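(* Let $(K_j)$ be a sequence of compact subsets of $\mathbb{R}^n$ with $\lim_{j\to\infty}\max_{x\in K_j}\mathrm{dist}(x,M)=0$, let $\mu\in\mathcal{M}_p(\Omega;M)$ and let $A\in\mathscr A(\Omega)$. Assume that $(\mathscr F_{K_j}(\cdot,A))$ $\Gamma$-converges in $L^0(\Omega)$ to $\mathscr F^\mu(\cdot,A)$. Then every sequence $(u_j)$ of minimisers of the problems $$\min\Big\{\int_{A\setminus K_j}f(\nabla u)\,dx+\int_A g(x,u)\,dx\ :\ u\in L^0(A),\ u|_{A\setminus K_j}\in L^{1,p}(A\setminus K_j)\Big\}\qquad(P_j)$$ has a subsequence which converges in $L^q(A)$ to a minimiser of the problem $$\min_{u\in L^{1,p}(A\setminus M)}\Big\{\int_{A\setminus M}f(\nabla u)\,dx+\int_{A\cap M}[u]^p\,d\mu+\int_A g(x,u)\,dx\Big\}.\qquad(P)$$ Moreover, the minimum values of $(P_j)$ converge, as $j\to\infty$, to the minimum value of $(P)$.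
   Context: Standing assumptions: $\Omega\subset\mathbb{R}^n$, $n\ge2$, is a bounded open set; $1<p\le n$; $f:\mathbb{R}^n\to[0,\infty)$ is convex, even, positively homogeneous of degree $p$, and $\lambda|\xi|^p\le f(\xi)\le\Lambda|\xi|^p$ for all $\xi$, with $0<\lambda<\Lambda<\infty$; $M\subset\Omega$ is a compact $(n-1)$-dimensional $C^1$ manifold with boundary; $1\le q<\infty$ and $g:\Omega\times\mathbb{R}\to[0,\infty)$ is such that $g(\cdot,s)$ is measurable for all $s\in\mathbb{R}$, $g(x,\cdot)$ is continuous for a.e. $x\in\Omega$, and $c_1|s|^q-a_1(x)\le g(x,s)\le c_2(1+|s|^q+a_2(x))$ for a.e. $x\in\Omega$ and all $s\in\mathbb{R}$, with constants $0<c_1<c_2<\infty$ and functions $a_1,a_2\in L^1(\Omega)$. Notation. $\mathscr A(\Omega)$ is the family of open subsets of $\Omega$. $L^0(A)$ is the space of (classes of) real measurable functions on $A$ with the topology of convergence in measure. For $A$ open, $L^{1,p}(A)$ is the Deny-Lions space of all $u\in L^1_{\rm loc}(A)$ whose distributional gradient is in $L^p(A;\mathbb{R}^n)$. The $p$-capacity of $E\subset\Omega$ is $C_{1,p}(E)=\inf\int_\Omega|\nabla u|^p\,dx$ over all $u\in W^{1,p}_0(\Omega)$ with $u\ge1$ a.e. in an open neighbourhood of $E$; "$p$-q.e." means up to a set of $p$-capacity zero. $\mathcal{M}_p(\Omega;M)$ is the class of all Borel measures $\mu$ on $\Omega$ with values in $[0,\infty]$ such that $\mu(B)=0$ for every Borel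 $B\subset\Omega$ with $C_{1,p}(B)=0$, and $\mu(\Omega\setminus M)=0$. Jump: for $u\in L^{1,p}(A\setminus M)$ and $p$-q.e. $x\in A\cap M$, $[u](x)=\big|\lim_{\rho\to0^+}⨍_{B^+_{\rho,\nu}(x)}u\,dy-\lim_{\rho\to0^+}⨍_{B^-_{\rho,\nu}(x)}u\,dy\big|$, where ⨍ denotes the mean value integral, $\nu$ is a unit normal to $M$ at $x$ and $B^\pm_{\rho,\nu}(x)=\{y\in B_\rho(x):\pm(y-x)\cdot\nu>0\}$ (these limits exist $p$-q.e.). Functionals: for $u\in L^0(\Omega)$, $\mathscr F_{K_j}(u,A)=\int_{A\setminus K_j}f(\nabla u)\,dx$ if $u|_{A\setminus K_j}\in L^{1,p}(A\setminus K_j)$ and $\infty$ otherwise; $\mathscr F^\mu(u,A)=\int_{A\setminus M}f(\nabla u)\,dx+\int_{A\cap M}[u]^p\,d\mu$ if $u|_{A\setminus M}\in L^{1,p}(A\setminus M)$ and $\infty$ otherwise. *)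

theory Defs
  imports "HOL-Analysis.Analysis"
begin

section \<open>Function spaces\<close>

text \<open>
  Classes of measurable functions are represented by total functions, of which only the
  values on the set in question matter; every notion below is invariant under changes on
  a Lebesgue null set.
\<close>

definition L0 :: "'a::euclidean_space set \<Rightarrow> ('a \<Rightarrow> real) set" where
  "L0 A = borel_measurable (lebesgue_on A)"

definition converges_in_measure ::
    "'a::euclidean_space set \<Rightarrow> (nat \<Rightarrow> 'a \<Rightarrow> real) \<Rightarrow> ('a \<Rightarrow> real) \<Rightarrow> bool" where
  "converges_in_measure A u v \<longleftrightarrow>
     (\<forall>\<epsilon>>0. (\<lambda>j. emeasure lebesgue {x \<in> A. \<bar>u j x - v x\<bar> > \<epsilon>}) \<longlonglongrightarrow> 0)"

definition Lp :: "real \<Rightarrow> 'a::euclidean_space set \<Rightarrow> ('a \<Rightarrow> 'b::euclidean_space) set" where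
  "Lp p A = {v \<in> borel_measurable (lebesgue_on A).
               integrable (lebesgue_on A) (\<lambda>x. norm (v x) powr p)}"

definition converges_in_Lp ::
    "real \<Rightarrow> 'a::euclidean_space set \<Rightarrow> (nat \<Rightarrow> 'a \<Rightarrow> 'b::euclidean_space) \<Rightarrow> ('a \<Rightarrow> 'b) \<Rightarrow> bool"
  where
  "converges_in_Lp p A u v \<longleftrightarrow> (\<forall>j. u j \<in> Lp p A) \<and> v \<in> Lp p A \<and>
     (\<lambda>j. \<integral>\<^sup>+x\<in>A. ennreal (norm (u j x - v x) powr p) \<partial>lebesgue) \<longlonglongrightarrow> 0"

definition L1_loc :: "'a::euclidean_space set \<Rightarrow> ('a \<Rightarrow> 'b::euclidean_space) set" where
  "L1_loc A = {u. \<forall>C. compact C \<and> C \<subseteq> A \<longrightarrow> set_integrable lebesgue C u}"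

primrec C_k :: "nat \<Rightarrow> ('a::euclidean_space \<Rightarrow> real) \<Rightarrow> bool" where
  "C_k 0 \<phi> \<longleftrightarrow> continuous_on UNIV \<phi>"
| "C_k (Suc k) \<phi> \<longleftrightarrow> (\<forall>x. \<phi> differentiable at x) \<and>
     (\<forall>b\<in>Basis. C_k k (\<lambda>x. frechet_derivative \<phi> (at x) b))"

definition test_functions :: "'a::euclidean_space set \<Rightarrow> ('a \<Rightarrow> real) set" where
  "test_functions A = {\<phi>. (\<forall>k. C_k k \<phi>) \<and>
     compact (closure {x. \<phi> x \<noteq> 0}) \<and> closure {x. \<phi> x \<noteq> 0} \<subseteq> A}"

definition classical_grad :: "('a::euclidean_space \<Rightarrow> real) \<Rightarrow> 'a \<Rightarrow> 'a" where
  "classical_grad \<phi> x = (\<Sum>b\<in>Basis. frechet_derivative \<phi> (at x) b *\<^sub>R b)"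

definition is_weak_grad ::
    "'a::euclidean_space set \<Rightarrow> ('a \<Rightarrow> real) \<Rightarrow> ('a \<Rightarrow> 'a) \<Rightarrow> bool" where
  "is_weak_grad A u v \<longleftrightarrow> u \<in> L1_loc A \<and> v \<in> L1_loc A \<and>
     (\<forall>\<phi>\<in>test_functions A. \<forall>b\<in>Basis.
        (LINT x:A|lebesgue. u x * (classical_grad \<phi> x \<bullet> b))
          = - (LINT x:A|lebesgue. (v x \<bullet> b) * \<phi> x))"

text \<open>The distributional gradient; unique up to null sets when it exists.\<close>

definition weak_grad :: "'a::euclidean_space set \<Rightarrow> ('a \<Rightarrow> real) \<Rightarrow> 'a \<Rightarrow> 'a" where
  "weak_grad A u = (SOME v. is_weak_grad A u v)"

definition deny_lions :: "real \<Rightarrow> 'a::euclidean_space set \<Rightarrow> ('a \<Rightarrow> real) set" where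
  "deny_lions p A = {u. \<exists>v. is_weak_grad A u v \<and> v \<in> Lp p A}"

text \<open>The closure of the test functions in the usual norm of \<open>W\<^sup>1\<^sup>,\<^sup>p(A)\<close>.\<close>

definition W01 :: "real \<Rightarrow> 'a::euclidean_space set \<Rightarrow> ('a \<Rightarrow> real) set" where
  "W01 p A = {u \<in> Lp p A \<inter> deny_lions p A. \<exists>\<phi>. (\<forall>k. \<phi> k \<in> test_functions A) \<and>
     converges_in_Lp p A \<phi> u \<and>
     converges_in_Lp p A (\<lambda>k. classical_grad (\<phi> k)) (weak_grad A u)}"


section \<open>Capacity\<close>

text \<open>
  Since \<open>\<Omega>\<close> is open, restricting to neighbourhoods contained in \<open>\<Omega>\<close> is no loss for
  \<open>E \<subseteq> \<Omega>\<close>. The capacity is infinite if there is no admissible function.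
\<close>

definition capacity :: "real \<Rightarrow> 'a::euclidean_space set \<Rightarrow> 'a set \<Rightarrow> ennreal" where
  "capacity p \<Omega> E =
     (INF u \<in> {u \<in> W01 p \<Omega>. \<exists>U. open U \<and> E \<subseteq> U \<and> U \<subseteq> \<Omega> \<and> (AE x in lebesgue_on U. u x \<ge> 1)}.
        \<integral>\<^sup>+x\<in>\<Omega>. ennreal (norm (weak_grad \<Omega> u x) powr p) \<partial>lebesgue)"

definition M_p :: "real \<Rightarrow> 'a::euclidean_space set \<Rightarrow> 'a set \<Rightarrow> 'a measure set" where
  "M_p p \<Omega> M = {\<mu>. space \<mu> = \<Omega> \<and> sets \<mu> = sets (restrict_space borel \<Omega>) \<and>
     (\<forall>B\<in>sets \<mu>. capacity p \<Omega> B = 0 \<longrightarrow> emeasure \<mu> B = 0) \<and> emeasure \<mu> (\<Omega> - M) = 0}"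


section \<open>Hypersurfaces with boundary and jumps\<close>

definition C1_with_derivative ::
    "'a::euclidean_space set \<Rightarrow> ('a \<Rightarrow> 'a) \<Rightarrow> ('a \<Rightarrow> 'a \<Rightarrow>\<^sub>L 'a) \<Rightarrow> bool" where
  "C1_with_derivative U \<Phi> \<Phi>' \<longleftrightarrow>
     (\<forall>x\<in>U. (\<Phi> has_derivative blinfun_apply (\<Phi>' x)) (at x)) \<and> continuous_on U \<Phi>'"

text \<open>
  A chart is a \<open>C\<^sup>1\<close> diffeomorphism between open sets of the ambient space which takes \<open>M\<close>
  to a piece of a half-hyperplane \<open>{y. y \<bullet> e = 0 \<and> y \<bullet> e' \<ge> 0}\<close>. Interior points of \<open>M\<close> are
  those mapped to \<open>y \<bullet> e' > 0\<close>; the boundary of \<open>M\<close> may be empty.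
\<close>

definition hypersurface_chart ::
    "'a::euclidean_space set \<Rightarrow> 'a set \<Rightarrow> ('a \<Rightarrow> 'a) \<Rightarrow> ('a \<Rightarrow> 'a \<Rightarrow>\<^sub>L 'a) \<Rightarrow> 'a \<Rightarrow> bool" where
  "hypersurface_chart M U \<Phi> \<Phi>' e \<longleftrightarrow> open U \<and> C1_with_derivative U \<Phi> \<Phi>' \<and>
     (\<exists>V \<Psi> \<Psi>'. open V \<and> homeomorphism U V \<Phi> \<Psi> \<and> C1_with_derivative V \<Psi> \<Psi>' \<and>
        (\<exists>e'. e \<in> Basis \<and> e' \<in> Basis \<and> e \<noteq> e' \<and>
           \<Phi> ` (M \<inter> U) = V \<inter> {y. y \<bullet> e = 0 \<and> y \<bullet> e' \<ge> 0}))"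

definition C1_hypersurface_with_boundary :: "'a::euclidean_space set \<Rightarrow> bool" where
  "C1_hypersurface_with_boundary M \<longleftrightarrow>
     (\<forall>x\<in>M. \<exists>U \<Phi> \<Phi>' e. x \<in> U \<and> hypersurface_chart M U \<Phi> \<Phi>' e)"

text \<open>At boundary points this is the full hyperplane; it does not depend on the chart.\<close>

definition tangent_space :: "'a::euclidean_space set \<Rightarrow> 'a \<Rightarrow> 'a set" where
  "tangent_space M x = {v. \<exists>U \<Phi> \<Phi>' e. x \<in> U \<and> hypersurface_chart M U \<Phi> \<Phi>' e \<and>
     blinfun_apply (\<Phi>' x) v \<bullet> e = 0}"

definition unit_normal :: "'a::euclidean_space set \<Rightarrow> 'a \<Rightarrow> 'a \<Rightarrow> bool" where
  "unit_normal M x \<nu> \<longleftrightarrow> norm \<nu> = 1 \<and> (\<forall>v\<in>tangent_space M x. v \<bullet> \<nu> = 0)"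

definition half_ball :: "'a::euclidean_space \<Rightarrow> 'a \<Rightarrow> real \<Rightarrow> 'a set" where
  "half_ball \<nu> x \<rho> = {y \<in> ball x \<rho>. (y - x) \<bullet> \<nu> > 0}"

definition mean_value :: "'a::euclidean_space set \<Rightarrow> ('a \<Rightarrow> real) \<Rightarrow> real" where
  "mean_value S u = (LINT y:S|lebesgue. u y) / measure lebesgue S"

text \<open>
  The unit normal is unique up to its sign, on which the jump does not depend. The value is
  meaningful only where the two limits exist, which is the case quasi-everywhere on
  \<open>A \<inter> M\<close> for \<open>u \<in> deny_lions p (A - M)\<close>.
\<close>

definition jump :: "'a::euclidean_space set \<Rightarrow> ('a \<Rightarrow> real) \<Rightarrow> 'a \<Rightarrow> real" where
  "jump M u x = (let \<nu> = (SOME \<nu>. unit_normal M x \<nu>) in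
     \<bar>Lim (at_right 0) (\<lambda>\<rho>. mean_value (half_ball \<nu> x \<rho>) u)
      - Lim (at_right 0) (\<lambda>\<rho>. mean_value (half_ball (- \<nu>) x \<rho>) u)\<bar>)"


section \<open>Functionals and Gamma-convergence\<close>

definition F_crack ::
    "real \<Rightarrow> ('a::euclidean_space \<Rightarrow> real) \<Rightarrow> 'a set \<Rightarrow> ('a \<Rightarrow> real) \<Rightarrow> 'a set \<Rightarrow> ennreal" where
  "F_crack p f K u A =
     (if u \<in> deny_lions p (A - K)
      then \<integral>\<^sup>+x\<in>A - K. ennreal (f (weak_grad (A - K) u x)) \<partial>lebesgue else \<infinity>)"

definition F_meas ::
    "real \<Rightarrow> ('a::euclidean_space \<Rightarrow> real) \<Rightarrow> 'a set \<Rightarrow> 'a measure \<Rightarrow> ('a \<Rightarrow> real) \<Rightarrow> 'a set \<Rightarrow> ennreal"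
  where
  "F_meas p f M \<mu> u A =
     (if u \<in> deny_lions p (A - M)
      then (\<integral>\<^sup>+x\<in>A - M. ennreal (f (weak_grad (A - M) u x)) \<partial>lebesgue)
         + (\<integral>\<^sup>+x\<in>A \<inter> M. ennreal (jump M u x powr p) \<partial>\<mu>) else \<infinity>)"

text \<open>
  Gamma-convergence with respect to a notion of sequential convergence on \<open>X\<close>. On a set of
  finite measure, convergence in measure is induced by a pseudometric, so that this is
  Gamma-convergence for that topology.
\<close>

definition gamma_converges ::
    "'b set \<Rightarrow> ((nat \<Rightarrow> 'b) \<Rightarrow> 'b \<Rightarrow> bool) \<Rightarrow> (nat \<Rightarrow> 'b \<Rightarrow> ennreal) \<Rightarrow> ('b \<Rightarrow> ennreal) \<Rightarrow> bool" where
  "gamma_converges X conv F G \<longleftrightarrow> (\<forall>u\<in>X.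
     (\<forall>v. (\<forall>j. v j \<in> X) \<and> conv v u \<longrightarrow> G u \<le> liminf (\<lambda>j. F j (v j))) \<and>
     (\<exists>v. (\<forall>j. v j \<in> X) \<and> conv v u \<and> limsup (\<lambda>j. F j (v j)) \<le> G u))"


section \<open>The minimum problems\<close>

definition lower_order ::
    "('a::euclidean_space \<Rightarrow> real \<Rightarrow> real) \<Rightarrow> ('a \<Rightarrow> real) \<Rightarrow> 'a set \<Rightarrow> ennreal" where
  "lower_order g u A = (\<integral>\<^sup>+x\<in>A. ennreal (g x (u x)) \<partial>lebesgue)"

definition admissible_crack :: "real \<Rightarrow> 'a::euclidean_space set \<Rightarrow> 'a set \<Rightarrow> ('a \<Rightarrow> real) set" where
  "admissible_crack p K A = L0 A \<inter> deny_lions p (A - K)"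

definition energy_crack where
  "energy_crack p f g K A u = F_crack p f K u A + lower_order g u A"

definition energy_meas where
  "energy_meas p f g M \<mu> A u = F_meas p f M \<mu> u A + lower_order g u A"

end

theory Submission
  imports Defs "HOL-Complex_Analysis.Great_Picard" "HOL-Library.Diagonal_Subsequence"
begin

text \<open>
  The minimum values of the approximating problems are squeezed between a lower and an upper
  bound, both equal to the minimum value of the limit problem.

  \<^emph>\<open>Lower bound.\<close> The zero function bounds all minimum values at once. Functions of bounded energy
  are bounded in \<open>L\<^sup>q(A)\<close>, by the growth of \<open>g\<close> from below, and have gradients bounded in \<open>L\<^sup>p\<close>. Every
  compact part of \<open>A - M\<close> is disjoint from \<open>K j\<close> for large \<open>j\<close>, so a Rellich argument on such parts
  and a diagonal sequence yield a subsequence that converges almost everywhere in \<open>A\<close>, because \<open>M\<close>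
  is a null set (\<open>compactness\<close>). Along it the liminf inequality of the Gamma-convergence and
  Fatou's lemma bound the energy of the limit by the lower limit of the energies
  (\<open>energy_liminf\<close>); for near-minimisers this is \<open>minima_le_liminf\<close>.

  \<^emph>\<open>Upper bound.\<close> A competitor \<open>w\<close> of finite energy has a recovery sequence, but this converges only
  in measure, and the lower order term is not continuous for that convergence. The members of the
  recovery sequence are therefore composed with the smooth bounded contraction
  \<open>k * arctan (s / k)\<close>. By the chain rule and homogeneity this does not increase the gradient
  energies on \<open>A - K j\<close>, while for fixed \<open>k\<close> the lower order terms converge by dominated convergence
  (\<open>limsup_truncated\<close>). Since \<open>w\<close> lies in \<open>L\<^sup>q(A)\<close>, a second dominated convergence lets \<open>k\<close> tend to
  infinity (\<open>limsup_minima_le\<close>). Truncating the recovery sequence rather than \<open>w\<close> avoids any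
  comparison of the jump of \<open>w\<close> with the jump of its truncation, which would require the fine
  properties of Sobolev functions.

  \<^emph>\<open>Minimisers.\<close> A subsequence of minimisers converges almost everywhere to a minimiser of the limit
  problem. The two parts of the energy satisfy separate liminf inequalities and their sum
  converges, so each part converges. Scheffe's lemma turns this into convergence in \<open>L\<^sup>1\<close> of
  \<open>g x (u j x)\<close>, and the growth of \<open>g\<close> from below into convergence of \<open>u j\<close> in \<open>L\<^sup>q(A)\<close>
  (\<open>converges_in_Lq\<close>).

  The facts about weak gradients that this uses are uniqueness, the chain rule for bounded
  continuously differentiable functions of derivative at most one, and a Rellich estimate. All
  three come from mollification: on a compact part of the domain a function and its weak
  gradient are replaced by integrable functions \<open>u\<close>, \<open>v\<close> such that the mollifications of
  \<open>u\<close> are differentiable and their gradient is the mollification of \<open>v\<close>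
  (\<open>mollified_grad\<close>).
\<close>

section \<open>Smooth bumps\<close>

text \<open>
  For \<open>m = 0\<close> this is the classical flat function. The powers in the denominator make the family
  closed under differentiation, up to linear combinations.
\<close>

definition flat_exp :: "nat \<Rightarrow> real \<Rightarrow> real" where
  "flat_exp m t = (if t \<le> 0 then 0 else exp (- (1 / t)) / t ^ m)"

text \<open>
  A single term of the exponential series bounds \<open>exp (1 / t)\<close> from below by a multiple of
  \<open>(1 / t) ^ (m + 2)\<close>; the surplus \<open>t\<^sup>2\<close> makes the derivative at 0 vanish.
\<close>

lemma flat_exp_le: "\<bar>flat_exp m t\<bar> \<le> fact (m + 2) * t\<^sup>2"
proof (cases "t \<le> 0")
  case True then show ?thesis by (simp add: flat_exp_def)
next
  case False
  then have t: "t > 0" by simp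
  define c :: real where "c = fact (m + 2)"
  have c: "c > 0" by (simp add: c_def)
  have "(1 / t) ^ (m + 2) / c \<le> exp (1 / t)"
    unfolding exp_def c_def using t
    by (intro order_trans[OF _ sum_le_suminf[OF summable_exp_generic[of "1 / t"], of "{m + 2}"]])
      (auto simp: divide_inverse mult.commute)
  then have "exp (- (1 / t)) \<le> c * t ^ (m + 2)"
    using t c by (simp add: exp_minus field_simps)
  then have "exp (- (1 / t)) / t ^ m \<le> c * t\<^sup>2"
    using t by (simp add: divide_le_eq power_add power2_eq_square algebra_simps)
  then show ?thesis using t by (simp add: flat_exp_def c_def)
qed

lemma DERIV_flat_exp:
  "(flat_exp m has_real_derivative flat_exp (m + 2) t - m * flat_exp (m + 1) t) (at t)"
proof -
  consider "t < 0" | "t = 0" | "t > 0" by linarith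
  then show ?thesis
  proof cases
    case 1
    have "(flat_exp m has_real_derivative 0) (at t)"
    proof (rule has_field_derivative_transform_within_open[of "\<lambda>_. 0" _ _ "{..<0}"])
      show "\<And>x. x \<in> {..<0} \<Longrightarrow> 0 = flat_exp m x"
        by (auto simp: flat_exp_def)
    qed (use 1 in auto)
    then show ?thesis using 1 by (simp add: flat_exp_def)
  next
    case 2
    have "(\<lambda>y. flat_exp m y / y) \<midarrow>0\<rightarrow> 0"
    proof (rule tendsto_0_le[of "\<lambda>y::real. y" _ _ "fact (m + 2)"])
      show "\<forall>\<^sub>F y in at 0. norm (flat_exp m y / y) \<le> norm y * fact (m + 2)"
      proof (rule always_eventually, rule allI)
        fix y :: real
        show "norm (flat_exp m y / y) \<le> norm y * fact (m + 2)"
        proof (cases "y = 0")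
          case False
          have "\<bar>flat_exp m y\<bar> \<le> (\<bar>y\<bar> * fact (m + 2)) * \<bar>y\<bar>"
            using flat_exp_le[of m y] by (simp only: power2_eq_square ac_simps abs_mult_self_eq)
          then show ?thesis using False by (simp only: real_norm_def abs_divide divide_le_eq) auto
        qed auto
      qed
    qed (auto intro: tendsto_eq_intros)
    then show ?thesis unfolding 2 by (simp add: has_field_derivative_iff flat_exp_def)
  next
    case 3
    have "((\<lambda>t. exp (- (1 / t)) / t ^ m) has_real_derivative
       flat_exp (m + 2) t - m * flat_exp (m + 1) t) (at t)"
    proof (cases m)
      case 0 then show ?thesis using 3
        by (auto intro!: derivative_eq_intros simp: flat_exp_def power2_eq_square field_simps)
    next
      case (Suc k)
      define E where "E = exp (- (1 / t))"
      have e: "((\<lambda>t. exp (- (1 / t))) has_real_derivative E * (1 / t\<^sup>2)) (at t)"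
        using 3 by (auto intro!: derivative_eq_intros simp: power2_eq_square E_def)
      have "((\<lambda>t. t ^ Suc k) has_real_derivative real (Suc k) * t ^ k) (at t)"
        using DERIV_pow[of "Suc k" t] by simp
      from DERIV_divide[OF e this] have "((\<lambda>t. exp (- (1 / t)) / t ^ Suc k) has_real_derivative
        (E * (1 / t\<^sup>2) * t ^ Suc k - E * (real (Suc k) * t ^ k)) / (t ^ Suc k * t ^ Suc k)) (at t)"
        using 3 by (simp add: E_def)
      moreover have "(E * (1 / t\<^sup>2) * t ^ Suc k - E * (real (Suc k) * t ^ k)) / (t ^ Suc k * t ^ Suc k)
         = E / t ^ (Suc k + 2) - real (Suc k) * (E / t ^ (Suc k + 1))"
        using 3 by (simp add: divide_simps power2_eq_square) (simp add: algebra_simps)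
      moreover have "E / t ^ (Suc k + 2) = flat_exp (m + 2) t" "E / t ^ (Suc k + 1) = flat_exp (m + 1) t"
        using 3 Suc by (simp_all only: flat_exp_def E_def not_le[symmetric] if_False)
      ultimately show ?thesis unfolding Suc by (simp only:)
    qed
    then show ?thesis
      by (rule has_field_derivative_transform_within_open[of _ _ _ "{0<..}"]) (use 3 in \<open>auto simp: flat_exp_def\<close>)
  qed
qed

lemma C_k_pred: "C_k (Suc k) \<phi> \<Longrightarrow> C_k k \<phi>"
proof (induction k arbitrary: \<phi>)
  case 0
  then show ?case by (auto intro!: continuous_at_imp_continuous_on differentiable_imp_continuous_within)
next
  case (Suc k)
  then show ?case by simp
qed

lemma C_k_const: "C_k k (\<lambda>_. c)"
  by (induction k arbitrary: c) auto

lemma C_k_add: "C_k k \<phi> \<Longrightarrow> C_k k \<psi> \<Longrightarrow> C_k k (\<lambda>x. \<phi> x + \<psi> x)"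
proof (induction k arbitrary: \<phi> \<psi>)
  case 0 then show ?case by (auto intro: continuous_intros)
next
  case (Suc k)
  have "frechet_derivative (\<lambda>x. \<phi> x + \<psi> x) (at x) = (\<lambda>b. frechet_derivative \<phi> (at x) b + frechet_derivative \<psi> (at x) b)" for x
    using Suc.prems by (intro frechet_derivative_at[symmetric] has_derivative_add) (auto simp: frechet_derivative_works)
  then show ?case using Suc by auto
qed

lemma C_k_mult: "C_k k \<phi> \<Longrightarrow> C_k k \<psi> \<Longrightarrow> C_k k (\<lambda>x. \<phi> x * \<psi> x)"
proof (induction k arbitrary: \<phi> \<psi>)
  case 0 then show ?case by (auto intro: continuous_intros)
next
  case (Suc k)
  have "frechet_derivative (\<lambda>x. \<phi> x * \<psi> x) (at x)
      = (\<lambda>b. \<phi> x * frechet_derivative \<psi> (at x) b + frechet_derivative \<phi> (at x) b * \<psi> x)" for x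
    using Suc.prems by (intro frechet_derivative_at[symmetric] has_derivative_mult) (auto simp: frechet_derivative_works)
  moreover have "C_k k \<phi>" "C_k k \<psi>" using Suc.prems by (blast intro: C_k_pred)+
  ultimately show ?case using Suc by (auto intro!: C_k_add differentiable_mult)
qed

lemma C_k_inner: "C_k k (\<lambda>x. (x - z) \<bullet> b)"
proof (cases k)
  case 0 then show ?thesis by (auto intro!: continuous_intros)
next
  case (Suc j)
  have "frechet_derivative (\<lambda>x. (x - z) \<bullet> b) (at x) = (\<lambda>c. c \<bullet> b)" for x
    by (intro frechet_derivative_at[symmetric] derivative_eq_intros) auto
  then show ?thesis using Suc by (auto intro: C_k_const)
qed

lemma has_derivative_flat_exp_sphere:
  fixes z x :: "'a::euclidean_space"
  shows "((\<lambda>y. flat_exp m (r\<^sup>2 - (y - z) \<bullet> (y - z))) has_derivative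
     (\<lambda>b. (flat_exp (m + 2) (r\<^sup>2 - (x - z) \<bullet> (x - z)) + (- real m) * flat_exp (m + 1) (r\<^sup>2 - (x - z) \<bullet> (x - z)))
          * (- 2 * ((x - z) \<bullet> b)))) (at x)"
proof -
  have "((\<lambda>y. r\<^sup>2 - (y - z) \<bullet> (y - z)) has_derivative (\<lambda>b. - 2 * ((x - z) \<bullet> b))) (at x)"
    by (auto intro!: derivative_eq_intros simp: inner_commute)
  from has_derivative_compose[OF this DERIV_flat_exp[unfolded has_field_derivative_def]]
  show ?thesis by (simp add: o_def)
qed

text \<open>
  A partial derivative combines two members of the family, with larger \<open>m\<close>, and a linear
  function. Hence the induction on \<open>k\<close> has to treat all \<open>m\<close> simultaneously.
\<close>

lemma C_k_flat_exp_sphere: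
  fixes z :: "'a::euclidean_space"
  shows "C_k k (\<lambda>y. flat_exp m (r\<^sup>2 - (y - z) \<bullet> (y - z)))"
proof (induction k arbitrary: m)
  case 0
  show ?case
    using has_derivative_continuous[OF has_derivative_flat_exp_sphere]
    by (auto intro!: continuous_at_imp_continuous_on)
next
  case (Suc k)
  have "frechet_derivative (\<lambda>y. flat_exp m (r\<^sup>2 - (y - z) \<bullet> (y - z))) (at x) =
     (\<lambda>b. (flat_exp (m + 2) (r\<^sup>2 - (x - z) \<bullet> (x - z)) + (- real m) * flat_exp (m + 1) (r\<^sup>2 - (x - z) \<bullet> (x - z)))
          * (- 2 * ((x - z) \<bullet> b)))" for x
    by (rule frechet_derivative_at[symmetric, OF has_derivative_flat_exp_sphere])
  moreover have "(\<lambda>y. flat_exp m (r\<^sup>2 - (y - z) \<bullet> (y - z))) differentiable at x" for x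
    using has_derivative_flat_exp_sphere by (rule differentiableI)
  ultimately show ?case
    unfolding C_k.simps by (simp only:) (intro conjI allI ballI TrueI C_k_mult C_k_add C_k_const C_k_inner Suc.IH)
qed

definition bump :: "real \<Rightarrow> 'a::euclidean_space \<Rightarrow> real" where
  "bump r y = flat_exp 0 (r\<^sup>2 - y \<bullet> y)"

lemma bump_nonneg: "0 \<le> bump r y"
  by (simp add: bump_def flat_exp_def)

lemma bump_pos_iff: "0 < r \<Longrightarrow> 0 < bump r y \<longleftrightarrow> norm y < r"
  using abs_le_square_iff[of r "norm y"]
  by (auto simp: bump_def flat_exp_def dot_square_norm not_le)

lemma bump_nonzero_iff: "0 < r \<Longrightarrow> bump r y \<noteq> 0 \<longleftrightarrow> norm y < r"
  using bump_pos_iff[of r y] bump_nonneg[of r y] by linarith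

lemma bump_minus: "bump r (x - y) = bump r (y - x)"
  by (simp add: bump_def dot_square_norm norm_minus_commute)

lemma bump_test_function:
  fixes x :: "'a::euclidean_space"
  assumes "0 < r" "cball x r \<subseteq> A"
  shows "(\<lambda>y. bump r (y - x)) \<in> test_functions A"
proof -
  have "{y. bump r (y - x) \<noteq> 0} = ball x r"
    unfolding set_eq_iff mem_Collect_eq mem_ball dist_norm bump_nonzero_iff[OF assms(1)]
    by (metis norm_minus_commute)
  then have "closure {y. bump r (y - x) \<noteq> 0} = cball x r" using assms(1) by simp
  moreover have "C_k k (\<lambda>y. bump r (y - x))" for k
    unfolding bump_def by (rule C_k_flat_exp_sphere)
  ultimately show ?thesis using assms(2) unfolding test_functions_def
    by (simp only: mem_Collect_eq compact_cball) simp
qed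

lemma continuous_bump: "continuous_on UNIV (bump r :: 'a::euclidean_space \<Rightarrow> real)"
  using C_k_flat_exp_sphere[of 0 0 r "0::'a"] by (simp add: bump_def[abs_def])

text \<open>
  The partial derivatives are continuous and vanish outside a compact set, so they are bounded.
  The Lipschitz constant is what dominates difference quotients under integrals below.
\<close>

lemma test_function_Lipschitz:
  assumes "\<phi> \<in> test_functions A"
  obtains L where "L \<ge> 0" "\<And>x y. \<bar>\<phi> x - \<phi> y\<bar> \<le> L * norm (x - y)"
proof -
  define S where "S = closure {x. \<phi> x \<noteq> 0}"
  have S: "compact S" and C: "\<And>k. C_k k \<phi>" using assms by (auto simp: test_functions_def S_def)
  from C[of 1] have diff: "\<And>x. \<phi> differentiable at x"
    and cont: "\<And>b. b \<in> Basis \<Longrightarrow> continuous_on UNIV (\<lambda>x. frechet_derivative \<phi> (at x) b)"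
    by auto
  have "\<forall>b\<in>Basis. \<exists>B\<ge>0. \<forall>x\<in>S. \<bar>frechet_derivative \<phi> (at x) b\<bar> \<le> B"
  proof
    fix b :: 'a assume "b \<in> Basis"
    then have "compact ((\<lambda>x. frechet_derivative \<phi> (at x) b) ` S)"
      using S cont by (metis compact_continuous_image continuous_on_subset subset_UNIV)
    then obtain B where "\<forall>y\<in>(\<lambda>x. frechet_derivative \<phi> (at x) b) ` S. \<bar>y\<bar> \<le> B"
      using bounded_real compact_imp_bounded by metis
    then show "\<exists>B\<ge>0. \<forall>x\<in>S. \<bar>frechet_derivative \<phi> (at x) b\<bar> \<le> B"
      by (intro exI[of _ "max 0 B"]) auto
  qed
  then obtain B where B: "\<And>b. b \<in> Basis \<Longrightarrow> B b \<ge> 0"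
    "\<And>b x. b \<in> Basis \<Longrightarrow> x \<in> S \<Longrightarrow> \<bar>frechet_derivative \<phi> (at x) b\<bar> \<le> B b" by metis
  have zero: "frechet_derivative \<phi> (at x) = (\<lambda>_. 0)" if "x \<notin> S" for x
  proof -
    have "(\<phi> has_derivative (\<lambda>_. 0)) (at x)"
    proof (rule has_derivative_transform_within_open[of "\<lambda>_. 0" _ _ _ "- S"])
      show "open (- S)" using S by (simp add: compact_imp_closed open_Compl)
      show "\<And>y. y \<in> - S \<Longrightarrow> 0 = \<phi> y" using closure_subset[of "{x. \<phi> x \<noteq> 0}"] by (auto simp: S_def)
    qed (use that in auto)
    then show ?thesis by (rule frechet_derivative_at[symmetric])
  qed
  have bd: "norm (frechet_derivative \<phi> (at x) h) \<le> (\<Sum>b\<in>Basis. B b) * norm h" for x h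
  proof -
    have lin: "linear (frechet_derivative \<phi> (at x))" by (rule linear_frechet_derivative[OF diff])
    have "frechet_derivative \<phi> (at x) h = frechet_derivative \<phi> (at x) (\<Sum>b\<in>Basis. (h \<bullet> b) *\<^sub>R b)"
      by (simp add: euclidean_representation)
    also have "\<dots> = (\<Sum>b\<in>Basis. (h \<bullet> b) * frechet_derivative \<phi> (at x) b)"
      by (simp only: linear_sum[OF lin] linear_cmul[OF lin] real_scaleR_def)
    finally have eq: "frechet_derivative \<phi> (at x) h = (\<Sum>b\<in>Basis. (h \<bullet> b) * frechet_derivative \<phi> (at x) b)" .
    have "norm (frechet_derivative \<phi> (at x) h) \<le> (\<Sum>b\<in>Basis. norm h * B b)"
      unfolding eq
    proof (rule order_trans[OF norm_sum], rule sum_mono)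
      fix b :: 'a assume b: "b \<in> Basis"
      have "\<bar>frechet_derivative \<phi> (at x) b\<bar> \<le> B b"
        using B[OF b] zero[of x] by (cases "x \<in> S") auto
      then show "norm ((h \<bullet> b) * frechet_derivative \<phi> (at x) b) \<le> norm h * B b"
        unfolding real_norm_def abs_mult by (rule mult_mono[OF Basis_le_norm[OF b]]) auto
    qed
    then show ?thesis by (simp add: sum_distrib_left mult.commute)
  qed
  show ?thesis
  proof (rule that)
    show "0 \<le> (\<Sum>b\<in>Basis. B b)" using B(1) by (simp add: sum_nonneg)
    show "\<bar>\<phi> x - \<phi> y\<bar> \<le> (\<Sum>b\<in>Basis. B b) * norm (x - y)" for x y
      unfolding real_norm_def[symmetric]
    proof (rule differentiable_bound[of UNIV])
      fix x
      show "(\<phi> has_derivative frechet_derivative \<phi> (at x)) (at x)"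
        using diff frechet_derivative_works by blast
      show "onorm (frechet_derivative \<phi> (at x)) \<le> (\<Sum>b\<in>Basis. B b)"
        by (rule onorm_bound[OF _ bd]) (simp add: B(1) sum_nonneg)
    qed auto
  qed
qed

section \<open>Mollification of integrable functions\<close>

lemma nn_integral_abs_triangle:
  fixes u v w :: "'a \<Rightarrow> real"
  assumes "u \<in> borel_measurable M" "v \<in> borel_measurable M" "w \<in> borel_measurable M"
  shows "(\<integral>\<^sup>+x. ennreal \<bar>u x - w x\<bar> \<partial>M) \<le> (\<integral>\<^sup>+x. ennreal \<bar>u x - v x\<bar> \<partial>M) + (\<integral>\<^sup>+x. ennreal \<bar>v x - w x\<bar> \<partial>M)"
  using assms by (subst nn_integral_add[symmetric])
    (auto intro!: nn_integral_mono simp flip: ennreal_plus)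

abbreviation L1_dist :: "('a::euclidean_space \<Rightarrow> real) \<Rightarrow> ('a \<Rightarrow> real) \<Rightarrow> ennreal" where
  "L1_dist u v \<equiv> \<integral>\<^sup>+x. ennreal \<bar>u x - v x\<bar> \<partial>lborel"

text \<open>
  A measurable function is an almost everywhere limit of continuous ones. Clipping values at
  height \<open>k\<close> and multiplying by a continuous cut-off near the ball of radius \<open>k\<close> provides
  dominating functions, so that dominated convergence applies twice: to the clipped \<open>u\<close> as \<open>k\<close>
  grows, and to the clipped continuous functions for a fixed \<open>k\<close>.
\<close>

lemma continuous_dense_L1:
  fixes u :: "'a::euclidean_space \<Rightarrow> real"
  assumes u: "integrable lborel u" and e: "0 < e"
  obtains g R where "continuous_on UNIV g" "\<And>x. R < norm x \<Longrightarrow> g x = 0" "L1_dist u g < ennreal e"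
proof -
  have [measurable]: "u \<in> borel_measurable borel" using u by auto
  \<comment> \<open>The second factor is a continuous cut-off, one on the ball of radius \<open>k\<close>.\<close>
  define cut where "cut k s x = max (- real k) (min (real k) s) * max 0 (min 1 (real k + 1 - norm x))" for k s and x :: 'a
  have cut_abs: "\<bar>cut k s x\<bar> \<le> \<bar>s\<bar>" and cut_bound: "\<bar>cut k s x\<bar> \<le> real k * indicator (cball 0 (real k + 1)) x" for k s x
    using mult_mono[of "\<bar>max (- real k) (min (real k) s)\<bar>" "\<bar>s\<bar>" "max 0 (min 1 (real k + 1 - norm x))" 1]
      mult_mono[of "\<bar>max (- real k) (min (real k) s)\<bar>" "real k" "max 0 (min 1 (real k + 1 - norm x))" "indicator (cball 0 (real k + 1)) x"]
    by (auto simp: cut_def abs_mult indicator_def)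
  have cut_cont: "continuous_on UNIV (\<lambda>x. cut k (g x) x)" if "continuous_on UNIV g" for k g
    unfolding cut_def by (intro continuous_intros that)
  have cut_meas[measurable]: "(\<lambda>x. cut k (g x) x) \<in> borel_measurable borel" if [measurable]: "g \<in> borel_measurable borel" for k g
    unfolding cut_def by measurable
  have cut_lim: "(\<lambda>n. cut k (g n) x) \<longlonglongrightarrow> cut k s x" if "g \<longlonglongrightarrow> s" for k s g x
    unfolding cut_def by (intro tendsto_intros that)
  have "(\<lambda>k. \<integral>\<^sup>+x. ennreal (norm (u x - cut k (u x) x)) \<partial>lborel) \<longlonglongrightarrow> 0"
  proof (rule nn_integral_dominated_convergence_norm)
    show "AE x in lborel. norm (cut k (u x) x) \<le> norm (u x)" for k using cut_abs by simp
    show "(\<integral>\<^sup>+x. ennreal (norm (u x)) \<partial>lborel) < \<infinity>" using u by (simp add: integrable_iff_bounded)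
    show "AE x in lborel. (\<lambda>k. cut k (u x) x) \<longlonglongrightarrow> u x"
    proof (rule AE_I2, rule tendsto_eventually)
      fix x
      obtain N :: nat where N: "\<bar>u x\<bar> + norm x \<le> real N" using real_arch_simple by blast
      have "cut k (u x) x = u x" if "k \<ge> N" for k
      proof -
        have "real N \<le> real k" using that by simp
        then have "\<bar>u x\<bar> \<le> real k" "norm x \<le> real k" using N norm_ge_zero[of x] by linarith+
        then have "max (- real k) (min (real k) (u x)) = u x" "max 0 (min 1 (real k + 1 - norm x)) = 1" by auto
        then show ?thesis by (simp add: cut_def)
      qed
      then show "\<forall>\<^sub>F k in sequentially. cut k (u x) x = u x" unfolding eventually_sequentially by blast
    qed
  qed auto
  from order_tendstoD(2)[OF this, of "ennreal (e / 2)"] e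
  obtain k where k: "(\<integral>\<^sup>+x. ennreal \<bar>u x - cut k (u x) x\<bar> \<partial>lborel) < ennreal (e / 2)"
    by (auto simp: eventually_sequentially)
  have "u measurable_on UNIV"
    by (rule lebesgue_measurable_imp_measurable_on_real) (auto simp: measurable_completion)
  then obtain N g where N: "negligible N" and g: "\<And>n. continuous_on UNIV (g n)" "\<And>x. x \<notin> N \<Longrightarrow> (\<lambda>n. g n x) \<longlonglongrightarrow> u x"
    unfolding measurable_on_def by auto
  have [measurable]: "g n \<in> borel_measurable borel" for n using g(1) by (rule borel_measurable_continuous_onI)
  have "AE x in lebesgue. x \<notin> N" using N by (intro AE_not_in) (simp add: negligible_iff_null_sets)
  then have "AE x in lborel. x \<notin> N" by (simp only: AE_completion_iff)
  then have lim: "AE x in lborel. (\<lambda>n. g n x) \<longlonglongrightarrow> u x" by eventually_elim (rule g(2))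
  have "(\<lambda>n. \<integral>\<^sup>+x. ennreal (norm (cut k (u x) x - cut k (g n x) x)) \<partial>lborel) \<longlonglongrightarrow> 0"
  proof (rule nn_integral_dominated_convergence_norm)
    show "AE x in lborel. norm (cut k (g n x) x) \<le> real k * indicator (cball 0 (real k + 1)) x" for n
      using cut_bound by simp
    have "(\<integral>\<^sup>+x. ennreal (real k * indicator (cball 0 (real k + 1)) (x::'a)) \<partial>lborel) = ennreal (real k) * emeasure lborel (cball (0::'a) (real k + 1))"
      by (simp add: ennreal_mult ennreal_indicator nn_integral_cmult_indicator)
    also have "\<dots> < \<infinity>" using emeasure_bounded_finite[OF bounded_cball] by (auto simp: ennreal_mult_less_top)
    finally show "(\<integral>\<^sup>+x. ennreal (real k * indicator (cball 0 (real k + 1)) (x::'a)) \<partial>lborel) < \<infinity>" .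
    show "(\<lambda>x::'a. real k * indicator (cball 0 (real k + 1)) x) \<in> borel_measurable lborel"
      by (intro borel_measurable_times borel_measurable_const borel_measurable_indicator) simp
    show "AE x in lborel. (\<lambda>n. cut k (g n x) x) \<longlonglongrightarrow> cut k (u x) x"
      using lim by eventually_elim (rule cut_lim)
  qed auto
  from order_tendstoD(2)[OF this, of "ennreal (e / 2)"] e
  obtain n where n: "(\<integral>\<^sup>+x. ennreal \<bar>cut k (u x) x - cut k (g n x) x\<bar> \<partial>lborel) < ennreal (e / 2)"
    by (auto simp: eventually_sequentially)
  show thesis
  proof (rule that[of "\<lambda>x. cut k (g n x) x"])
    show "continuous_on UNIV (\<lambda>x. cut k (g n x) x)" by (rule cut_cont[OF g(1)])
    show "cut k (g n x) x = 0" if "real k + 1 < norm x" for x using that by (simp add: cut_def)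
    have "(\<integral>\<^sup>+x. ennreal \<bar>u x - cut k (g n x) x\<bar> \<partial>lborel)
        \<le> (\<integral>\<^sup>+x. ennreal \<bar>u x - cut k (u x) x\<bar> \<partial>lborel) + (\<integral>\<^sup>+x. ennreal \<bar>cut k (u x) x - cut k (g n x) x\<bar> \<partial>lborel)"
      by (rule nn_integral_abs_triangle) auto
    also have "\<dots> < ennreal (e / 2) + ennreal (e / 2)" by (rule add_strict_mono[OF k n])
    also have "\<dots> = ennreal e" using e by (simp flip: ennreal_plus)
    finally show "(\<integral>\<^sup>+x. ennreal \<bar>u x - cut k (g n x) x\<bar> \<partial>lborel) < ennreal e" .
  qed
qed

definition mollifier :: "real \<Rightarrow> 'a::euclidean_space \<Rightarrow> real" where
  "mollifier r z = bump r z / (LINT w|lborel. bump r (w::'a))"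

lemma continuous_mollifier: "continuous_on UNIV (mollifier r :: 'a::euclidean_space \<Rightarrow> real)"
  unfolding mollifier_def[abs_def] divide_inverse by (intro continuous_intros continuous_bump)

lemma borel_measurable_mollifier[measurable]: "mollifier r \<in> borel_measurable borel"
  by (rule borel_measurable_continuous_onI[OF continuous_mollifier])

lemma integrable_continuous_bounded_support:
  fixes g :: "'a::euclidean_space \<Rightarrow> real"
  assumes "continuous_on UNIV g" "\<And>x. norm x > R \<Longrightarrow> g x = 0"
  shows "integrable lborel g"
proof -
  have "integrable lborel (\<lambda>x. indicator (cball 0 R) x *\<^sub>R g x)"
    by (rule borel_integrable_compact) (auto intro: continuous_on_subset[OF assms(1)])
  moreover have "(\<lambda>x. indicator (cball 0 R) x *\<^sub>R g x) = g"
    using assms(2) by (auto simp: indicator_def fun_eq_iff not_le)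
  ultimately show ?thesis by simp
qed

lemma integrable_bump: "0 < r \<Longrightarrow> integrable lborel (bump r :: 'a::euclidean_space \<Rightarrow> real)"
  using integrable_continuous_bounded_support[OF continuous_bump, of r r] bump_nonzero_iff[of r]
  by (metis order_less_asym)

lemma integral_bump_pos:
  assumes r: "0 < r"
  shows "0 < (LINT w|lborel. bump r (w::'a::euclidean_space))"
proof -
  have "(LINT w|lborel. bump r (w::'a)) \<noteq> 0"
  proof
    assume "(LINT w|lborel. bump r (w::'a)) = 0"
    then have "AE w::'a in lborel. bump r w = 0"
      using integral_nonneg_eq_0_iff_AE[OF integrable_bump[OF r]] bump_nonneg by auto
    then have "AE w::'a in lborel. w \<notin> ball 0 r"
      by eventually_elim (use bump_nonzero_iff[OF r] in auto)
    then have "ball 0 r \<in> null_sets (lborel :: 'a measure)"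
      by (subst (asm) AE_iff_null) (auto simp: ball_def)
    then have "negligible (ball (0::'a) r)"
      by (simp add: negligible_iff_null_sets null_sets_completionI)
    then show False using r open_not_negligible[of "ball (0::'a) r"] by auto
  qed
  moreover have "0 \<le> (LINT w|lborel. bump r (w::'a))"
    by (rule Bochner_Integration.integral_nonneg) (rule bump_nonneg)
  ultimately show ?thesis by simp
qed

lemma mollifier_nonneg: "0 \<le> mollifier r z"
  unfolding mollifier_def by (intro divide_nonneg_nonneg bump_nonneg Bochner_Integration.integral_nonneg)

lemma mollifier_eq_0: "0 < r \<Longrightarrow> r \<le> norm z \<Longrightarrow> mollifier r z = 0"
  using bump_nonzero_iff[of r z] by (auto simp: mollifier_def)

lemma mollifier_minus: "mollifier r (x - y) = mollifier r (y - x)"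
  by (simp add: mollifier_def bump_minus)

lemma integrable_mollifier: "0 < r \<Longrightarrow> integrable lborel (mollifier r :: 'a::euclidean_space \<Rightarrow> real)"
  unfolding mollifier_def[abs_def] by (intro integrable_divide integrable_bump)

lemma nn_integral_mollifier:
  assumes "0 < r"
  shows "(\<integral>\<^sup>+z. ennreal (mollifier r (z::'a::euclidean_space)) \<partial>lborel) = 1"
proof -
  have "(LINT z|lborel. mollifier r (z::'a)) = 1"
    using integral_bump_pos[OF assms, where 'a='a] by (simp add: mollifier_def)
  then show ?thesis
    by (simp add: nn_integral_eq_integral[OF integrable_mollifier[OF assms]] mollifier_nonneg)
qed

lemma nn_integral_lborel_plus:
  fixes g :: "'a::euclidean_space \<Rightarrow> ennreal"
  assumes [measurable]: "g \<in> borel_measurable borel"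
  shows "(\<integral>\<^sup>+y. g (c + y) \<partial>lborel) = (\<integral>\<^sup>+y. g y \<partial>lborel)"
proof -
  have "(\<integral>\<^sup>+y. g y \<partial>lborel) = (\<integral>\<^sup>+y. g y \<partial>(distr lborel borel ((+) c)))" by (simp add: lborel_distr_plus)
  also have "\<dots> = (\<integral>\<^sup>+y. g (c + y) \<partial>lborel)" by (rule nn_integral_distr) auto
  finally show ?thesis by simp
qed

lemma integral_lborel_plus:
  fixes g :: "'a::euclidean_space \<Rightarrow> real"
  assumes [measurable]: "g \<in> borel_measurable borel"
  shows "(LINT y|lborel. g (c + y)) = (LINT y|lborel. g y)"
    and "integrable lborel (\<lambda>y. g (c + y)) \<longleftrightarrow> integrable lborel g"
proof -
  have "(LINT y|lborel. g y) = (LINT y|(distr lborel borel ((+) c)). g y)" by (simp add: lborel_distr_plus)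
  also have "\<dots> = (LINT y|lborel. g (c + y))" by (rule integral_distr) auto
  finally show "(LINT y|lborel. g (c + y)) = (LINT y|lborel. g y)" by simp
  have "integrable lborel g \<longleftrightarrow> integrable (distr lborel borel ((+) c)) g" by (simp add: lborel_distr_plus)
  also have "\<dots> \<longleftrightarrow> integrable lborel (\<lambda>y. g (c + y))" by (rule integrable_distr_eq) auto
  finally show "integrable lborel (\<lambda>y. g (c + y)) \<longleftrightarrow> integrable lborel g" by simp
qed

text \<open>
  This is the convolution with the mollifier. As the kernel is symmetric, it is written as a
  translate of a test function in the variable of integration, the form in which weak
  gradients are tested.
\<close>

definition mollify :: "real \<Rightarrow> ('a::euclidean_space \<Rightarrow> real) \<Rightarrow> 'a \<Rightarrow> real" where
  "mollify r u x = (LINT y|lborel. u y * mollifier r (y - x))"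

lemma mollify_eq_shift:
  assumes [measurable]: "u \<in> borel_measurable borel"
  shows "mollify r u x = (LINT z|lborel. u (x + z) * mollifier r z)"
  using integral_lborel_plus(1)[of "\<lambda>y. u y * mollifier r (y - x)" x] by (simp add: mollify_def)

lemma borel_measurable_mollify[measurable]:
  assumes [measurable]: "u \<in> borel_measurable borel"
  shows "mollify r u \<in> borel_measurable borel"
proof -
  have "(\<lambda>x. LINT y|lborel. u y * mollifier r (y - x)) \<in> borel_measurable lborel"
    by (rule lborel.borel_measurable_lebesgue_integral) simp
  then show ?thesis by (simp add: mollify_def[abs_def])
qed

lemma mollifier_bounded:
  assumes r: "0 < r"
  obtains B where "B \<ge> 0" "\<And>z::'a::euclidean_space. mollifier r z \<le> B"
proof -
  have "compact (mollifier r ` cball (0::'a) r)"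
    by (intro compact_continuous_image continuous_on_subset[OF continuous_mollifier]) auto
  then obtain B where B: "\<forall>y\<in>mollifier r ` cball (0::'a) r. \<bar>y\<bar> \<le> B"
    using bounded_real compact_imp_bounded by metis
  show ?thesis
  proof (rule that[of "max 0 B"])
    fix z :: 'a show "mollifier r z \<le> max 0 B"
      using B mollifier_eq_0[OF r, of z] by (cases "norm z \<le> r") force+
  qed auto
qed

lemma integrable_mult_mollifier:
  fixes u :: "'a::euclidean_space \<Rightarrow> real"
  assumes r: "0 < r" and u: "integrable lborel u"
  shows "integrable lborel (\<lambda>y. u y * mollifier r (y - x))"
proof -
  obtain B where B: "\<And>z::'a. mollifier r z \<le> B" using mollifier_bounded[OF r] by blast
  show ?thesis
  proof (rule Bochner_Integration.integrable_bound)
    show "integrable lborel (\<lambda>y. B * u y)" using u by simp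
    show "AE y in lborel. norm (u y * mollifier r (y - x)) \<le> norm (B * u y)"
    proof (rule AE_I2)
      fix y
      have "\<bar>mollifier r (y - x)\<bar> \<le> \<bar>B\<bar>" using B[of "y - x"] mollifier_nonneg[of r "y - x"] by linarith
      from mult_right_mono[OF this, of "\<bar>u y\<bar>"]
      show "norm (u y * mollifier r (y - x)) \<le> norm (B * u y)" by (simp add: abs_mult mult.commute)
    qed
  qed (use u in auto)
qed

text \<open>
  Tonelli's theorem, as the kernel has integral one in either variable.
\<close>

lemma nn_integral_mollify_le:
  fixes u :: "'a::euclidean_space \<Rightarrow> real"
  assumes r: "0 < r" and [measurable]: "u \<in> borel_measurable borel"
  shows "(\<integral>\<^sup>+x. ennreal \<bar>mollify r u x\<bar> \<partial>lborel) \<le> (\<integral>\<^sup>+x. ennreal \<bar>u x\<bar> \<partial>lborel)"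
proof -
  have "(\<integral>\<^sup>+x. ennreal \<bar>mollify r u x\<bar> \<partial>lborel) \<le> (\<integral>\<^sup>+x. (\<integral>\<^sup>+y. ennreal \<bar>u y\<bar> * ennreal (mollifier r (y - x)) \<partial>lborel) \<partial>lborel)"
  proof (rule nn_integral_mono)
    fix x
    show "ennreal \<bar>mollify r u x\<bar> \<le> (\<integral>\<^sup>+y. ennreal \<bar>u y\<bar> * ennreal (mollifier r (y - x)) \<partial>lborel)"
      using integral_norm_bound_ennreal[of lborel "\<lambda>y. u y * mollifier r (y - x)"]
      by (cases "integrable lborel (\<lambda>y. u y * mollifier r (y - x))")
        (auto simp: mollify_def abs_mult mollifier_nonneg ennreal_mult not_integrable_integral_eq)
  qed
  also have "\<dots> = (\<integral>\<^sup>+y. (\<integral>\<^sup>+x. ennreal \<bar>u y\<bar> * ennreal (mollifier r (y - x)) \<partial>lborel) \<partial>lborel)"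
    by (rule lborel_pair.Fubini'[symmetric]) simp
  also have "\<dots> = (\<integral>\<^sup>+y. ennreal \<bar>u y\<bar> \<partial>lborel)"
  proof (rule nn_integral_cong)
    fix y :: 'a
    have "(\<integral>\<^sup>+x. ennreal (mollifier r (y - x)) \<partial>lborel) = (\<integral>\<^sup>+x. ennreal (mollifier r (- y + x)) \<partial>lborel)"
      by (subst mollifier_minus) (simp add: algebra_simps)
    also have "\<dots> = 1" by (subst nn_integral_lborel_plus[of "\<lambda>z. ennreal (mollifier r z)"]) (simp_all add: nn_integral_mollifier r)
    finally show "(\<integral>\<^sup>+x. ennreal \<bar>u y\<bar> * ennreal (mollifier r (y - x)) \<partial>lborel) = ennreal \<bar>u y\<bar>"
      by (subst nn_integral_cmult) auto
  qed
  finally show ?thesis .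
qed

lemma integrable_mollify:
  fixes u :: "'a::euclidean_space \<Rightarrow> real"
  assumes r: "0 < r" and u: "integrable lborel u"
  shows "integrable lborel (mollify r u)"
proof -
  have [measurable]: "u \<in> borel_measurable borel" using u by auto
  show ?thesis using nn_integral_mollify_le[OF r, of u] u
    by (auto simp: integrable_iff_bounded intro: le_less_trans)
qed

lemma mollify_diff:
  assumes "0 < r" "integrable lborel u" "integrable lborel v"
  shows "mollify r (\<lambda>x. u x - v x) x = mollify r u x - mollify r v x"
  unfolding mollify_def
  by (subst Bochner_Integration.integral_diff[symmetric])
    (auto intro!: integrable_mult_mollifier assms simp: algebra_simps)

text \<open>
  Since the kernel has integral one, \<open>u x\<close> can be moved under the integral: the error of
  mollification is an average of errors of translation.
\<close>

lemma abs_mollify_minus_le: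
  fixes u :: "'a::euclidean_space \<Rightarrow> real"
  assumes r: "0 < r" and u: "integrable lborel u"
  shows "ennreal \<bar>mollify r u x - u x\<bar> \<le> (\<integral>\<^sup>+z. ennreal \<bar>u (x + z) - u x\<bar> * ennreal (mollifier r z) \<partial>lborel)"
proof -
  have [measurable]: "u \<in> borel_measurable borel" using u by auto
  have i1: "integrable lborel (\<lambda>z. u (x + z) * mollifier r z)"
    using integral_lborel_plus(2)[where g="\<lambda>y. u y * mollifier r (y - x)" and c=x] integrable_mult_mollifier[OF r u, of x]
    by simp
  have i2: "integrable lborel (\<lambda>z::'a. u x * mollifier r z)" by (simp add: integrable_mollifier r)
  have "(LINT z|lborel. mollifier r (z::'a)) = 1"
    using nn_integral_mollifier[OF r, where 'a='a] nn_integral_eq_integral[OF integrable_mollifier[OF r, where 'a='a]]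
    by (simp add: mollifier_nonneg)
  then have "mollify r u x - u x = (LINT z|lborel. u (x + z) * mollifier r z) - (LINT z|lborel. u x * mollifier r (z::'a))"
    by (simp add: mollify_eq_shift)
  also have "\<dots> = (LINT z|lborel. (u (x + z) - u x) * mollifier r z)"
    by (subst Bochner_Integration.integral_diff[symmetric, OF i1 i2]) (simp add: algebra_simps)
  finally have eq: "mollify r u x - u x = \<dots>" .
  have "integrable lborel (\<lambda>z. (u (x + z) - u x) * mollifier r z)"
    using Bochner_Integration.integrable_diff[OF i1 i2] by (simp add: algebra_simps)
  from integral_norm_bound_ennreal[OF this] show ?thesis
    by (simp add: eq abs_mult ennreal_mult mollifier_nonneg)
qed

lemma uniformly_continuous_bounded_support:
  fixes g :: "'a::euclidean_space \<Rightarrow> real"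
  assumes g: "continuous_on UNIV g" "\<And>x. norm x > R \<Longrightarrow> g x = 0" and e: "0 < e"
  obtains d where "0 < d" "\<And>x y::'a. dist x y < d \<Longrightarrow> \<bar>g x - g y\<bar> < e"
proof -
  have "uniformly_continuous_on (cball 0 (R + 1)) g"
    by (intro compact_uniformly_continuous continuous_on_subset[OF g(1)]) auto
  then obtain d where d: "d > 0" "\<And>x y. x \<in> cball 0 (R + 1) \<Longrightarrow> y \<in> cball 0 (R + 1) \<Longrightarrow> dist y x < d \<Longrightarrow> dist (g y) (g x) < e"
    using e unfolding uniformly_continuous_on_def by metis
  show ?thesis
  proof (rule that[of "min d 1"])
    fix x y :: 'a assume xy: "dist x y < min d 1"
    show "\<bar>g x - g y\<bar> < e"
    proof (cases "norm x \<le> R + 1 \<and> norm y \<le> R + 1")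
      case True then show ?thesis using d(2)[of x y] xy by (simp add: dist_real_def dist_commute abs_minus_commute)
    next
      case False
      have "norm x \<le> norm y + dist x y" "norm y \<le> norm x + dist x y"
        using norm_triangle_sub[of x y] norm_triangle_sub[of y x] by (auto simp: dist_norm norm_minus_commute)
      then have "norm x > R" "norm y > R" using False xy by auto
      then show ?thesis using g(2) e by simp
    qed
  qed (use d in auto)
qed

text \<open>
  For a continuous function of bounded support the mollifications converge uniformly and live on
  a common ball. Density and the contraction property \<open>nn_integral_mollify_le\<close> do the rest.
\<close>

lemma mollify_tendsto_L1:
  fixes u :: "'a::euclidean_space \<Rightarrow> real"
  assumes u: "integrable lborel u" and e: "0 < e"
  shows "\<exists>d>0. \<forall>r. 0 < r \<and> r < d \<longrightarrow> L1_dist (mollify r u) u < ennreal e"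
proof -
  have "0 < e / 3" using e by simp
  from continuous_dense_L1[OF u this] obtain g R where g: "continuous_on UNIV g" "\<And>x. R < norm x \<Longrightarrow> g x = 0"
    "L1_dist u g < ennreal (e / 3)" by blast
  have gi: "integrable lborel g" by (rule integrable_continuous_bounded_support[OF g(1,2)])
  have [measurable]: "g \<in> borel_measurable borel" "u \<in> borel_measurable borel" using gi u by auto
  define m where "m = measure lborel (cball (0::'a) (R + 1))"
  have m: "emeasure lborel (cball (0::'a) (R + 1)) = ennreal m" "m \<ge> 0"
    using emeasure_eq_ennreal_measure[of lborel "cball (0::'a) (R + 1)"] emeasure_lborel_cball_finite[of "0::'a" "R + 1"]
    by (auto simp: m_def less_top)
  obtain d where d: "0 < d" "\<And>x y. dist x y < d \<Longrightarrow> \<bar>g x - g y\<bar> < e / (3 * (m + 1))"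
    using uniformly_continuous_bounded_support[of g R "e / (3 * (m + 1))"] g e m by auto
  have "L1_dist (mollify r u) u < ennreal e" if r: "0 < r" "r < min d 1" for r
  proof -
    have pt: "ennreal \<bar>mollify r g x - g x\<bar> \<le> ennreal (e / (3 * (m + 1))) * indicator (cball 0 (R + 1)) x" for x
    proof -
      have "ennreal \<bar>mollify r g x - g x\<bar> \<le> (\<integral>\<^sup>+z. ennreal \<bar>g (x + z) - g x\<bar> * ennreal (mollifier r z) \<partial>lborel)"
        by (rule abs_mollify_minus_le[OF r(1) gi])
      also have "\<dots> \<le> (\<integral>\<^sup>+z. ennreal (e / (3 * (m + 1))) * indicator (cball 0 (R + 1)) x * ennreal (mollifier r (z::'a)) \<partial>lborel)"
      proof (rule nn_integral_mono)
        fix z :: 'a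
        show "ennreal \<bar>g (x + z) - g x\<bar> * ennreal (mollifier r z)
           \<le> ennreal (e / (3 * (m + 1))) * indicator (cball 0 (R + 1)) x * ennreal (mollifier r z)"
        proof (cases "norm z < r")
          case True
          then have "dist (x + z) x < d" using r by (simp add: dist_norm)
          then have "\<bar>g (x + z) - g x\<bar> \<le> e / (3 * (m + 1))" using d(2) by force
          moreover have "\<bar>g (x + z) - g x\<bar> = 0" if "norm x > R + 1"
          proof -
            have "norm x \<le> norm (x + z) + norm z" using norm_triangle_ineq4[of "x + z" z] by simp
            then show ?thesis using that True r g(2) by simp
          qed
          ultimately show ?thesis
            by (intro mult_right_mono) (auto simp: indicator_def not_le intro!: ennreal_leI)
        next
          case False then show ?thesis using mollifier_eq_0[OF r(1), of z] by simp
        qed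
      qed
      also have "\<dots> = ennreal (e / (3 * (m + 1))) * indicator (cball 0 (R + 1)) x"
        by (subst nn_integral_cmult) (auto simp: nn_integral_mollifier r)
      finally show ?thesis .
    qed
    have A: "L1_dist (mollify r g) g \<le> ennreal (e / 3)"
    proof -
      have "L1_dist (mollify r g) g \<le> ennreal (e / (3 * (m + 1))) * ennreal m"
        by (rule order_trans[OF nn_integral_mono[OF pt]])
          (simp only: nn_integral_cmult_indicator m sets_lborel borel_closed closed_cball order_refl)
      also have "\<dots> \<le> ennreal (e / 3)"
        using e m by (subst ennreal_mult[symmetric]) (auto intro!: ennreal_leI simp: field_simps)
      finally show ?thesis .
    qed
    have "L1_dist (mollify r u) u \<le>
       L1_dist (mollify r u) (mollify r g) + L1_dist (mollify r g) u"
      by (rule nn_integral_abs_triangle) auto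
    also have "L1_dist (mollify r u) (mollify r g) = (\<integral>\<^sup>+x. ennreal \<bar>mollify r (\<lambda>x. u x - g x) x\<bar> \<partial>lborel)"
      by (simp add: mollify_diff r u gi)
    also have "\<dots> \<le> L1_dist u g"
      by (rule nn_integral_mollify_le[OF r(1)]) auto
    also have "L1_dist (mollify r g) u \<le>
       L1_dist (mollify r g) g + L1_dist g u"
      by (rule nn_integral_abs_triangle) auto
    also have "L1_dist g u = L1_dist u g"
      by (simp add: abs_minus_commute)
    finally have "L1_dist (mollify r u) u \<le>
       L1_dist u g + (L1_dist (mollify r g) g + L1_dist u g)"
      by (simp add: add_mono)
    also have "\<dots> \<le> L1_dist u g + (ennreal (e / 3) + L1_dist u g)"
      by (intro add_mono A order_refl)
    also have "\<dots> < ennreal (e / 3) + (ennreal (e / 3) + ennreal (e / 3))"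
      by (rule add_strict_mono[OF g(3)]) (subst ennreal_add_left_cancel_less, use g(3) in simp)
    also have "\<dots> = ennreal e" using e by (simp flip: ennreal_plus)
    finally show ?thesis .
  qed
  moreover have "0 < min d 1" using d(1) by simp
  ultimately show ?thesis by blast
qed

section \<open>Derivatives of mollifications and integration by parts\<close>

lemma mollifier_test_function:
  fixes x :: "'a::euclidean_space"
  assumes r: "0 < r" and "cball x r \<subseteq> A"
  shows "(\<lambda>y. mollifier r (y - x)) \<in> test_functions A"
proof -
  define c where "c = inverse (LINT w|lborel. bump r (w::'a))"
  have c: "c \<noteq> 0" using integral_bump_pos[OF r, where 'a='a] by (simp add: c_def)
  have eq: "mollifier r (y - x) = c * bump r (y - x)" for y by (simp add: mollifier_def c_def divide_inverse)
  have b: "(\<lambda>y. bump r (y - x)) \<in> test_functions A" by (rule bump_test_function[OF assms])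
  have "C_k k (\<lambda>y. c * bump r (y - x))" for k
    using b by (intro C_k_mult C_k_const) (simp add: test_functions_def)
  moreover have "{y. c * bump r (y - x) \<noteq> 0} = {y. bump r (y - x) \<noteq> 0}" using c by simp
  ultimately show ?thesis using b unfolding eq test_functions_def by simp
qed

lemma differentiable_mollifier: "mollifier r differentiable at (x::'a::euclidean_space)"
proof -
  have "C_k 1 (\<lambda>y::'a. inverse (LINT w|lborel. bump r (w::'a)) * flat_exp 0 (r\<^sup>2 - (y - 0) \<bullet> (y - 0)))"
    by (intro C_k_mult C_k_const C_k_flat_exp_sphere)
  moreover have "(\<lambda>y::'a. inverse (LINT w|lborel. bump r (w::'a)) * flat_exp 0 (r\<^sup>2 - (y - 0) \<bullet> (y - 0))) = mollifier r"
    by (simp add: mollifier_def[abs_def] bump_def[abs_def] divide_inverse mult.commute)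
  ultimately have "C_k 1 (mollifier r :: 'a \<Rightarrow> real)" by (simp only:)
  then show ?thesis by simp
qed

lemma mollifier_Lipschitz:
  assumes r: "0 < r"
  obtains L where "L \<ge> 0" "\<And>x y::'a::euclidean_space. \<bar>mollifier r x - mollifier r y\<bar> \<le> L * norm (x - y)"
  using test_function_Lipschitz[OF mollifier_test_function[OF r subset_UNIV, of "0::'a"]] by (metis diff_zero)

lemma frechet_derivative_shift:
  assumes "f differentiable at (y - x)"
  shows "frechet_derivative (\<lambda>y. f (y - x)) (at y) = frechet_derivative f (at (y - x))"
proof -
  have "((\<lambda>y. f (y - x)) has_derivative frechet_derivative f (at (y - x))) (at y)"
  proof (rule has_derivative_compose[where f = "\<lambda>y. y - x" and f' = "\<lambda>h. h"])
    show "((\<lambda>y. y - x) has_derivative (\<lambda>h. h)) (at y)" by (auto intro!: derivative_eq_intros)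
  qed (use assms frechet_derivative_works in blast)
  then show ?thesis by (rule frechet_derivative_at[symmetric])
qed

text \<open>
  The constant depends on \<open>u\<close> only through its \<open>L\<^sup>1\<close> norm. This makes the mollifications of an
  \<open>L\<^sup>1\<close>-bounded family equicontinuous.
\<close>

lemma mollify_Lipschitz_uniform:
  assumes r: "0 < r"
  obtains L where "L \<ge> 0" "\<And>(u::'a::euclidean_space \<Rightarrow> real) x y. integrable lborel u \<Longrightarrow>
     \<bar>mollify r u x - mollify r u y\<bar> \<le> L * (LINT z|lborel. \<bar>u z\<bar>) * norm (x - y)"
proof -
  obtain L where L: "L \<ge> 0" "\<And>x y::'a. \<bar>mollifier r x - mollifier r y\<bar> \<le> L * norm (x - y)"
    using mollifier_Lipschitz[OF r] by blast
  have "\<bar>mollify r u x - mollify r u y\<bar> \<le> L * (LINT z|lborel. \<bar>u z\<bar>) * norm (x - y)"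
    if u: "integrable lborel u" for u :: "'a \<Rightarrow> real" and x y
  proof -
    have "mollify r u x - mollify r u y = (LINT z|lborel. u z * mollifier r (z - x) - u z * mollifier r (z - y))"
      unfolding mollify_def
      by (rule Bochner_Integration.integral_diff[symmetric]) (intro integrable_mult_mollifier r u)+
    also have "\<bar>\<dots>\<bar> \<le> (LINT z|lborel. \<bar>u z\<bar> * (L * norm (x - y)))"
    proof (rule integral_abs_bound[THEN order_trans], rule integral_mono)
      show "integrable lborel (\<lambda>z. \<bar>u z * mollifier r (z - x) - u z * mollifier r (z - y)\<bar>)"
        by (intro integrable_abs Bochner_Integration.integrable_diff integrable_mult_mollifier r u)
      show "\<bar>u z * mollifier r (z - x) - u z * mollifier r (z - y)\<bar> \<le> \<bar>u z\<bar> * (L * norm (x - y))" for z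
        using mult_left_mono[OF L(2)[of "z - x" "z - y"], of "\<bar>u z\<bar>"]
        by (simp add: abs_mult[symmetric] right_diff_distrib norm_minus_commute)
    qed (use u in auto)
    finally show ?thesis by (simp add: mult_ac)
  qed
  then show ?thesis using that L(1) by blast
qed

lemma mollify_Lipschitz:
  fixes u :: "'a::euclidean_space \<Rightarrow> real"
  assumes r: "0 < r" and u: "integrable lborel u"
  obtains L where "L \<ge> 0" "\<And>x y. \<bar>mollify r u x - mollify r u y\<bar> \<le> L * norm (x - y)"
proof -
  obtain L where L: "L \<ge> 0" "\<And>(u::'a \<Rightarrow> real) x y. integrable lborel u \<Longrightarrow>
     \<bar>mollify r u x - mollify r u y\<bar> \<le> L * (LINT z|lborel. \<bar>u z\<bar>) * norm (x - y)"
    using mollify_Lipschitz_uniform[OF r] by blast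
  have "0 \<le> L * (LINT z|lborel. \<bar>u z\<bar>)"
    by (intro mult_nonneg_nonneg L Bochner_Integration.integral_nonneg) auto
  then show ?thesis using that L(2)[OF u] by blast
qed

lemma continuous_mollify:
  assumes "0 < r" "integrable lborel u"
  shows "continuous_on UNIV (mollify r u)"
proof -
  obtain L where "L \<ge> 0" "\<And>x y. \<bar>mollify r u x - mollify r u y\<bar> \<le> L * norm (x - y)"
    using mollify_Lipschitz[OF assms] by blast
  then have "L-lipschitz_on UNIV (mollify r u)"
    by (auto simp: lipschitz_on_def dist_real_def dist_norm)
  then show ?thesis by (rule lipschitz_on_continuous_on)
qed

lemma directional_DERIV:
  fixes f :: "'a::real_normed_vector \<Rightarrow> real"
  assumes "f differentiable at z"
  shows "((\<lambda>t. f (z + t *\<^sub>R h)) has_real_derivative frechet_derivative f (at z) h) (at 0)"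
proof -
  have D: "(f has_derivative frechet_derivative f (at z)) (at (z + 0 *\<^sub>R h))"
    using assms(1) by (simp add: frechet_derivative_works)
  have lin: "linear (frechet_derivative f (at z))" by (rule linear_frechet_derivative[OF assms(1)])
  have "((\<lambda>t. z + t *\<^sub>R h) has_derivative (\<lambda>t. t *\<^sub>R h)) (at 0)"
    by (auto intro!: derivative_eq_intros)
  from has_derivative_compose[OF this D] show ?thesis
    unfolding has_field_derivative_def
    by (rule has_derivative_eq_rhs) (simp add: fun_eq_iff linear_cmul[OF lin])
qed

lemma directional_derivative_quotient:
  fixes f :: "'a::real_normed_vector \<Rightarrow> real"
  assumes "f differentiable at z" "\<And>n. X n \<noteq> 0" "X \<longlonglongrightarrow> 0"
  shows "(\<lambda>n. (f (z + X n *\<^sub>R h) - f z) / X n) \<longlonglongrightarrow> frechet_derivative f (at z) h"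
  using directional_DERIV[OF assms(1), of h] assms(2,3)
  by (simp add: has_field_derivative_iff LIMSEQ_SEQ_conv[symmetric])

text \<open>
  Differentiation under the integral sign; the difference quotients of the kernel are bounded by
  its Lipschitz constant. The minus sign stems from differentiating \<open>y - x\<close> with respect to \<open>x\<close>.
\<close>

lemma DERIV_mollify:
  fixes u :: "'a::euclidean_space \<Rightarrow> real"
  assumes r: "0 < r" and u: "integrable lborel u"
  shows "((\<lambda>t. mollify r u (x + t *\<^sub>R h)) has_real_derivative
            - (LINT y|lborel. u y * frechet_derivative (mollifier r) (at (y - x)) h)) (at 0)"
    and "integrable lborel (\<lambda>y. u y * frechet_derivative (mollifier r) (at (y - x)) h)"
proof -
  obtain L where L: "L \<ge> 0" "\<And>x y::'a. \<bar>mollifier r x - mollifier r y\<bar> \<le> L * norm (x - y)"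
    using mollifier_Lipschitz[OF r] by blast
  have [measurable]: "u \<in> borel_measurable borel" using u by auto
  define q where "q t y = u y * ((mollifier r ((y - x) + t *\<^sub>R (- h)) - mollifier r (y - x)) / t)" for t y
  have [measurable]: "q t \<in> borel_measurable borel" for t unfolding q_def by measurable
  have lin: "linear (frechet_derivative (mollifier r) (at z))" for z :: 'a
    by (rule linear_frechet_derivative[OF differentiable_mollifier])
  have neg: "frechet_derivative (mollifier r) (at z) (- h) = - frechet_derivative (mollifier r) (at z) h" for z :: 'a
    by (rule linear_neg[OF lin])
  have lim: "(\<lambda>n. q (X n) y) \<longlonglongrightarrow> - (u y * frechet_derivative (mollifier r) (at (y - x)) h)"
    if "\<And>n. X n \<noteq> 0" "X \<longlonglongrightarrow> 0" for X y
    unfolding q_def using tendsto_mult[OF tendsto_const directional_derivative_quotient[OF differentiable_mollifier that], of "u y" r "y - x" "- h"]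
    by (simp add: neg)
  have bound: "norm (q t y) \<le> L * norm h * \<bar>u y\<bar>" for t y
  proof (cases "t = 0")
    case False
    have "\<bar>mollifier r ((y - x) + t *\<^sub>R (- h)) - mollifier r (y - x)\<bar> \<le> L * norm h * \<bar>t\<bar>"
      using L(2)[of "(y - x) + t *\<^sub>R (- h)" "y - x"] by (simp add: mult_ac)
    then have "\<bar>(mollifier r ((y - x) + t *\<^sub>R (- h)) - mollifier r (y - x)) / t\<bar> \<le> L * norm h"
      using False by (simp add: divide_le_eq)
    from mult_left_mono[OF this, of "\<bar>u y\<bar>"] show ?thesis
      by (simp add: q_def abs_mult mult_ac)
  qed (use L in \<open>simp add: q_def\<close>)
  have meas: "(\<lambda>y. - (u y * frechet_derivative (mollifier r) (at (y - x)) h)) \<in> borel_measurable lborel"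
  proof (rule borel_measurable_LIMSEQ_real)
    show "(\<lambda>n. q (1 / real (Suc n)) y) \<longlonglongrightarrow> - (u y * frechet_derivative (mollifier r) (at (y - x)) h)" for y
      by (rule lim) (use LIMSEQ_Suc[OF lim_1_over_n] in auto)
  qed auto
  have dct: "integrable lborel (\<lambda>y. - (u y * frechet_derivative (mollifier r) (at (y - x)) h))"
    "(\<lambda>n. LINT y|lborel. q (X n) y) \<longlonglongrightarrow> (LINT y|lborel. - (u y * frechet_derivative (mollifier r) (at (y - x)) h))"
    if "\<And>n. X n \<noteq> 0" "X \<longlonglongrightarrow> 0" for X
  proof -
    have w: "integrable lborel (\<lambda>y. L * norm h * \<bar>u y\<bar>)" using u by simp
    have b: "AE y in lborel. norm (q (X n) y) \<le> L * norm h * \<bar>u y\<bar>" for n using bound by simp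
    have l: "AE y in lborel. (\<lambda>n. q (X n) y) \<longlonglongrightarrow> - (u y * frechet_derivative (mollifier r) (at (y - x)) h)"
      using lim[OF that] by simp
    show "integrable lborel (\<lambda>y. - (u y * frechet_derivative (mollifier r) (at (y - x)) h))"
      by (rule integrable_dominated_convergence[OF meas _ w l b]) simp
    show "(\<lambda>n. LINT y|lborel. q (X n) y) \<longlonglongrightarrow> (LINT y|lborel. - (u y * frechet_derivative (mollifier r) (at (y - x)) h))"
      by (rule integral_dominated_convergence[OF meas _ w l b]) simp
  qed
  have "integrable lborel (\<lambda>y. - (u y * frechet_derivative (mollifier r) (at (y - x)) h))"
    by (rule dct(1)[of "\<lambda>n. 1 / real (Suc n)"]) (use LIMSEQ_Suc[OF lim_1_over_n] in auto)
  then show "integrable lborel (\<lambda>y. u y * frechet_derivative (mollifier r) (at (y - x)) h)" by simp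
  have quot: "(mollify r u (x + t *\<^sub>R h) - mollify r u x) / t = (LINT y|lborel. q t y)" for t
  proof -
    have "mollify r u (x + t *\<^sub>R h) - mollify r u x
        = (LINT y|lborel. u y * mollifier r (y - (x + t *\<^sub>R h)) - u y * mollifier r (y - x))"
      unfolding mollify_def
      by (rule Bochner_Integration.integral_diff[symmetric]) (intro integrable_mult_mollifier r u)+
    also have "\<dots> / t = (LINT y|lborel. (u y * mollifier r (y - (x + t *\<^sub>R h)) - u y * mollifier r (y - x)) / t)"
      by simp
    also have "\<dots> = (LINT y|lborel. q t y)"
      by (rule Bochner_Integration.integral_cong) (simp_all add: q_def algebra_simps diff_divide_distrib)
    finally show ?thesis .
  qed
  show "((\<lambda>t. mollify r u (x + t *\<^sub>R h)) has_real_derivative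
            - (LINT y|lborel. u y * frechet_derivative (mollifier r) (at (y - x)) h)) (at 0)"
    unfolding has_field_derivative_iff
    using dct(2) by (simp add: quot LIMSEQ_SEQ_conv[symmetric])
qed

text \<open>
  Integration by parts without coordinates: difference quotients have integral zero by
  translation invariance, and the Lipschitz bound and the bounded support dominate them.
\<close>

lemma integral_directional_derivative_eq_0:
  fixes h D :: "'a::euclidean_space \<Rightarrow> real"
  assumes Lip: "\<And>x y. \<bar>h x - h y\<bar> \<le> L * norm (x - y)"
    and supp: "\<And>x. R < norm x \<Longrightarrow> h x = 0"
    and D: "\<And>x. ((\<lambda>t. h (x + t *\<^sub>R b)) has_real_derivative D x) (at 0)"
  shows "(LINT x|lborel. D x) = 0"
proof -
  have L: "L * norm y \<ge> 0" for y :: 'a using Lip[of y 0] by simp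
  have "\<bar>h x - h y\<bar> \<le> \<bar>L\<bar> * norm (x - y)" for x y
    using Lip[of x y] mult_right_mono[OF abs_ge_self[of L], of "norm (x - y)"] by simp
  then have "\<bar>L\<bar>-lipschitz_on UNIV h" by (auto simp: lipschitz_on_def dist_real_def dist_norm)
  then have cont: "continuous_on UNIV h" by (rule lipschitz_on_continuous_on)
  then have [measurable]: "h \<in> borel_measurable borel" by (rule borel_measurable_continuous_onI)
  have hi: "integrable lborel h" by (rule integrable_continuous_bounded_support[OF cont supp])
  define X where "X n = 1 / real (Suc n)" for n
  have X: "X n \<noteq> 0" "0 < X n" "X n \<le> 1" for n by (auto simp: X_def)
  have X0: "X \<longlonglongrightarrow> 0" unfolding X_def[abs_def] using LIMSEQ_Suc[OF lim_1_over_n] by simp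
  define q where "q n x = (h (X n *\<^sub>R b + x) - h x) / X n" for n x
  have [measurable]: "q n \<in> borel_measurable borel" for n unfolding q_def by measurable
  have int_q: "(LINT x|lborel. q n x) = 0" for n
  proof -
    have "integrable lborel (\<lambda>x. h (X n *\<^sub>R b + x))" using hi by (simp add: integral_lborel_plus(2))
    then have "(LINT x|lborel. q n x) = ((LINT x|lborel. h (X n *\<^sub>R b + x)) - (LINT x|lborel. h x)) / X n"
      unfolding q_def using hi by simp
    then show ?thesis by (simp add: integral_lborel_plus(1))
  qed
  have lim: "(\<lambda>n. q n x) \<longlonglongrightarrow> D x" for x
  proof -
    have "(\<lambda>t. (h (x + t *\<^sub>R b) - h x) / t) \<midarrow>0\<rightarrow> D x" using D[of x] by (simp add: has_field_derivative_iff)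
    then show ?thesis using X(1) X0 unfolding q_def by (simp add: LIMSEQ_SEQ_conv[symmetric] add.commute)
  qed
  have bound: "norm (q n x) \<le> L * norm b * indicator (cball 0 (R + norm b)) x" for n x
  proof (cases "norm x \<le> R + norm b")
    case True
    have "\<bar>h (X n *\<^sub>R b + x) - h x\<bar> \<le> L * norm b * X n"
      using Lip[of "X n *\<^sub>R b + x" x] X(2)[of n] by (simp add: mult_ac)
    then show ?thesis using True X(2)[of n] by (simp add: q_def divide_le_eq)
  next
    case False
    have "norm x \<le> norm (X n *\<^sub>R b + x) + norm (X n *\<^sub>R b)"
      using norm_triangle_ineq4[of "X n *\<^sub>R b + x" "X n *\<^sub>R b"] by simp
    moreover have "norm (X n *\<^sub>R b) \<le> norm b"
      using mult_right_mono[OF X(3)[of n], of "norm b"] X(2)[of n] by simp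
    ultimately have "h (X n *\<^sub>R b + x) = 0" using False by (intro supp) linarith
    moreover have "h x = 0" using False norm_ge_zero[of b] by (intro supp) linarith
    ultimately show ?thesis using False by (simp add: q_def)
  qed
  have "(\<lambda>n. LINT x|lborel. q n x) \<longlonglongrightarrow> (LINT x|lborel. D x)"
  proof (rule integral_dominated_convergence)
    show "D \<in> borel_measurable lborel"
      by (rule borel_measurable_LIMSEQ_real[of _ q]) (use lim in auto)
    have "integrable lborel (indicator (cball (0::'a) (R + norm b)) :: 'a \<Rightarrow> real)"
      using emeasure_bounded_finite[OF bounded_cball, of "0::'a" "R + norm b"] by (intro integrable_real_indicator) auto
    then show "integrable lborel (\<lambda>x::'a. L * norm b * indicator (cball 0 (R + norm b)) x)" by simp
  qed (use lim bound in auto)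
  then show ?thesis by (simp add: int_q LIMSEQ_const_iff)
qed

section \<open>Weak gradients seen through mollification\<close>

text \<open>
  Weak gradients involve Lebesgue measurable functions, whereas translations and Tonelli's theorem
  are convenient for Borel measurable ones. This lemma passes between the two.
\<close>

lemma integral_lebesgue_eq_lborel:
  fixes f g :: "'a::euclidean_space \<Rightarrow> real"
  assumes g: "g \<in> borel_measurable borel" and eq: "AE x in lborel. f x = g x"
  shows "integral\<^sup>L lebesgue f = integral\<^sup>L lborel g"
proof -
  have AE: "AE x in lebesgue. f x = g x" using eq by (rule AE_completion)
  have gm: "g \<in> borel_measurable lebesgue" using g by (simp add: measurable_completion)
  have fm: "f \<in> borel_measurable lebesgue"
    by (rule borel_measurable_AE[OF gm]) (use AE in \<open>auto elim: eventually_mono\<close>)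
  have "integral\<^sup>L lebesgue f = integral\<^sup>L lebesgue g" by (rule integral_cong_AE[OF fm gm AE])
  also have "\<dots> = integral\<^sup>L lborel g" using g by (intro integral_completion) simp
  finally show ?thesis .
qed

lemma classical_grad_inner:
  assumes "b \<in> Basis" shows "classical_grad \<phi> x \<bullet> b = frechet_derivative \<phi> (at x) b"
  using assms by (simp add: classical_grad_def inner_sum_left inner_Basis if_distrib sum.delta cong: if_cong)

lemma frechet_derivative_eq_0_outside_support:
  fixes \<phi> :: "'a::real_normed_vector \<Rightarrow> real"
  assumes "x \<notin> closure {x. \<phi> x \<noteq> 0}"
  shows "frechet_derivative \<phi> (at x) = (\<lambda>_. 0)"
proof -
  have "(\<phi> has_derivative (\<lambda>_. 0)) (at x)"
  proof (rule has_derivative_transform_within_open[of "\<lambda>_. 0" _ _ _ "- closure {x. \<phi> x \<noteq> 0}"])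
    show "\<And>y. y \<in> - closure {x. \<phi> x \<noteq> 0} \<Longrightarrow> 0 = \<phi> y" using closure_subset[of "{x. \<phi> x \<noteq> 0}"] by auto
  qed (use assms in auto)
  then show ?thesis by (rule frechet_derivative_at[symmetric])
qed

text \<open>
  The form in which weak gradients are used. In contrast to \<^const>\<open>is_weak_grad\<close> both functions
  are globally integrable, so that convolutions make sense everywhere; the relation between them
  is only required where the ball of mollification lies in \<open>S\<close>.
\<close>

definition mollified_grad :: "'a::euclidean_space set \<Rightarrow> ('a \<Rightarrow> real) \<Rightarrow> ('a \<Rightarrow> 'a) \<Rightarrow> bool" where
  "mollified_grad S u v \<longleftrightarrow> integrable lborel u \<and> integrable lborel v \<and>
     (\<forall>r x h. 0 < r \<and> cball x r \<subseteq> S \<longrightarrow>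
        ((\<lambda>t. mollify r u (x + t *\<^sub>R h)) has_real_derivative mollify r (\<lambda>y. v y \<bullet> h) x) (at 0))"

lemma integrable_lebesgue_borel_version:
  fixes f :: "'a::euclidean_space \<Rightarrow> real"
  assumes "integrable lebesgue f"
  shows "\<exists>g. integrable lborel g \<and> (AE x in lborel. f x = g x)"
proof -
  obtain g where g: "g \<in> borel_measurable lborel" "AE x in lborel. f x = g x"
    using completion_ex_borel_measurable_real[of f lborel] assms by auto
  have "integrable lebesgue g"
    using assms by (subst integrable_cong_AE[of g lebesgue f])
      (use g AE_completion[OF g(2)] in \<open>auto simp: measurable_completion elim: eventually_mono\<close>)
  then show ?thesis using g by (auto simp: integrable_completion)
qed

text \<open>
  Both functions are cut off outside \<open>S\<close> and replaced by Borel versions. A translated mollifier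
  supported in \<open>S\<close> is a test function, and for it the definition of a weak gradient is exactly the
  formula of \<open>DERIV_mollify\<close> in the coordinate directions; other directions follow by linearity.
\<close>

lemma mollified_grad_of_weak_grad:
  fixes u :: "'a::euclidean_space \<Rightarrow> real"
  assumes w: "is_weak_grad A u v" and S: "compact S" "S \<subseteq> A"
  shows "\<exists>u' v'. mollified_grad S u' v' \<and>
     (AE x in lborel. u' x = indicator S x * u x \<and> v' x = indicator S x *\<^sub>R v x)"
proof -
  have iu: "integrable lebesgue (\<lambda>x. indicator S x * u x)"
    and iv: "integrable lebesgue (\<lambda>x. indicator S x *\<^sub>R v x)"
    using w S by (auto simp: is_weak_grad_def L1_loc_def set_integrable_def)
  obtain u' where u': "integrable lborel u'" "AE x in lborel. indicator S x * u x = u' x"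
    using integrable_lebesgue_borel_version[OF iu] by blast
  have "\<forall>b\<in>Basis. \<exists>g. integrable lborel g \<and> (AE x in lborel. (indicator S x *\<^sub>R v x) \<bullet> b = g x)"
    using integrable_lebesgue_borel_version[OF integrable_inner_left[OF iv]] by blast
  then obtain g where g: "\<And>b. b \<in> Basis \<Longrightarrow> integrable lborel (g b)"
    "\<And>b. b \<in> Basis \<Longrightarrow> AE x in lborel. (indicator S x *\<^sub>R v x) \<bullet> b = g b x" by metis
  define v' where "v' x = (\<Sum>b\<in>Basis. g b x *\<^sub>R b)" for x
  have v'i: "integrable lborel v'" unfolding v'_def[abs_def] using g(1) by (intro Bochner_Integration.integrable_sum integrable_scaleR_left) auto
  have v'b: "v' x \<bullet> b = g b x" if "b \<in> Basis" for x b
    using that by (simp add: v'_def inner_sum_left inner_Basis if_distrib sum.delta cong: if_cong)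
  have "AE x in lborel. \<forall>b\<in>Basis. (indicator S x *\<^sub>R v x) \<bullet> b = g b x"
    using g(2) by (intro AE_finite_allI) auto
  then have v'eq: "AE x in lborel. v' x = indicator S x *\<^sub>R v x"
  proof eventually_elim
    case (elim x)
    show ?case by (rule euclidean_eqI) (use elim v'b in metis)
  qed
  have [measurable]: "u' \<in> borel_measurable borel" "v' \<in> borel_measurable borel" using u' v'i by auto
  have basis: "- (LINT y|lborel. u' y * frechet_derivative (mollifier r) (at (y - x)) b) = mollify r (\<lambda>y. v' y \<bullet> b) x"
    if r: "0 < r" "cball x r \<subseteq> S" and b: "b \<in> Basis" for r x b
  proof -
    define \<phi> where "\<phi> = (\<lambda>y. mollifier r (y - x))"
    have \<phi>: "\<phi> \<in> test_functions A"
      unfolding \<phi>_def using r S by (intro mollifier_test_function) auto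
    have fd: "frechet_derivative \<phi> (at y) = frechet_derivative (mollifier r) (at (y - x))" for y
      unfolding \<phi>_def by (rule frechet_derivative_shift[OF differentiable_mollifier])
    have "{y. \<phi> y \<noteq> 0} \<subseteq> cball x r" 
      using mollifier_eq_0[OF r(1)] unfolding \<phi>_def subset_iff mem_Collect_eq mem_cball dist_norm
      by (metis linorder_le_cases norm_minus_commute)
    then have cl: "closure {y. \<phi> y \<noteq> 0} \<subseteq> S" using r(2) closure_minimal[of _ "cball x r"] by blast
    have zero: "frechet_derivative (mollifier r) (at (y - x)) b = 0" "\<phi> y = 0" if "y \<notin> S" for y
    proof -
      have n: "y \<notin> closure {y. \<phi> y \<noteq> 0}" using cl that by blast
      show "frechet_derivative (mollifier r) (at (y - x)) b = 0"
        using frechet_derivative_eq_0_outside_support[OF n] by (simp add: fd)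
      show "\<phi> y = 0" using n closure_subset[of "{y. \<phi> y \<noteq> 0}"] by blast
    qed
    have "(LINT y:A|lebesgue. u y * (classical_grad \<phi> y \<bullet> b)) = - (LINT y:A|lebesgue. (v y \<bullet> b) * \<phi> y)"
      using w \<phi> b by (simp add: is_weak_grad_def)
    moreover have "(LINT y:A|lebesgue. u y * (classical_grad \<phi> y \<bullet> b))
        = (LINT y|lborel. u' y * frechet_derivative (mollifier r) (at (y - x)) b)"
      unfolding set_lebesgue_integral_def
    proof (rule integral_lebesgue_eq_lborel)
      show "(\<lambda>y. u' y * frechet_derivative (mollifier r) (at (y - x)) b) \<in> borel_measurable borel"
        using borel_measurable_integrable[OF DERIV_mollify(2)[OF r(1) u'(1), of x b]] by simp
      show "AE y in lborel. indicator A y *\<^sub>R (u y * (classical_grad \<phi> y \<bullet> b)) = u' y * frechet_derivative (mollifier r) (at (y - x)) b"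
        using u'(2)
      proof eventually_elim
        case (elim y)
        then show ?case using zero(1)[of y] S(2) b
          by (cases "y \<in> S") (auto simp: classical_grad_inner fd indicator_def split: if_splits)
      qed
    qed
    moreover have "(LINT y:A|lebesgue. (v y \<bullet> b) * \<phi> y) = mollify r (\<lambda>y. v' y \<bullet> b) x"
      unfolding set_lebesgue_integral_def mollify_def
    proof (rule integral_lebesgue_eq_lborel)
      show "AE y in lborel. indicator A y *\<^sub>R ((v y \<bullet> b) * \<phi> y) = (v' y \<bullet> b) * mollifier r (y - x)"
        using v'eq
      proof eventually_elim
        case (elim y)
        then show ?case using zero(2)[of y] S(2)
          by (cases "y \<in> S") (auto simp: \<phi>_def indicator_def split: if_splits)
      qed
    qed simp
    ultimately show ?thesis by simp
  qed
  have "((\<lambda>t. mollify r u' (x + t *\<^sub>R h)) has_real_derivative mollify r (\<lambda>y. v' y \<bullet> h) x) (at 0)"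
    if r: "0 < r" "cball x r \<subseteq> S" for r x h
  proof -
    have lin: "linear (frechet_derivative (mollifier r) (at z))" for z :: 'a
      by (rule linear_frechet_derivative[OF differentiable_mollifier])
    have fdh: "frechet_derivative (mollifier r) (at z) h
       = (\<Sum>b\<in>Basis. (h \<bullet> b) * frechet_derivative (mollifier r) (at z) b)" for z
    proof -
      have "frechet_derivative (mollifier r) (at z) h = frechet_derivative (mollifier r) (at z) (\<Sum>b\<in>Basis. (h \<bullet> b) *\<^sub>R b)"
        by (simp add: euclidean_representation)
      also have "\<dots> = (\<Sum>b\<in>Basis. (h \<bullet> b) * frechet_derivative (mollifier r) (at z) b)"
        by (simp only: linear_sum[OF lin] linear_cmul[OF lin] real_scaleR_def)
      finally show ?thesis .
    qed
    have "(LINT y|lborel. u' y * frechet_derivative (mollifier r) (at (y - x)) h)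
        = (LINT y|lborel. (\<Sum>b\<in>Basis. (h \<bullet> b) * (u' y * frechet_derivative (mollifier r) (at (y - x)) b)))"
      by (simp add: fdh sum_distrib_left mult_ac)
    also have "\<dots> = (\<Sum>b\<in>Basis. (h \<bullet> b) * (LINT y|lborel. u' y * frechet_derivative (mollifier r) (at (y - x)) b))"
      by (subst Bochner_Integration.integral_sum) (auto intro!: integrable_mult_right DERIV_mollify(2) r u'(1))
    finally have "- (LINT y|lborel. u' y * frechet_derivative (mollifier r) (at (y - x)) h)
        = (\<Sum>b\<in>Basis. (h \<bullet> b) * mollify r (\<lambda>y. v' y \<bullet> b) x)"
      using basis[OF r] by (simp add: sum_negf[symmetric] flip: minus_mult_right cong: sum.cong) (simp add: minus_mult_right)
    also have "\<dots> = (LINT y|lborel. (\<Sum>b\<in>Basis. (h \<bullet> b) * ((v' y \<bullet> b) * mollifier r (y - x))))"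
      unfolding mollify_def
      by (subst Bochner_Integration.integral_sum) (auto intro!: integrable_mult_right integrable_mult_mollifier r integrable_inner_left v'i)
    also have "\<dots> = mollify r (\<lambda>y. v' y \<bullet> h) x"
      unfolding mollify_def
    proof (rule Bochner_Integration.integral_cong)
      fix y
      have "v' y \<bullet> h = (\<Sum>b\<in>Basis. (h \<bullet> b) * (v' y \<bullet> b))"
        by (subst euclidean_inner) (simp add: mult.commute)
      then show "(\<Sum>b\<in>Basis. (h \<bullet> b) * ((v' y \<bullet> b) * mollifier r (y - x))) = (v' y \<bullet> h) * mollifier r (y - x)"
        by (simp add: sum_distrib_right mult.assoc)
    qed simp
    finally show ?thesis using DERIV_mollify(1)[OF r(1) u'(1), of x h] by simp
  qed
  then have "mollified_grad S u' v'" using u' v'i by (simp add: mollified_grad_def)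
  moreover have "AE x in lborel. u' x = indicator S x * u x \<and> v' x = indicator S x *\<^sub>R v x"
    using u'(2) v'eq by eventually_elim simp
  ultimately show ?thesis by blast
qed

lemma mollify_cong_AE:
  assumes "AE x in lborel. u x = u' x" "u \<in> borel_measurable borel" "u' \<in> borel_measurable borel"
  shows "mollify r u = mollify r u'"
  unfolding mollify_def using assms
  by (intro ext integral_cong_AE) (auto elim: eventually_mono)

text \<open>
  The mollifications of \<open>v\<close> and \<open>v'\<close> are derivatives of the same function, hence equal, and they
  converge to \<open>v\<close> and \<open>v'\<close> in \<open>L\<^sup>1\<close>.
\<close>

lemma mollified_grad_unique:
  fixes u :: "'a::euclidean_space \<Rightarrow> real"
  assumes g: "mollified_grad S u v" "mollified_grad S u' v'" and eq: "AE x in lborel. u x = u' x"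
    and C: "C \<in> sets borel" "0 < \<rho>" "\<And>x. x \<in> C \<Longrightarrow> cball x \<rho> \<subseteq> S"
  shows "AE x in lborel. x \<in> C \<longrightarrow> v x = v' x"
proof -
  have int: "integrable lborel u" "integrable lborel u'" "integrable lborel v" "integrable lborel v'"
    using g by (auto simp: mollified_grad_def)
  then have [measurable]: "u \<in> borel_measurable borel" "u' \<in> borel_measurable borel"
     "v \<in> borel_measurable borel" "v' \<in> borel_measurable borel" "C \<in> sets borel" using C by auto
  have meq: "mollify r u = mollify r u'" for r by (rule mollify_cong_AE[OF eq]) auto
  have "AE x in lborel. x \<in> C \<longrightarrow> v x \<bullet> b = v' x \<bullet> b" if "b \<in> Basis" for b
  proof -
    define w where "w x = v x \<bullet> b - v' x \<bullet> b" for x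
    have wi: "integrable lborel w" unfolding w_def using int by (intro Bochner_Integration.integrable_diff integrable_inner_left)
    then have [measurable]: "w \<in> borel_measurable borel" by auto
    have zero: "mollify r w x = 0" if "x \<in> C" "0 < r" "r < \<rho>" for x r
    proof -
      have sub: "cball x r \<subseteq> S" using C(3)[OF that(1)] that(3) by (meson cball_subset_cball_iff less_imp_le order_trans subset_cball)
      have "mollify r (\<lambda>y. v y \<bullet> b) x = mollify r (\<lambda>y. v' y \<bullet> b) x"
        using g that(2) sub meq unfolding mollified_grad_def by (metis DERIV_unique)
      moreover have "mollify r w x = mollify r (\<lambda>y. v y \<bullet> b) x - mollify r (\<lambda>y. v' y \<bullet> b) x"
        unfolding w_def[abs_def] using int that(2) by (intro mollify_diff integrable_inner_left) auto
      ultimately show ?thesis by simp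
    qed
    have "(\<integral>\<^sup>+x. ennreal \<bar>w x\<bar> * indicator C x \<partial>lborel) \<le> 0"
    proof (rule ennreal_le_epsilon)
      fix e :: real assume "0 < e"
      from mollify_tendsto_L1[OF wi this] obtain d where d: "d > 0"
        "\<And>r. 0 < r \<Longrightarrow> r < d \<Longrightarrow> L1_dist (mollify r w) w < ennreal e" by metis
      define r where "r = min d \<rho> / 2"
      have r: "0 < r" "r < d" "r < \<rho>" using d(1) C(2) by (auto simp: r_def)
      have "(\<integral>\<^sup>+x. ennreal \<bar>w x\<bar> * indicator C x \<partial>lborel) \<le> L1_dist (mollify r w) w"
        by (rule nn_integral_mono) (auto simp: indicator_def zero[OF _ r(1,3)])
      then show "(\<integral>\<^sup>+x. ennreal \<bar>w x\<bar> * indicator C x \<partial>lborel) \<le> 0 + ennreal e"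
        using d(2)[OF r(1,2)] by (simp add: order.strict_implies_order order_trans)
    qed
    then have "AE x in lborel. ennreal \<bar>w x\<bar> * indicator C x = 0"
      by (subst (asm) le_zero_eq, subst (asm) nn_integral_0_iff_AE) auto
    then show ?thesis by eventually_elim (auto simp: w_def indicator_def split: if_splits)
  qed
  then have "AE x in lborel. \<forall>b\<in>Basis. x \<in> C \<longrightarrow> v x \<bullet> b = v' x \<bullet> b" by (intro AE_finite_allI) auto
  then show ?thesis by eventually_elim (metis euclidean_eqI)
qed

text \<open>
  The points of distance at least \<open>\<rho>\<close> from the complement of \<open>U\<close>, within a ball of radius \<open>R\<close>.
  As \<open>\<rho>\<close> decreases and \<open>R\<close> increases, these compact sets exhaust an open set \<open>U\<close>.
\<close>

definition erode :: "'a::euclidean_space set \<Rightarrow> real \<Rightarrow> real \<Rightarrow> 'a set" where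
  "erode U \<rho> R = {x \<in> cball 0 R. ball x \<rho> \<subseteq> U}"

lemma compact_erode: "compact (erode U \<rho> R)"
proof -
  have "erode U \<rho> R = cball 0 R \<inter> (\<Inter>z\<in>-U. {x. \<rho> \<le> dist x z})"
  proof (rule set_eqI)
    fix x
    have "ball x \<rho> \<subseteq> U \<longleftrightarrow> (\<forall>z\<in>-U. \<not> dist x z < \<rho>)" by auto
    then show "x \<in> erode U \<rho> R \<longleftrightarrow> x \<in> cball 0 R \<inter> (\<Inter>z\<in>-U. {x. \<rho> \<le> dist x z})"
      by (simp add: erode_def not_less)
  qed
  moreover have "closed {x. \<rho> \<le> dist x z}" for z
    by (intro closed_Collect_le continuous_intros)
  ultimately show ?thesis by (simp only:) (intro compact_Int_closed compact_cball closed_INT ballI)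
qed

lemma erode_subset: "0 < \<rho> \<Longrightarrow> erode U \<rho> R \<subseteq> U"
  by (auto simp: erode_def)

text \<open>
  Starting at distance \<open>3 * \<rho>\<close> from the complement, one step of length \<open>\<rho>\<close> for a translation and
  another one for a mollification keep distance \<open>\<rho>\<close>.
\<close>

lemma cball_subset_erode:
  assumes "x \<in> erode U (3 * \<rho>) R" "\<rho> \<le> 1"
  shows "cball x (2 * \<rho>) \<subseteq> erode U \<rho> (R + 2)"
proof
  fix z assume z: "z \<in> cball x (2 * \<rho>)"
  have "norm z \<le> norm x + dist x z" using norm_triangle_sub[of z x] by (simp add: dist_norm norm_minus_commute)
  moreover have "ball z \<rho> \<subseteq> ball x (3 * \<rho>)"
  proof
    fix y assume "y \<in> ball z \<rho>"
    then show "y \<in> ball x (3 * \<rho>)" using z dist_triangle[of x y z] by simp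
  qed
  ultimately show "z \<in> erode U \<rho> (R + 2)" using assms z by (auto simp: erode_def)
qed

lemma erode_exhausts:
  assumes "open U" "x \<in> U"
  shows "\<exists>n. x \<in> erode U (3 * (1 / real (Suc n))) (real n)"
proof -
  obtain e where e: "e > 0" "ball x e \<subseteq> U" using assms open_contains_ball by blast
  obtain n where n: "norm x + 3 / e < real n" using reals_Archimedean2 by blast
  have "0 \<le> norm x" "0 < 3 / e" using e by auto
  then have "norm x \<le> real n" "3 / e < real (Suc n)" using n by linarith+
  then have "3 * (1 / real (Suc n)) \<le> e" using e by (simp add: field_simps)
  then have "ball x (3 * (1 / real (Suc n))) \<subseteq> U" using e(2) subset_ball by blast
  then show ?thesis using \<open>norm x \<le> real n\<close> unfolding erode_def by auto
qed

lemma AE_exhaust: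
  assumes "open U" "\<And>n. AE x in lebesgue. x \<in> erode U (3 * (1 / real (Suc n))) (real n) \<longrightarrow> P x"
  shows "AE x in lebesgue. x \<in> U \<longrightarrow> P x"
proof -
  have "AE x in lebesgue. \<forall>n. x \<in> erode U (3 * (1 / real (Suc n))) (real n) \<longrightarrow> P x"
    using assms(2) unfolding AE_all_countable by blast
  then show ?thesis by eventually_elim (use erode_exhausts[OF assms(1)] in blast)
qed

lemma is_weak_grad_unique:
  fixes u :: "'a::euclidean_space \<Rightarrow> real"
  assumes A: "open A" and w: "is_weak_grad A u v" "is_weak_grad A u v'"
  shows "AE x in lebesgue. x \<in> A \<longrightarrow> v x = v' x"
proof (rule AE_exhaust[OF A])
  fix n
  define \<rho> where "\<rho> = 1 / real (Suc n)"
  have \<rho>: "0 < \<rho>" "\<rho> \<le> 1" by (auto simp: \<rho>_def)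
  define S where "S = erode A \<rho> (real n + 2)"
  have S: "compact S" "S \<subseteq> A" unfolding S_def by (rule compact_erode, rule erode_subset[OF \<rho>(1)])
  obtain u1 v1 where 1: "mollified_grad S u1 v1" "AE x in lborel. u1 x = indicator S x * u x \<and> v1 x = indicator S x *\<^sub>R v x"
    using mollified_grad_of_weak_grad[OF w(1) S] by blast
  obtain u2 v2 where 2: "mollified_grad S u2 v2" "AE x in lborel. u2 x = indicator S x * u x \<and> v2 x = indicator S x *\<^sub>R v' x"
    using mollified_grad_of_weak_grad[OF w(2) S] by blast
  define C where "C = erode A (3 * \<rho>) (real n)"
  have C: "cball x (2 * \<rho>) \<subseteq> S" if "x \<in> C" for x
    using cball_subset_erode[of x A \<rho> "real n"] that \<rho> by (simp add: C_def S_def)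
  have "AE x in lborel. x \<in> C \<longrightarrow> v1 x = v2 x"
  proof (rule mollified_grad_unique[OF 1(1) 2(1), where \<rho> = "2 * \<rho>"])
    show "AE x in lborel. u1 x = u2 x" using 1(2) 2(2) by eventually_elim simp
    show "C \<in> sets borel" unfolding C_def using compact_erode by (intro borel_compact)
  qed (use C \<rho> in auto)
  then have "AE x in lborel. x \<in> C \<longrightarrow> v x = v' x"
    using 1(2) 2(2)
  proof eventually_elim
    case (elim x)
    show ?case using elim C[of x] \<rho> by (auto simp: indicator_def subset_iff split: if_splits)
  qed
  then show "AE x in lebesgue. x \<in> erode A (3 * (1 / real (Suc n))) (real n) \<longrightarrow> v x = v' x"
    unfolding C_def \<rho>_def by (rule AE_completion)
qed

section \<open>The Rellich estimate\<close>

text \<open>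
  The fundamental theorem of calculus along the segment from \<open>x\<close> to \<open>x + h\<close>, followed by Tonelli's
  theorem, translation invariance and the contraction property.
\<close>

lemma mollify_translation:
  fixes u :: "'a::euclidean_space \<Rightarrow> real"
  assumes g: "mollified_grad S u v" and C: "C \<in> sets borel" "\<And>x. x \<in> C \<Longrightarrow> cball x (2 * \<rho>) \<subseteq> S"
    and h: "norm h \<le> \<rho>" and r: "0 < r" "r \<le> \<rho>"
  shows "(\<integral>\<^sup>+x. ennreal \<bar>mollify r u (x + h) - mollify r u x\<bar> * indicator C x \<partial>lborel)
           \<le> ennreal (norm h) * (\<integral>\<^sup>+x. ennreal (norm (v x)) \<partial>lborel)"
proof -
  have int: "integrable lborel u" "integrable lborel v" using g by (auto simp: mollified_grad_def)
  then have [measurable]: "u \<in> borel_measurable borel" "v \<in> borel_measurable borel" "C \<in> sets borel" using C by auto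
  define w where "w = mollify r (\<lambda>y. v y \<bullet> h)"
  have vh: "integrable lborel (\<lambda>y. v y \<bullet> h)" using int(2) by (rule integrable_inner_left)
  have [measurable]: "w \<in> borel_measurable borel" unfolding w_def by measurable
  have wc: "continuous_on UNIV w" unfolding w_def by (rule continuous_mollify[OF r(1) vh])
  have pt: "ennreal \<bar>mollify r u (x + h) - mollify r u x\<bar>
      \<le> (\<integral>\<^sup>+s. ennreal \<bar>w (x + s *\<^sub>R h)\<bar> * indicator {0..1} s \<partial>lborel)" if x: "x \<in> C" for x
  proof -
    define F where "F s = mollify r u (x + s *\<^sub>R h)" for s
    have D: "(F has_real_derivative w (x + s *\<^sub>R h)) (at s)" if s: "0 \<le> s" "s \<le> 1" for s
    proof -
      have "cball (x + s *\<^sub>R h) r \<subseteq> cball x (2 * \<rho>)"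
      proof
        fix z assume "z \<in> cball (x + s *\<^sub>R h) r"
        then have "dist (x + s *\<^sub>R h) z \<le> \<rho>" using r by simp
        moreover have "dist x (x + s *\<^sub>R h) \<le> \<rho>"
          using s h mult_mono[of s 1 "norm h" \<rho>] by (simp add: dist_norm)
        ultimately show "z \<in> cball x (2 * \<rho>)" using dist_triangle[of x z "x + s *\<^sub>R h"] by simp
      qed
      then have "cball (x + s *\<^sub>R h) r \<subseteq> S" using C(2)[OF x] by blast
      then have "((\<lambda>t. mollify r u ((x + s *\<^sub>R h) + t *\<^sub>R h)) has_real_derivative w (x + s *\<^sub>R h)) (at 0)"
        using g r(1) unfolding mollified_grad_def w_def by blast
      moreover have "(\<lambda>t. mollify r u ((x + s *\<^sub>R h) + t *\<^sub>R h)) = (\<lambda>t. F (t + s))"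
        by (simp add: F_def algebra_simps)
      ultimately show ?thesis using DERIV_shift[of F "w (x + s *\<^sub>R h)" 0 s] by simp
    qed
    have cont: "isCont (\<lambda>s. w (x + s *\<^sub>R h)) s" for s
      by (rule isCont_o2[of _ "\<lambda>s. x + s *\<^sub>R h"]) (use wc in \<open>auto intro!: continuous_intros simp: continuous_on_eq_continuous_at\<close>)
    have bi: "has_bochner_integral lborel (\<lambda>s. w (x + s *\<^sub>R h) * indicator {0..1} s) (F 1 - F 0)"
      by (rule has_bochner_integral_FTC_Icc_real) (use D cont in auto)
    have "F 1 - F 0 = (LINT s|lborel. w (x + s *\<^sub>R h) * indicator {0..1} s)"
      using has_bochner_integral_integral_eq[OF bi] by simp
    moreover have I: "integrable lborel (\<lambda>s. w (x + s *\<^sub>R h) * indicator {0..1} s)"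
      using bi has_bochner_integral_iff by blast
    ultimately have "ennreal \<bar>F 1 - F 0\<bar> \<le> (\<integral>\<^sup>+s. ennreal \<bar>w (x + s *\<^sub>R h) * indicator {0..1} s\<bar> \<partial>lborel)"
      using integral_norm_bound_ennreal[OF I] by (simp only: real_norm_def)
    also have "\<dots> = (\<integral>\<^sup>+s. ennreal \<bar>w (x + s *\<^sub>R h)\<bar> * indicator {0..1} s \<partial>lborel)"
      by (intro nn_integral_cong) (auto simp: indicator_def)
    finally show ?thesis by (simp add: F_def)
  qed
  have "(\<integral>\<^sup>+x. ennreal \<bar>mollify r u (x + h) - mollify r u x\<bar> * indicator C x \<partial>lborel)
      \<le> (\<integral>\<^sup>+x. (\<integral>\<^sup>+s. ennreal \<bar>w (x + s *\<^sub>R h)\<bar> * indicator {0..1} s \<partial>lborel) \<partial>lborel)"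
    by (rule nn_integral_mono) (use pt in \<open>auto simp: indicator_def\<close>)
  also have "\<dots> = (\<integral>\<^sup>+s. (\<integral>\<^sup>+x. ennreal \<bar>w (x + s *\<^sub>R h)\<bar> * indicator {0..1::real} s \<partial>lborel) \<partial>lborel)"
    by (rule lborel_pair.Fubini'[symmetric]) simp
  also have "\<dots> = (\<integral>\<^sup>+s. (\<integral>\<^sup>+x. ennreal \<bar>w x\<bar> \<partial>lborel) * indicator {0..1::real} s \<partial>lborel)"
  proof (rule nn_integral_cong)
    fix s :: real
    have "(\<integral>\<^sup>+x. ennreal \<bar>w (x + s *\<^sub>R h)\<bar> \<partial>lborel) = (\<integral>\<^sup>+x. ennreal \<bar>w x\<bar> \<partial>lborel)"
      using nn_integral_lborel_plus[of "\<lambda>x. ennreal \<bar>w x\<bar>" "s *\<^sub>R h"] by (simp add: add.commute)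
    then show "(\<integral>\<^sup>+x. ennreal \<bar>w (x + s *\<^sub>R h)\<bar> * indicator {0..1} s \<partial>lborel) = (\<integral>\<^sup>+x. ennreal \<bar>w x\<bar> \<partial>lborel) * indicator {0..1} s"
      by (subst nn_integral_multc) auto
  qed
  also have "\<dots> = (\<integral>\<^sup>+x. ennreal \<bar>w x\<bar> \<partial>lborel)"
    by (subst nn_integral_cmult_indicator) auto
  also have "\<dots> \<le> (\<integral>\<^sup>+x. ennreal \<bar>v x \<bullet> h\<bar> \<partial>lborel)"
    unfolding w_def by (rule nn_integral_mollify_le[OF r(1)]) auto
  also have "\<dots> \<le> (\<integral>\<^sup>+x. ennreal (norm h) * ennreal (norm (v x)) \<partial>lborel)"
    by (intro nn_integral_mono) (simp add: ennreal_mult[symmetric] Cauchy_Schwarz_ineq2 mult.commute[of "norm h"])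
  also have "\<dots> = ennreal (norm h) * (\<integral>\<^sup>+x. ennreal (norm (v x)) \<partial>lborel)"
    by (rule nn_integral_cmult) auto
  finally show ?thesis .
qed

text \<open>
  The radius of mollification tends to zero in \<open>mollify_translation\<close>.
\<close>

lemma translation_L1:
  fixes u :: "'a::euclidean_space \<Rightarrow> real"
  assumes g: "mollified_grad S u v" and C: "C \<in> sets borel" "\<And>x. x \<in> C \<Longrightarrow> cball x (2 * \<rho>) \<subseteq> S"
    and \<rho>: "0 < \<rho>" and h: "norm h \<le> \<rho>"
  shows "(\<integral>\<^sup>+x. ennreal \<bar>u (x + h) - u x\<bar> * indicator C x \<partial>lborel)
           \<le> ennreal (norm h) * (\<integral>\<^sup>+x. ennreal (norm (v x)) \<partial>lborel)"
proof (rule ennreal_le_epsilon)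
  fix e :: real assume e: "0 < e"
  have int: "integrable lborel u" "integrable lborel v" using g by (auto simp: mollified_grad_def)
  then have [measurable]: "u \<in> borel_measurable borel" "v \<in> borel_measurable borel" "C \<in> sets borel" using C by auto
  obtain d where d: "d > 0"
    "\<And>r. 0 < r \<Longrightarrow> r < d \<Longrightarrow> L1_dist (mollify r u) u < ennreal (e / 2)"
    using mollify_tendsto_L1[OF int(1) half_gt_zero[OF e]] by metis
  define r where "r = min d \<rho> / 2"
  have r: "0 < r" "r < d" "r \<le> \<rho>" using d(1) \<rho> by (auto simp: r_def)
  define m where "m = mollify r u"
  have [measurable]: "m \<in> borel_measurable borel" unfolding m_def by measurable
  have "(\<integral>\<^sup>+x. ennreal \<bar>u (x + h) - u x\<bar> * indicator C x \<partial>lborel)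
     \<le> (\<integral>\<^sup>+x. ennreal \<bar>m (h + x) - u (h + x)\<bar> + (ennreal \<bar>m (x + h) - m x\<bar> * indicator C x + ennreal \<bar>m x - u x\<bar>) \<partial>lborel)"
  proof (rule nn_integral_mono)
    fix x
    have "\<bar>u (x + h) - u x\<bar> \<le> \<bar>m (h + x) - u (h + x)\<bar> + (\<bar>m (x + h) - m x\<bar> + \<bar>m x - u x\<bar>)"
      by (simp add: add.commute)
    then show "ennreal \<bar>u (x + h) - u x\<bar> * indicator C x \<le>
       ennreal \<bar>m (h + x) - u (h + x)\<bar> + (ennreal \<bar>m (x + h) - m x\<bar> * indicator C x + ennreal \<bar>m x - u x\<bar>)"
      by (cases "x \<in> C") (auto simp flip: ennreal_plus intro!: ennreal_leI)
  qed
  also have "\<dots> = (\<integral>\<^sup>+x. ennreal \<bar>m (h + x) - u (h + x)\<bar> \<partial>lborel) +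
      ((\<integral>\<^sup>+x. ennreal \<bar>m (x + h) - m x\<bar> * indicator C x \<partial>lborel) + L1_dist m u)"
    by (subst nn_integral_add, simp, simp, subst nn_integral_add) auto
  also have "(\<integral>\<^sup>+x. ennreal \<bar>m (h + x) - u (h + x)\<bar> \<partial>lborel) = L1_dist m u"
    by (rule nn_integral_lborel_plus[of "\<lambda>x. ennreal \<bar>m x - u x\<bar>"]) simp
  also have "L1_dist m u +
      ((\<integral>\<^sup>+x. ennreal \<bar>m (x + h) - m x\<bar> * indicator C x \<partial>lborel) + L1_dist m u)
     \<le> ennreal (e / 2) + (ennreal (norm h) * (\<integral>\<^sup>+x. ennreal (norm (v x)) \<partial>lborel) + ennreal (e / 2))"
    using mollify_translation[OF g C h r(1,3)] d(2)[OF r(1,2)]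
    by (intro add_mono) (simp_all add: m_def less_imp_le)
  also have "\<dots> = ennreal (norm h) * (\<integral>\<^sup>+x. ennreal (norm (v x)) \<partial>lborel) + (ennreal (e / 2) + ennreal (e / 2))"
    by (simp only: ac_simps)
  also have "ennreal (e / 2) + ennreal (e / 2) = ennreal e" using e by (simp flip: ennreal_plus)
  finally show "(\<integral>\<^sup>+x. ennreal \<bar>u (x + h) - u x\<bar> * indicator C x \<partial>lborel)
     \<le> ennreal (norm h) * (\<integral>\<^sup>+x. ennreal (norm (v x)) \<partial>lborel) + ennreal e" .
qed

text \<open>
  This is what makes sequences compact: a bound on the gradient alone makes the mollification of radius \<open>r\<close>
  close to the identity in \<open>L\<^sup>1\<close>, since the error averages translations by at most \<open>r\<close>.
\<close>

lemma mollify_error_L1: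
  fixes u :: "'a::euclidean_space \<Rightarrow> real"
  assumes g: "mollified_grad S u v" and C: "C \<in> sets borel" "\<And>x. x \<in> C \<Longrightarrow> cball x (2 * \<rho>) \<subseteq> S"
    and r: "0 < r" "r \<le> \<rho>"
  shows "(\<integral>\<^sup>+x. ennreal \<bar>mollify r u x - u x\<bar> * indicator C x \<partial>lborel)
           \<le> ennreal r * (\<integral>\<^sup>+x. ennreal (norm (v x)) \<partial>lborel)"
proof -
  have int: "integrable lborel u" "integrable lborel v" using g by (auto simp: mollified_grad_def)
  then have [measurable]: "u \<in> borel_measurable borel" "v \<in> borel_measurable borel" "C \<in> sets borel" using C by auto
  define V where "V = (\<integral>\<^sup>+x. ennreal (norm (v x)) \<partial>lborel)"
  have "(\<integral>\<^sup>+x. ennreal \<bar>mollify r u x - u x\<bar> * indicator C x \<partial>lborel)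
     \<le> (\<integral>\<^sup>+x. (\<integral>\<^sup>+z. ennreal \<bar>u (x + z) - u x\<bar> * ennreal (mollifier r z) \<partial>lborel) * indicator C x \<partial>lborel)"
    by (intro nn_integral_mono mult_right_mono abs_mollify_minus_le r int) auto
  also have "\<dots> = (\<integral>\<^sup>+x. (\<integral>\<^sup>+z. ennreal \<bar>u (x + z) - u x\<bar> * ennreal (mollifier r z) * indicator C x \<partial>lborel) \<partial>lborel)"
    by (intro nn_integral_cong, subst nn_integral_multc) auto
  also have "\<dots> = (\<integral>\<^sup>+z. (\<integral>\<^sup>+x. ennreal \<bar>u (x + z) - u x\<bar> * ennreal (mollifier r z) * indicator C x \<partial>lborel) \<partial>lborel)"
    by (rule lborel_pair.Fubini'[symmetric]) simp
  also have "\<dots> \<le> (\<integral>\<^sup>+z. (ennreal r * V) * ennreal (mollifier r (z::'a)) \<partial>lborel)"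
  proof (rule nn_integral_mono)
    fix z :: 'a
    have eq: "(\<integral>\<^sup>+x. ennreal \<bar>u (x + z) - u x\<bar> * ennreal (mollifier r z) * indicator C x \<partial>lborel)
        = (\<integral>\<^sup>+x. ennreal \<bar>u (x + z) - u x\<bar> * indicator C x \<partial>lborel) * ennreal (mollifier r z)"
      by (subst nn_integral_multc[symmetric]) (auto simp: mult_ac)
    show "(\<integral>\<^sup>+x. ennreal \<bar>u (x + z) - u x\<bar> * ennreal (mollifier r z) * indicator C x \<partial>lborel) \<le> (ennreal r * V) * ennreal (mollifier r z)"
    proof (cases "norm z < r")
      case True
      then have "(\<integral>\<^sup>+x. ennreal \<bar>u (x + z) - u x\<bar> * indicator C x \<partial>lborel) \<le> ennreal (norm z) * V"
        unfolding V_def using r by (intro translation_L1[OF g C]) auto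
      also have "\<dots> \<le> ennreal r * V" using True by (intro mult_right_mono ennreal_leI) auto
      finally show ?thesis unfolding eq by (rule mult_right_mono) simp
    next
      case False
      then show ?thesis using mollifier_eq_0[OF r(1), of z] by simp
    qed
  qed
  also have "\<dots> = ennreal r * V" by (subst nn_integral_cmult) (auto simp: nn_integral_mollifier[OF r(1)])
  finally show ?thesis unfolding V_def .
qed

section \<open>The chain rule for weak gradients\<close>

text \<open>
  A single sequence of radii serves both functions. Convergence almost everywhere is needed for \<open>u\<close>,
  which will occur inside nonlinear functions; \<open>L\<^sup>1\<close> convergence is enough for \<open>w\<close>, which will
  occur linearly.
\<close>

lemma mollify_AE_sequence:
  fixes u w :: "'a::euclidean_space \<Rightarrow> real"
  assumes u: "integrable lborel u" and w: "integrable lborel w" and "0 < \<epsilon>"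
  obtains r where "\<And>n::nat. 0 < r n" "\<And>n. r n < \<epsilon>" "AE x in lborel. (\<lambda>n. mollify (r n) u x) \<longlonglongrightarrow> u x"
    "(\<lambda>n. LINT x|lborel. \<bar>mollify (r n) w x - w x\<bar>) \<longlonglongrightarrow> 0"
proof -
  have "\<exists>r. 0 < r \<and> r < \<epsilon> \<and> (LINT x|lborel. \<bar>mollify r u x - u x\<bar>) < 1 / real (Suc n) \<and>
       (LINT x|lborel. \<bar>mollify r w x - w x\<bar>) < 1 / real (Suc n)" for n
  proof -
    have pos: "0 < 1 / real (Suc n)" by simp
    obtain d where d: "d > 0" "\<And>r. 0 < r \<Longrightarrow> r < d \<Longrightarrow> L1_dist (mollify r u) u < ennreal (1 / real (Suc n))"
      using mollify_tendsto_L1[OF u pos] by metis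
    obtain d' where d': "d' > 0" "\<And>r. 0 < r \<Longrightarrow> r < d' \<Longrightarrow> L1_dist (mollify r w) w < ennreal (1 / real (Suc n))"
      using mollify_tendsto_L1[OF w pos] by metis
    define r where "r = min (min d d') \<epsilon> / 2"
    have r: "0 < r" "r < d" "r < d'" "r < \<epsilon>" using d(1) d'(1) \<open>0 < \<epsilon>\<close> by (auto simp: r_def)
    have conv: "(LINT x|lborel. \<bar>mollify r f x - f x\<bar>) < 1 / real (Suc n)"
      if f: "integrable lborel f" and lt: "L1_dist (mollify r f) f < ennreal (1 / real (Suc n))"
      for f :: "'a \<Rightarrow> real"
    proof -
      have "integrable lborel (\<lambda>x. \<bar>mollify r f x - f x\<bar>)"
        by (intro integrable_abs Bochner_Integration.integrable_diff integrable_mollify r f)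
      from nn_integral_eq_integral[OF this] lt show ?thesis
        by (simp add: ennreal_less_iff)
    qed
    show ?thesis using r conv[OF u d(2)] conv[OF w d'(2)] by blast
  qed
  then obtain r where r: "\<And>n. 0 < r n" "\<And>n. r n < \<epsilon>"
    "\<And>n. (LINT x|lborel. \<bar>mollify (r n) u x - u x\<bar>) < 1 / real (Suc n)"
    "\<And>n. (LINT x|lborel. \<bar>mollify (r n) w x - w x\<bar>) < 1 / real (Suc n)" by metis
  have lim: "(\<lambda>n. LINT x|lborel. \<bar>mollify (r n) f x - f x\<bar>) \<longlonglongrightarrow> 0"
    if "\<And>n. (LINT x|lborel. \<bar>mollify (r n) f x - f x\<bar>) < 1 / real (Suc n)" for f :: "'a \<Rightarrow> real"
  proof (rule tendsto_sandwich[OF _ _ tendsto_const LIMSEQ_Suc[OF lim_1_over_n]])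
    show "\<forall>\<^sub>F n in sequentially. 0 \<le> (LINT x|lborel. \<bar>mollify (r n) f x - f x\<bar>)"
      by (intro always_eventually allI Bochner_Integration.integral_nonneg) auto
    show "\<forall>\<^sub>F n in sequentially. (LINT x|lborel. \<bar>mollify (r n) f x - f x\<bar>) \<le> 1 / real (Suc n)"
      using that by (intro always_eventually allI less_imp_le)
  qed
  have "\<exists>k. strict_mono k \<and> (AE x in lborel. (\<lambda>n. mollify (r (k n)) u x - u x) \<longlonglongrightarrow> 0)"
    using tendsto_L1_AE_subseq[of lborel "\<lambda>n x. mollify (r n) u x - u x"] lim[OF r(3)]
      Bochner_Integration.integrable_diff[OF integrable_mollify[OF r(1) u] u] by simp
  then obtain k where k: "strict_mono k" "AE x in lborel. (\<lambda>n. mollify (r (k n)) u x - u x) \<longlonglongrightarrow> 0" by blast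
  show ?thesis
  proof (rule that[of "r \<circ> k"])
    show "AE x in lborel. (\<lambda>n. mollify ((r \<circ> k) n) u x) \<longlonglongrightarrow> u x"
      using k(2) by eventually_elim (simp add: LIM_zero_iff)
    show "(\<lambda>n. LINT x|lborel. \<bar>mollify ((r \<circ> k) n) w x - w x\<bar>) \<longlonglongrightarrow> 0"
      using LIMSEQ_subseq_LIMSEQ[OF lim[OF r(4)] k(1)] by (simp add: o_def)
  qed (use r in auto)
qed

text \<open>
  For the mollifications, the product of \<open>T\<close> after them with \<open>\<phi>\<close> is Lipschitz, and its directional
  derivative is given by the classical rules. In the limit the terms with \<open>T\<close> and \<open>T'\<close> are bounded
  and converge almost everywhere, while the gradient converges in \<open>L\<^sup>1\<close>.
\<close>

lemma integral_chain_by_parts: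
  fixes u :: "'a::euclidean_space \<Rightarrow> real"
  assumes g: "mollified_grad S u v"
    and T: "\<And>s. (T has_real_derivative T' s) (at s)" "continuous_on UNIV T'" "\<And>s. \<bar>T' s\<bar> \<le> 1" "\<And>s. \<bar>T s\<bar> \<le> B"
    and \<phi>: "\<phi> \<in> test_functions A" and \<epsilon>: "0 < \<epsilon>" "\<And>x. \<phi> x \<noteq> 0 \<Longrightarrow> cball x \<epsilon> \<subseteq> S"
    and b: "b \<in> Basis"
  shows "(LINT x|lborel. T (u x) * frechet_derivative \<phi> (at x) b) = - (LINT x|lborel. T' (u x) * (v x \<bullet> b) * \<phi> x)"
proof -
  have ui: "integrable lborel u" and vi: "integrable lborel (\<lambda>x. v x \<bullet> b)"
    using g by (auto simp: mollified_grad_def intro: integrable_inner_left)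
  define w where "w x = v x \<bullet> b" for x
  have wi: "integrable lborel w" using vi by (simp add: w_def[abs_def])
  have Tc: "continuous_on UNIV T" by (rule DERIV_continuous_on) (use T(1) in \<open>auto intro: DERIV_subset\<close>)
  have [measurable]: "u \<in> borel_measurable borel" "w \<in> borel_measurable borel"
    "T \<in> borel_measurable borel" "T' \<in> borel_measurable borel"
    using ui wi Tc T(2) by (auto intro: borel_measurable_continuous_onI)
  have TL: "\<bar>T s - T t\<bar> \<le> \<bar>s - t\<bar>" for s t
    using field_differentiable_bound[of UNIV T T' 1 s t] T(1,3) by auto
  have B: "B \<ge> 0" using T(4)[of 0] by linarith
  define Z where "Z = closure {x. \<phi> x \<noteq> 0}"
  have Z: "compact Z" and Ck: "C_k 1 \<phi>" using \<phi> by (auto simp: test_functions_def Z_def)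
  have Z0: "x \<notin> Z \<Longrightarrow> \<phi> x = 0" for x using closure_subset[of "{x. \<phi> x \<noteq> 0}"] by (auto simp: Z_def)
  have diff: "\<phi> differentiable at x" for x using Ck by simp
  have \<phi>c: "continuous_on UNIV \<phi>" using C_k_pred[of 0 \<phi>] Ck by simp
  define d\<phi> where "d\<phi> x = frechet_derivative \<phi> (at x) b" for x
  have d\<phi>c: "continuous_on UNIV d\<phi>" using Ck b by (simp add: d\<phi>_def[abs_def])
  have d\<phi>0: "x \<notin> Z \<Longrightarrow> d\<phi> x = 0" for x
    using frechet_derivative_eq_0_outside_support[of x \<phi>] by (simp add: Z_def d\<phi>_def)
  obtain R where R: "\<And>x. x \<in> Z \<Longrightarrow> norm x \<le> R" using compact_imp_bounded[OF Z] by (auto simp: bounded_iff)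
  have outside: "R < norm x \<Longrightarrow> \<phi> x = 0" "R < norm x \<Longrightarrow> d\<phi> x = 0" for x using Z0 d\<phi>0 R[of x] by force+
  have \<phi>i: "integrable lborel \<phi>" "integrable lborel d\<phi>"
    by (rule integrable_continuous_bounded_support[of _ R], fact \<phi>c d\<phi>c, fact outside)+
  have [measurable]: "\<phi> \<in> borel_measurable borel" "d\<phi> \<in> borel_measurable borel" using \<phi>i by auto
  obtain L\<phi> where L\<phi>: "L\<phi> \<ge> 0" "\<And>x y. \<bar>\<phi> x - \<phi> y\<bar> \<le> L\<phi> * norm (x - y)" using test_function_Lipschitz[OF \<phi>] by blast
  obtain N where N: "N \<ge> 0" "\<And>x. \<bar>\<phi> x\<bar> \<le> N"
  proof -
    have "compact (\<phi> ` Z)" by (intro compact_continuous_image continuous_on_subset[OF \<phi>c] Z) auto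
    then obtain N where "\<forall>y\<in>\<phi> ` Z. \<bar>y\<bar> \<le> N" using bounded_real compact_imp_bounded by metis
    then have "\<bar>\<phi> x\<bar> \<le> max 0 N" for x using Z0[of x] by (cases "x \<in> Z") (auto simp: max_def)
    then show thesis by (intro that[of "max 0 N"]) auto
  qed
  obtain r where r: "\<And>n::nat. 0 < r n" "\<And>n. r n < \<epsilon>" "AE x in lborel. (\<lambda>n. mollify (r n) u x) \<longlonglongrightarrow> u x"
    "(\<lambda>n. LINT x|lborel. \<bar>mollify (r n) w x - w x\<bar>) \<longlonglongrightarrow> 0"
    using mollify_AE_sequence[OF ui wi \<epsilon>(1)] by blast
  define m where "m n = mollify (r n) u" for n
  define k where "k n = mollify (r n) w" for n
  have ki: "integrable lborel (k n)" for n unfolding k_def by (rule integrable_mollify[OF r(1) wi])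
  have [measurable]: "m n \<in> borel_measurable borel" "k n \<in> borel_measurable borel" for n unfolding m_def k_def by measurable
  have i1: "integrable lborel (\<lambda>x. T (m n x) * d\<phi> x)" for n
  proof (rule Bochner_Integration.integrable_bound[of _ "\<lambda>x. B * d\<phi> x"])
    show "AE x in lborel. norm (T (m n x) * d\<phi> x) \<le> norm (B * d\<phi> x)"
      using T(4) B by (auto simp: abs_mult intro!: mult_right_mono)
  qed (use \<phi>i in auto)
  have bnd: "\<bar>T' s * z * \<phi> x\<bar> \<le> N * \<bar>z\<bar>" for s z x
  proof -
    have "\<bar>T' s\<bar> * \<bar>z\<bar> * \<bar>\<phi> x\<bar> \<le> 1 * \<bar>z\<bar> * N"
      using T(3) N by (intro mult_mono) auto
    then show ?thesis by (simp add: abs_mult mult.commute)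
  qed
  have i2: "integrable lborel (\<lambda>x. T' (m n x) * f x * \<phi> x)" if f: "integrable lborel f" for n f
  proof (rule Bochner_Integration.integrable_bound[of _ "\<lambda>x. N * f x"])
    show "AE x in lborel. norm (T' (m n x) * f x * \<phi> x) \<le> norm (N * f x)"
      using bnd N(1) by (auto simp: abs_mult)
    have [measurable]: "f \<in> borel_measurable borel" using f by auto
    show "(\<lambda>x. T' (m n x) * f x * \<phi> x) \<in> borel_measurable lborel" by measurable
  qed (use f in auto)
  have IBP: "(LINT x|lborel. T' (m n x) * k n x * \<phi> x + T (m n x) * d\<phi> x) = 0" for n
  proof -
    obtain L where L: "L \<ge> 0" "\<And>x y. \<bar>m n x - m n y\<bar> \<le> L * norm (x - y)"
      unfolding m_def using mollify_Lipschitz[OF r(1) ui] by blast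
    show ?thesis
    proof (rule integral_directional_derivative_eq_0[where h = "\<lambda>x. T (m n x) * \<phi> x" and b = b and R = R])
    show "\<bar>T (m n x) * \<phi> x - T (m n y) * \<phi> y\<bar> \<le> (L * N + B * L\<phi>) * norm (x - y)" for x y
    proof -
      have "T (m n x) * \<phi> x - T (m n y) * \<phi> y = (T (m n x) - T (m n y)) * \<phi> x + T (m n y) * (\<phi> x - \<phi> y)"
        by (simp add: algebra_simps)
      also have "\<bar>\<dots>\<bar> \<le> \<bar>T (m n x) - T (m n y)\<bar> * \<bar>\<phi> x\<bar> + \<bar>T (m n y)\<bar> * \<bar>\<phi> x - \<phi> y\<bar>"
        using abs_triangle_ineq by (simp add: abs_mult[symmetric])
      also have "\<dots> \<le> (L * norm (x - y)) * N + B * (L\<phi> * norm (x - y))"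
        using order_trans[OF TL L(2)] N T(4) L\<phi> L(1) B by (intro add_mono mult_mono) auto
      finally show ?thesis by (simp add: algebra_simps)
    qed
    show "T (m n x) * \<phi> x = 0" if "R < norm x" for x using outside(1)[OF that] by simp
    show "((\<lambda>t. T (m n (x + t *\<^sub>R b)) * \<phi> (x + t *\<^sub>R b)) has_real_derivative T' (m n x) * k n x * \<phi> x + T (m n x) * d\<phi> x) (at 0)" for x
    proof -
      obtain d where d: "((\<lambda>t. m n (x + t *\<^sub>R b)) has_real_derivative d) (at 0)"
        unfolding m_def using DERIV_mollify(1)[OF r(1) ui] by blast
      \<comment> \<open>The derivative of \<open>m n\<close> is known to be \<open>k n\<close> only where \<open>\<phi>\<close> does not vanish, which suffices.\<close>
      have eq: "d * \<phi> x = k n x * \<phi> x"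
      proof (cases "\<phi> x = 0")
        case False
        have "cball x (r n) \<subseteq> S" using \<epsilon>(2)[OF False] r(2)[of n] by (meson less_imp_le order_trans subset_cball)
        then have "((\<lambda>t. m n (x + t *\<^sub>R b)) has_real_derivative k n x) (at 0)"
          using g r(1) unfolding mollified_grad_def m_def k_def w_def[abs_def] by blast
        from DERIV_unique[OF d this] show ?thesis by simp
      qed simp
      have "((\<lambda>t. T (m n (x + t *\<^sub>R b))) has_real_derivative T' (m n (x + 0 *\<^sub>R b)) * d) (at 0)"
        by (rule DERIV_chain2[OF T(1) d])
      from DERIV_mult[OF this directional_DERIV[OF diff, of x b]]
      show ?thesis using eq by (simp add: d\<phi>_def mult.assoc) (simp add: mult_ac add.commute)
    qed
    qed
  qed
  \<comment> \<open>The gradient \<open>k n\<close> is split into its limit \<open>w\<close> and an error small in \<open>L\<^sup>1\<close>.\<close>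
  have split: "(LINT x|lborel. T (m n x) * d\<phi> x) + (LINT x|lborel. T' (m n x) * w x * \<phi> x)
      + (LINT x|lborel. T' (m n x) * (k n x - w x) * \<phi> x) = 0" for n
  proof -
    have "(LINT x|lborel. T' (m n x) * k n x * \<phi> x + T (m n x) * d\<phi> x)
       = (LINT x|lborel. T' (m n x) * k n x * \<phi> x) + (LINT x|lborel. T (m n x) * d\<phi> x)"
      by (rule Bochner_Integration.integral_add[OF i2[OF ki] i1])
    moreover have "(LINT x|lborel. T' (m n x) * k n x * \<phi> x)
       = (LINT x|lborel. T' (m n x) * w x * \<phi> x) + (LINT x|lborel. T' (m n x) * (k n x - w x) * \<phi> x)"
      by (subst Bochner_Integration.integral_add[OF i2[OF wi] i2[OF Bochner_Integration.integrable_diff[OF ki wi]], symmetric])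
        (simp add: algebra_simps)
    ultimately show ?thesis using IBP[of n] by simp
  qed
  have conv: "AE x in lborel. (\<lambda>n. m n x) \<longlonglongrightarrow> u x" using r(3) by (simp add: m_def)
  have TT: "isCont T s" "isCont T' s" for s using Tc T(2) by (auto simp: continuous_on_eq_continuous_at)
  have l1: "(\<lambda>n. LINT x|lborel. T (m n x) * d\<phi> x) \<longlonglongrightarrow> (LINT x|lborel. T (u x) * d\<phi> x)"
  proof (rule integral_dominated_convergence[where w = "\<lambda>x. B * \<bar>d\<phi> x\<bar>"])
    show "AE x in lborel. (\<lambda>n. T (m n x) * d\<phi> x) \<longlonglongrightarrow> T (u x) * d\<phi> x"
      using conv by eventually_elim (intro tendsto_mult tendsto_const isCont_tendsto_compose[OF TT(1)])
    show "AE x in lborel. norm (T (m n x) * d\<phi> x) \<le> B * \<bar>d\<phi> x\<bar>" for n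
      using T(4) by (auto simp: abs_mult intro!: mult_right_mono)
  qed (use \<phi>i in auto)
  have l2: "(\<lambda>n. LINT x|lborel. T' (m n x) * w x * \<phi> x) \<longlonglongrightarrow> (LINT x|lborel. T' (u x) * w x * \<phi> x)"
  proof (rule integral_dominated_convergence[where w = "\<lambda>x. N * \<bar>w x\<bar>"])
    show "AE x in lborel. (\<lambda>n. T' (m n x) * w x * \<phi> x) \<longlonglongrightarrow> T' (u x) * w x * \<phi> x"
      using conv by eventually_elim (intro tendsto_mult tendsto_const isCont_tendsto_compose[OF TT(2)])
    show "AE x in lborel. norm (T' (m n x) * w x * \<phi> x) \<le> N * \<bar>w x\<bar>" for n
      using bnd by simp
  qed (use wi in auto)
  have l3: "(\<lambda>n. LINT x|lborel. T' (m n x) * (k n x - w x) * \<phi> x) \<longlonglongrightarrow> 0"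
  proof (rule tendsto_0_le[where K = N, OF r(4)], rule always_eventually, rule allI)
    fix n
    have kwi: "integrable lborel (\<lambda>x. k n x - w x)" by (intro Bochner_Integration.integrable_diff ki wi)
    have "\<bar>LINT x|lborel. T' (m n x) * (k n x - w x) * \<phi> x\<bar> \<le> (LINT x|lborel. N * \<bar>k n x - w x\<bar>)"
      using kwi i2[OF kwi] bnd
      by (intro integral_abs_bound[THEN order_trans] integral_mono) auto
    moreover have "0 \<le> (LINT x|lborel. \<bar>k n x - w x\<bar>)" by (rule Bochner_Integration.integral_nonneg) auto
    ultimately show "norm (LINT x|lborel. T' (m n x) * (k n x - w x) * \<phi> x) \<le> norm (LINT x|lborel. \<bar>mollify (r n) w x - w x\<bar>) * N"
      by (simp add: k_def mult.commute)
  qed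
  have "(LINT x|lborel. T (u x) * d\<phi> x) + (LINT x|lborel. T' (u x) * w x * \<phi> x) + 0 = 0"
    using tendsto_add[OF tendsto_add[OF l1 l2] l3] unfolding split by (simp add: LIMSEQ_const_iff)
  then show ?thesis by (simp add: d\<phi>_def w_def)
qed

text \<open>
  A test function only sees a compact neighbourhood of its support, on which the functions may be
  replaced by a pair as in \<^const>\<open>mollified_grad\<close>.
\<close>

lemma is_weak_grad_chain:
  fixes u :: "'a::euclidean_space \<Rightarrow> real"
  assumes A: "open A" and w: "is_weak_grad A u v"
    and T: "\<And>s. (T has_real_derivative T' s) (at s)" "continuous_on UNIV T'" "\<And>s. \<bar>T' s\<bar> \<le> 1" "\<And>s. \<bar>T s\<bar> \<le> B"
  shows "is_weak_grad A (\<lambda>x. T (u x)) (\<lambda>x. T' (u x) *\<^sub>R v x)"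
proof -
  have Tc: "continuous_on UNIV T" by (rule DERIV_continuous_on) (use T(1) in \<open>auto intro: DERIV_subset\<close>)
  have [measurable]: "T \<in> borel_measurable borel" "T' \<in> borel_measurable borel"
    using Tc T(2) by (auto intro: borel_measurable_continuous_onI)
  have loc: "set_integrable lebesgue C (\<lambda>x. T (u x)) \<and> set_integrable lebesgue C (\<lambda>x. T' (u x) *\<^sub>R v x)"
    if C: "compact C" "C \<subseteq> A" for C
  proof -
    have ui: "integrable lebesgue (\<lambda>x. indicator C x * u x)" and vi: "integrable lebesgue (\<lambda>x. indicator C x *\<^sub>R v x)"
      using w C by (auto simp: is_weak_grad_def L1_loc_def set_integrable_def)
    have [measurable]: "(\<lambda>x. indicator C x * u x) \<in> borel_measurable lebesgue" "(\<lambda>x. indicator C x *\<^sub>R v x) \<in> borel_measurable lebesgue"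
      using ui vi by auto
    have Cm: "C \<in> lmeasurable" using C(1) by (rule lmeasurable_compact)
    then have Cs[measurable]: "C \<in> sets lebesgue" by (rule fmeasurableD)
    have 1: "integrable lebesgue (\<lambda>x. indicator C x * T (indicator C x * u x))"
    proof (rule Bochner_Integration.integrable_bound[of _ "\<lambda>x. B * indicator C x"])
      show "integrable lebesgue (\<lambda>x. B * indicator C x)" using Cm by (simp add: fmeasurable_def)
      show "AE x in lebesgue. norm (indicator C x * T (indicator C x * u x)) \<le> norm (B * indicator C x)"
        using T(4) order_trans[OF T(4) abs_ge_self] by (auto simp: indicator_def)
    qed simp
    have 2: "integrable lebesgue (\<lambda>x. T' (indicator C x * u x) *\<^sub>R (indicator C x *\<^sub>R v x))"
    proof (rule Bochner_Integration.integrable_bound[OF vi])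
      show "AE x in lebesgue. norm (T' (indicator C x * u x) *\<^sub>R (indicator C x *\<^sub>R v x)) \<le> norm (indicator C x *\<^sub>R v x)"
      proof (rule AE_I2)
        fix x
        show "norm (T' (indicator C x * u x) *\<^sub>R (indicator C x *\<^sub>R v x)) \<le> norm (indicator C x *\<^sub>R v x)"
          unfolding norm_scaleR[of "T' (indicator C x * u x)"] using T(3) by (intro mult_left_le_one_le) auto
      qed
    qed measurable
    have e1: "(\<lambda>x. indicator C x * T (indicator C x * u x)) = (\<lambda>x. indicator C x *\<^sub>R T (u x))"
      and e2: "(\<lambda>x. T' (indicator C x * u x) *\<^sub>R (indicator C x *\<^sub>R v x)) = (\<lambda>x. indicator C x *\<^sub>R (T' (u x) *\<^sub>R v x))"
      by (auto simp: indicator_def fun_eq_iff)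
    show ?thesis using 1 2 unfolding e1 e2 set_integrable_def by blast
  qed
  have "(LINT x:A|lebesgue. T (u x) * (classical_grad \<phi> x \<bullet> b)) = - (LINT x:A|lebesgue. ((T' (u x) *\<^sub>R v x) \<bullet> b) * \<phi> x)"
    if \<phi>: "\<phi> \<in> test_functions A" and b: "b \<in> Basis" for \<phi> b
  proof -
    define Z where "Z = closure {x. \<phi> x \<noteq> 0}"
    have Z: "compact Z" "Z \<subseteq> A" "C_k 1 \<phi>" using \<phi> by (auto simp: test_functions_def Z_def)
    have Z0: "x \<notin> Z \<Longrightarrow> \<phi> x = 0" for x using closure_subset[of "{x. \<phi> x \<noteq> 0}"] by (auto simp: Z_def)
    have d0: "x \<notin> Z \<Longrightarrow> frechet_derivative \<phi> (at x) b = 0" for x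
      using frechet_derivative_eq_0_outside_support[of x \<phi>] by (simp add: Z_def)
    obtain \<epsilon> where \<epsilon>: "0 < \<epsilon>" "(\<Union>x\<in>Z. cball x \<epsilon>) \<subseteq> A"
      using compact_subset_open_imp_cball_epsilon_subset[OF Z(1) A Z(2)] by blast
    define S where "S = {x + y |x y. x \<in> Z \<and> y \<in> cball 0 \<epsilon>}"
    have cb: "cball x \<epsilon> \<subseteq> S" if "x \<in> Z" for x
    proof
      fix y assume "y \<in> cball x \<epsilon>"
      then show "y \<in> S" using that unfolding S_def
        by (intro CollectI exI[of _ x] exI[of _ "y - x"]) (auto simp: dist_norm norm_minus_commute)
    qed
    have "compact S" unfolding S_def by (intro compact_sums Z compact_cball)
    moreover have "S \<subseteq> A"
    proof
      fix z assume "z \<in> S"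
      then obtain x y where "z = x + y" "x \<in> Z" "norm y \<le> \<epsilon>" by (auto simp: S_def)
      then have "z \<in> cball x \<epsilon>" by (simp add: dist_norm)
      then show "z \<in> A" using \<epsilon>(2) \<open>x \<in> Z\<close> by blast
    qed
    ultimately have S: "compact S" "S \<subseteq> A" by auto
    obtain u' v' where g: "mollified_grad S u' v'" "AE x in lborel. u' x = indicator S x * u x \<and> v' x = indicator S x *\<^sub>R v x"
      using mollified_grad_of_weak_grad[OF w S] by blast
    have ZS: "x \<in> Z \<Longrightarrow> x \<in> S" for x using cb[of x] \<epsilon>(1) by auto
    have [measurable]: "u' \<in> borel_measurable borel" "v' \<in> borel_measurable borel"
      using g(1) by (auto simp: mollified_grad_def)
    have "continuous_on UNIV \<phi>" "continuous_on UNIV (\<lambda>x. frechet_derivative \<phi> (at x) b)"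
      using C_k_pred[of 0 \<phi>] Z(3) b by simp_all
    then have [measurable]: "\<phi> \<in> borel_measurable borel" "(\<lambda>x. frechet_derivative \<phi> (at x) b) \<in> borel_measurable borel"
      by (auto intro: borel_measurable_continuous_onI)
    have "(LINT x:A|lebesgue. T (u x) * (classical_grad \<phi> x \<bullet> b)) = (LINT x|lborel. T (u' x) * frechet_derivative \<phi> (at x) b)"
      unfolding set_lebesgue_integral_def
    proof (rule integral_lebesgue_eq_lborel)
      show "AE x in lborel. indicator A x *\<^sub>R (T (u x) * (classical_grad \<phi> x \<bullet> b)) = T (u' x) * frechet_derivative \<phi> (at x) b"
        using g(2)
      proof eventually_elim
        case (elim x)
        show ?case
        proof (cases "x \<in> Z")
          case True
          then have "x \<in> S" "x \<in> A" using ZS Z(2) by auto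
          then show ?thesis using elim by (simp add: classical_grad_inner[OF b])
        qed (simp add: classical_grad_inner[OF b] d0)
      qed
    qed simp
    also have "\<dots> = - (LINT x|lborel. T' (u' x) * (v' x \<bullet> b) * \<phi> x)"
      by (rule integral_chain_by_parts[OF g(1) T \<phi> \<epsilon>(1) _ b]) (use cb Z0 in blast)
    also have "(LINT x|lborel. T' (u' x) * (v' x \<bullet> b) * \<phi> x) = (LINT x:A|lebesgue. ((T' (u x) *\<^sub>R v x) \<bullet> b) * \<phi> x)"
      unfolding set_lebesgue_integral_def
    proof (rule integral_lebesgue_eq_lborel[symmetric])
      show "AE x in lborel. indicator A x *\<^sub>R (((T' (u x) *\<^sub>R v x) \<bullet> b) * \<phi> x) = T' (u' x) * (v' x \<bullet> b) * \<phi> x"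
        using g(2)
      proof eventually_elim
        case (elim x)
        show ?case
        proof (cases "x \<in> Z")
          case True
          then have "x \<in> S" "x \<in> A" using ZS Z(2) by auto
          then show ?thesis using elim by simp
        qed (simp add: Z0)
      qed
    qed simp
    finally show ?thesis .
  qed
  then show ?thesis using loc by (auto simp: is_weak_grad_def L1_loc_def)
qed

section \<open>Compactness almost everywhere\<close>

lemma abs_mollify_le:
  assumes r: "0 < r"
  obtains M where "M > 0" "\<And>(u::'a::euclidean_space \<Rightarrow> real) x. integrable lborel u \<Longrightarrow> \<bar>mollify r u x\<bar> \<le> M * (LINT z|lborel. \<bar>u z\<bar>)"
proof -
  obtain B where B: "B \<ge> 0" "\<And>z::'a. mollifier r z \<le> B" using mollifier_bounded[OF r] by blast
  have "\<bar>mollify r u x\<bar> \<le> (B + 1) * (LINT z|lborel. \<bar>u z\<bar>)" if u: "integrable lborel u" for u :: "'a \<Rightarrow> real" and x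
  proof -
    have "\<bar>mollify r u x\<bar> \<le> (LINT z|lborel. (B + 1) * \<bar>u z\<bar>)"
      unfolding mollify_def
    proof (rule integral_abs_bound[THEN order_trans], rule integral_mono)
      fix z
      have "\<bar>mollifier r (z - x)\<bar> \<le> B + 1" using B(2)[of "z - x"] mollifier_nonneg[of r "z - x"] by linarith
      from mult_left_mono[OF this, of "\<bar>u z\<bar>"]
      show "\<bar>u z * mollifier r (z - x)\<bar> \<le> (B + 1) * \<bar>u z\<bar>" by (simp add: abs_mult mult.commute)
    qed (use u integrable_mult_mollifier[OF r u, of x] in auto)
    then show ?thesis by simp
  qed
  then show ?thesis using that[of "B + 1"] B(1) by simp
qed

lemma LINT_abs_le_of_nn_integral:
  fixes f :: "'a \<Rightarrow> real"
  assumes f: "integrable M f" and le: "(\<integral>\<^sup>+x. ennreal \<bar>f x\<bar> \<partial>M) \<le> ennreal c" and c: "0 \<le> c"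
  shows "(LINT x|M. \<bar>f x\<bar>) \<le> c"
proof -
  have "ennreal (LINT x|M. \<bar>f x\<bar>) \<le> ennreal c"
    using nn_integral_eq_integral[OF integrable_abs[OF f]] le by simp
  then show ?thesis using c by (simp add: ennreal_le_iff)
qed

lemma LINT_abs_triangle:
  fixes u v w :: "'a \<Rightarrow> real"
  assumes "integrable M u" "integrable M v" "integrable M w"
  shows "(LINT x|M. \<bar>u x - w x\<bar>) \<le> (LINT x|M. \<bar>u x - v x\<bar>) + (LINT x|M. \<bar>v x - w x\<bar>)"
proof -
  have i: "integrable M (\<lambda>x. \<bar>u x - w x\<bar>)" "integrable M (\<lambda>x. \<bar>u x - v x\<bar>)" "integrable M (\<lambda>x. \<bar>v x - w x\<bar>)"
    by (intro integrable_abs Bochner_Integration.integrable_diff assms)+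
  have "(LINT x|M. \<bar>u x - w x\<bar>) \<le> (LINT x|M. \<bar>u x - v x\<bar> + \<bar>v x - w x\<bar>)"
    by (intro integral_mono i Bochner_Integration.integrable_add) simp
  then show ?thesis by (simp only: Bochner_Integration.integral_add[OF i(2,3)])
qed

text \<open>
  For each radius the mollifications of an \<open>L\<^sup>1\<close>-bounded sequence are bounded and equicontinuous,
  so it is enough to make them converge, for all radii, on a countable dense set.
\<close>

lemma mollify_subseq_converges:
  fixes u :: "nat \<Rightarrow> 'a::euclidean_space \<Rightarrow> real"
  assumes ui: "\<And>j. integrable lborel (u j)" and uB: "\<And>j. (LINT x|lborel. \<bar>u j x\<bar>) \<le> B"
    and B: "0 \<le> B" and r: "\<And>n::nat. 0 < r n"
  obtains k where "strict_mono (k :: nat \<Rightarrow> nat)" "\<And>x n. convergent (\<lambda>j. mollify (r n) (u (k j)) x)"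
proof -
  have "\<forall>n. \<exists>M>0. \<forall>(u::'a \<Rightarrow> real) x. integrable lborel u \<longrightarrow> \<bar>mollify (r n) u x\<bar> \<le> M * (LINT z|lborel. \<bar>u z\<bar>)"
    using abs_mollify_le[OF r] by metis
  then obtain M where M: "\<And>n. 0 < M n" "\<And>n (u::'a \<Rightarrow> real) x. integrable lborel u \<Longrightarrow> \<bar>mollify (r n) u x\<bar> \<le> M n * (LINT z|lborel. \<bar>u z\<bar>)"
    by metis
  have "\<forall>n. \<exists>L\<ge>0. \<forall>(u::'a \<Rightarrow> real) x y. integrable lborel u \<longrightarrow> \<bar>mollify (r n) u x - mollify (r n) u y\<bar> \<le> L * (LINT z|lborel. \<bar>u z\<bar>) * norm (x - y)"
    using mollify_Lipschitz_uniform[OF r] by metis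
  then obtain L where L: "\<And>n. 0 \<le> L n" "\<And>n (u::'a \<Rightarrow> real) x y. integrable lborel u \<Longrightarrow>
     \<bar>mollify (r n) u x - mollify (r n) u y\<bar> \<le> L n * (LINT z|lborel. \<bar>u z\<bar>) * norm (x - y)"
    by metis
  have mB: "\<bar>mollify (r n) (u j) x\<bar> \<le> M n * B" for n j x
    using M(2)[OF ui] mult_left_mono[OF uB less_imp_le[OF M(1)]] by (rule order_trans)
  have mL: "\<bar>mollify (r n) (u j) x - mollify (r n) (u j) y\<bar> \<le> L n * B * norm (x - y)" for n j x y
    by (rule order_trans[OF L(2)[OF ui]]) (intro mult_right_mono mult_left_mono uB L norm_ge_zero)
  obtain D :: "'a set" where D: "countable D" "\<And>X. open X \<Longrightarrow> X \<noteq> {} \<Longrightarrow> \<exists>d\<in>D. d \<in> X"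
    using countable_dense_setE by metis
  have "countable (D \<times> (UNIV :: nat set))" using D(1) by simp
  \<comment> \<open>The normalisation bounds all the values by 1, independently of the radius; \<open>B + 1\<close> excludes a zero denominator.\<close>
  moreover have "norm (mollify (r (snd z)) (u j) (fst z) / (M (snd z) * (B + 1))) \<le> 1" for j z
  proof -
    have "M (snd z) * B \<le> M (snd z) * (B + 1)" using M(1)[of "snd z"] by simp
    then have "\<bar>mollify (r (snd z)) (u j) (fst z)\<bar> \<le> M (snd z) * (B + 1)" using mB order_trans by blast
    moreover have "0 < M (snd z) * (B + 1)" using M(1) B by (intro mult_pos_pos) auto
    ultimately show ?thesis by (simp only: real_norm_def abs_divide abs_of_pos divide_le_eq_1) simp
  qed
  ultimately obtain k where k: "strict_mono (k :: nat \<Rightarrow> nat)"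
    "\<And>z. z \<in> D \<times> (UNIV :: nat set) \<Longrightarrow> \<exists>l. (\<lambda>j. mollify (r (snd z)) (u (k j)) (fst z) / (M (snd z) * (B + 1))) \<longlonglongrightarrow> l"
    using function_convergent_subsequence[of "D \<times> (UNIV :: nat set)" "\<lambda>j z. mollify (r (snd z)) (u j) (fst z) / (M (snd z) * (B + 1))" 1]
    by metis
  have cD: "convergent (\<lambda>j. mollify (r n) (u (k j)) x)" if xD: "x \<in> D" for x n
  proof -
    obtain l where "(\<lambda>j. mollify (r n) (u (k j)) x / (M n * (B + 1))) \<longlonglongrightarrow> l"
      using k(2)[of "(x, n)"] xD by auto
    from tendsto_mult_right[OF this, of "M n * (B + 1)"]
    have "(\<lambda>j. mollify (r n) (u (k j)) x) \<longlonglongrightarrow> l * (M n * (B + 1))" using M(1)[of n] B by simp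
    then show ?thesis by (rule convergentI)
  qed
  have cv: "convergent (\<lambda>j. mollify (r n) (u (k j)) x)" for x n
  proof -
    have "Cauchy (\<lambda>j. mollify (r n) (u (k j)) x)"
    proof (rule metric_CauchyI)
      fix e :: real assume e: "0 < e"
      define \<delta> where "\<delta> = e / (3 * (L n * B + 1))"
      have LB: "0 \<le> L n * B" using L B by simp
      then have \<delta>: "0 < \<delta>" using e by (simp add: \<delta>_def)
      have \<delta>': "L n * B * \<delta> < e / 3"
      proof -
        have "L n * B * \<delta> < (L n * B + 1) * \<delta>" using \<delta> by simp
        also have "\<dots> = e / 3"
        proof -
          have "c * (e / (3 * c)) = e / 3" if "c \<noteq> 0" for c :: real using that by simp
          moreover have "L n * B + 1 \<noteq> 0" using LB by linarith
          ultimately show ?thesis unfolding \<delta>_def by blast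
        qed
        finally show ?thesis .
      qed
      obtain d where d: "d \<in> D" "d \<in> ball x \<delta>" using D(2)[of "ball x \<delta>"] \<delta> open_ball centre_in_ball by blast
      have near: "\<bar>mollify (r n) (u j) x - mollify (r n) (u j) d\<bar> < e / 3" for j
      proof -
        have "L n * B * norm (x - d) \<le> L n * B * \<delta>" using d(2) LB by (intro mult_left_mono) (auto simp: dist_norm)
        then show ?thesis using mL[of n j x d] \<delta>' by linarith
      qed
      obtain N where N: "\<And>i j. i \<ge> N \<Longrightarrow> j \<ge> N \<Longrightarrow> dist (mollify (r n) (u (k i)) d) (mollify (r n) (u (k j)) d) < e / 3"
        using convergent_Cauchy[OF cD[OF d(1), of n]] e unfolding Cauchy_def by (metis divide_pos_pos zero_less_numeral)
      show "\<exists>N. \<forall>i\<ge>N. \<forall>j\<ge>N. dist (mollify (r n) (u (k i)) x) (mollify (r n) (u (k j)) x) < e"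
      proof (intro exI[of _ N] allI impI)
        fix i j assume "N \<le> i" "N \<le> j"
        then show "dist (mollify (r n) (u (k i)) x) (mollify (r n) (u (k j)) x) < e"
          using near[of "k i"] near[of "k j"] N[of i j] unfolding dist_real_def by linarith
      qed
    qed
    then show ?thesis by (rule Cauchy_convergent)
  qed
  from that[OF k(1) cv] show thesis .
qed

text \<open>
  On \<open>C\<close> the functions differ from their mollifications of radius \<open>\<rho> / n\<close> by at most a multiple of
  that radius in \<open>L\<^sup>1\<close>, uniformly along the sequence (\<open>mollify_error_L1\<close>). A subsequence whose
  mollifications converge is therefore Cauchy in \<open>L\<^sup>1(C)\<close>.
\<close>

lemma rellich_local_mollified:
  fixes u :: "nat \<Rightarrow> 'a::euclidean_space \<Rightarrow> real"
  assumes C: "compact C" "0 < \<rho>" "\<And>x. x \<in> C \<Longrightarrow> cball x (2 * \<rho>) \<subseteq> S"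
    and g: "\<And>j. mollified_grad S (u j) (v j)"
    and B: "0 \<le> B" "\<And>j. (\<integral>\<^sup>+x. ennreal \<bar>u j x\<bar> \<partial>lborel) \<le> ennreal B"
      "\<And>j. (\<integral>\<^sup>+x. ennreal (norm (v j x)) \<partial>lborel) \<le> ennreal B"
  obtains k where "strict_mono (k :: nat \<Rightarrow> nat)" "AE x in lborel. x \<in> C \<longrightarrow> convergent (\<lambda>j. u (k j) x)"
proof -
  have ui: "integrable lborel (u j)" for j using g[of j] by (simp add: mollified_grad_def)
  have [measurable]: "u j \<in> borel_measurable borel" for j using ui by auto
  have uB: "(LINT x|lborel. \<bar>u j x\<bar>) \<le> B" for j by (rule LINT_abs_le_of_nn_integral[OF ui B(2,1)])
  define r where "r n = \<rho> / real (Suc n)" for n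
  have r: "0 < r n" "r n \<le> \<rho>" for n
    using C(2) mult_left_mono[of 1 "real (Suc n)" \<rho>] by (auto simp: r_def divide_le_eq)
  have "\<forall>n. \<exists>M>0. \<forall>(u::'a \<Rightarrow> real) x. integrable lborel u \<longrightarrow> \<bar>mollify (r n) u x\<bar> \<le> M * (LINT z|lborel. \<bar>u z\<bar>)"
    using abs_mollify_le[OF r(1)] by metis
  then obtain M where M: "\<And>n. 0 < M n" "\<And>n (u::'a \<Rightarrow> real) x. integrable lborel u \<Longrightarrow> \<bar>mollify (r n) u x\<bar> \<le> M n * (LINT z|lborel. \<bar>u z\<bar>)"
    by metis
  have mB: "\<bar>mollify (r n) (u j) x\<bar> \<le> M n * B" for n j x
    using M(2)[OF ui] mult_left_mono[OF uB less_imp_le[OF M(1)]] by (rule order_trans)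
  obtain k where k: "strict_mono (k :: nat \<Rightarrow> nat)" and cv: "\<And>x n. convergent (\<lambda>j. mollify (r n) (u (k j)) x)"
    by (rule mollify_subseq_converges[where u = u and r = r, OF ui uB B(1) r(1)]) (rule that)
  define l where "l n x = lim (\<lambda>j. mollify (r n) (u (k j)) x)" for n x
  have ll: "(\<lambda>j. mollify (r n) (u (k j)) x) \<longlonglongrightarrow> l n x" for n x
    using cv unfolding l_def by (simp add: convergent_LIMSEQ_iff)
  have [measurable]: "C \<in> sets borel" using C(1) by (rule borel_compact)
  have [measurable]: "l n \<in> borel_measurable borel" for n
    by (rule borel_measurable_LIMSEQ_real[OF ll]) simp
  define w where "w j x = indicator C x * u (k j) x" for j x
  define m where "m n j x = indicator C x * mollify (r n) (u (k j)) x" for n j x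
  have [measurable]: "w j \<in> borel_measurable borel" "m n j \<in> borel_measurable borel" for n j
    unfolding w_def m_def by measurable
  have Ci: "integrable lborel (indicator C :: 'a \<Rightarrow> real)"
    using emeasure_bounded_finite[OF compact_imp_bounded[OF C(1)]] by (intro integrable_real_indicator) auto
  have wi: "integrable lborel (w j)" for j
    unfolding w_def[abs_def] using integrable_mult_indicator[of C lborel "u (k j)"] ui by simp
  have mi: "integrable lborel (m n j)" for n j
    unfolding m_def[abs_def] using integrable_mult_indicator[of C lborel "mollify (r n) (u (k j))"] integrable_mollify[OF r(1) ui] by simp
  have mlim: "integrable lborel (\<lambda>x. indicator C x * l n x) \<and> (\<lambda>j. LINT x|lborel. \<bar>m n j x - indicator C x * l n x\<bar>) \<longlonglongrightarrow> 0" for n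
  proof -
    have dom: "integrable lborel (\<lambda>x. M n * B * indicator C x)" using Ci by simp
    have "AE x in lborel. (\<lambda>j. m n j x) \<longlonglongrightarrow> indicator C x * l n x"
      unfolding m_def using ll by (intro AE_I2 tendsto_mult tendsto_const)
    moreover have mb: "AE x in lborel. norm (m n j x) \<le> M n * B * indicator C x" for j
      using mB by (auto simp: m_def indicator_def)
    ultimately have li: "integrable lborel (\<lambda>x. indicator C x * l n x)"
      by (intro integrable_dominated_convergence[where s = "m n" and w = "\<lambda>x. M n * B * indicator C x", OF _ _ dom]) simp_all
    have lb: "\<bar>l n x\<bar> \<le> M n * B" for x
      using tendsto_rabs[OF ll] by (rule LIMSEQ_le_const2) (use mB in auto)
    have "(\<lambda>j. LINT x|lborel. \<bar>m n j x - indicator C x * l n x\<bar>) \<longlonglongrightarrow> (LINT x|(lborel::'a measure). 0)"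
    proof (rule integral_dominated_convergence[where w = "\<lambda>x. 2 * (M n * B * indicator C x)"])
      show "AE x in lborel. (\<lambda>j. \<bar>m n j x - indicator C x * l n x\<bar>) \<longlonglongrightarrow> 0"
      proof (rule AE_I2)
        fix x
        have "(\<lambda>j. \<bar>m n j x - indicator C x * l n x\<bar>) \<longlonglongrightarrow> \<bar>indicator C x * l n x - indicator C x * l n x\<bar>"
          unfolding m_def by (intro tendsto_rabs tendsto_diff tendsto_mult tendsto_const ll)
        then show "(\<lambda>j. \<bar>m n j x - indicator C x * l n x\<bar>) \<longlonglongrightarrow> 0" by simp
      qed
      show "AE x in lborel. norm \<bar>m n j x - indicator C x * l n x\<bar> \<le> 2 * (M n * B * indicator C x)" for j
      proof (rule AE_I2)
        fix x
        show "norm \<bar>m n j x - indicator C x * l n x\<bar> \<le> 2 * (M n * B * indicator C x)"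
          using mB[of n "k j" x] lb[of x] by (cases "x \<in> C") (auto simp: m_def)
      qed
    qed (use dom in \<open>auto simp: m_def\<close>)
    then show ?thesis using li by simp
  qed
  \<comment> \<open>This bound is uniform in \<open>j\<close>; it reduces the Cauchy property to a single radius.\<close>
  have err: "(LINT x|lborel. \<bar>m n j x - w j x\<bar>) \<le> r n * B" for n j
  proof (rule LINT_abs_le_of_nn_integral)
    have "(\<integral>\<^sup>+x. ennreal \<bar>m n j x - w j x\<bar> \<partial>lborel) = (\<integral>\<^sup>+x. ennreal \<bar>mollify (r n) (u (k j)) x - u (k j) x\<bar> * indicator C x \<partial>lborel)"
      by (rule nn_integral_cong) (auto simp: m_def w_def indicator_def)
    also have "\<dots> \<le> ennreal (r n) * (\<integral>\<^sup>+x. ennreal (norm (v (k j) x)) \<partial>lborel)"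
      by (rule mollify_error_L1[OF g _ C(3) r]) auto
    also have "\<dots> \<le> ennreal (r n) * ennreal B" by (intro mult_left_mono B) auto
    also have "\<dots> = ennreal (r n * B)" using r(1)[of n] B(1) by (simp add: ennreal_mult)
    finally show "(\<integral>\<^sup>+x. ennreal \<bar>m n j x - w j x\<bar> \<partial>lborel) \<le> ennreal (r n * B)" .
  qed (use mi wi r(1)[of n] B in auto)
  have cau: "\<exists>N. \<forall>i\<ge>N. \<forall>j\<ge>N. (LINT x|lborel. norm (w i x - w j x)) < e" if e: "0 < e" for e
  proof -
    obtain n where n: "r n * B < e / 4"
    proof -
      obtain n where "4 * \<rho> * B / e < real n" using reals_Archimedean2 by blast
      then have "4 * \<rho> * B / e < real (Suc n)" by simp
      then show thesis using e C(2) by (intro that[of n]) (simp add: r_def field_simps)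
    qed
    define h where "h x = indicator C x * l n x" for x
    have hi: "integrable lborel h" and hl: "(\<lambda>j. LINT x|lborel. \<bar>m n j x - h x\<bar>) \<longlonglongrightarrow> 0"
      using mlim[of n] by (auto simp: h_def[abs_def])
    from order_tendstoD(2)[OF hl, of "e / 4"] e obtain N where N: "\<And>j. j \<ge> N \<Longrightarrow> (LINT x|lborel. \<bar>m n j x - h x\<bar>) < e / 4"
      by (auto simp: eventually_sequentially)
    have half: "(LINT x|lborel. \<bar>w j x - h x\<bar>) < e / 2" if "j \<ge> N" for j
      using LINT_abs_triangle[OF wi[of j] mi[of n j] hi] err[of n j] n N[OF that] by (simp add: abs_minus_commute)
    have "(LINT x|lborel. norm (w i x - w j x)) < e" if "i \<ge> N" "j \<ge> N" for i j
      using LINT_abs_triangle[OF wi[of i] hi wi[of j]] half[OF that(1)] half[OF that(2)]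
      by (simp add: abs_minus_commute[of "h _"])
    then show ?thesis by blast
  qed
  obtain s where s: "strict_mono s" "AE x in lborel. Cauchy (\<lambda>i. w (s i) x)"
    by (rule cauchy_L1_AE_cauchy_subseq[OF wi cau])
  show thesis
  proof (rule that[of "k \<circ> s"])
    show "AE x in lborel. x \<in> C \<longrightarrow> convergent (\<lambda>j. u ((k \<circ> s) j) x)"
      using s(2) by eventually_elim (auto simp: w_def dest: Cauchy_convergent)
  qed (use k s(1) in \<open>simp add: strict_mono_o\<close>)
qed

text \<open>
  The sets on which the weak gradients are taken may vary with \<open>j\<close>, and they need to contain \<open>S\<close>
  only for large \<open>j\<close>. This suits the complements of moving compact sets.
\<close>

lemma rellich_compact:
  fixes u :: "nat \<Rightarrow> 'a::euclidean_space \<Rightarrow> real"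
  assumes C: "compact C" "0 < \<rho>" "\<And>x. x \<in> C \<Longrightarrow> cball x (2 * \<rho>) \<subseteq> S" and S: "compact S"
    and B: "0 \<le> B" and ev: "\<forall>\<^sub>F j in sequentially. (\<exists>A. S \<subseteq> A \<and> is_weak_grad A (u j) (v j)) \<and>
       (\<integral>\<^sup>+x. ennreal \<bar>u j x\<bar> * indicator S x \<partial>lebesgue) \<le> ennreal B \<and>
       (\<integral>\<^sup>+x. ennreal (norm (v j x)) * indicator S x \<partial>lebesgue) \<le> ennreal B"
  obtains k where "strict_mono (k :: nat \<Rightarrow> nat)" "AE x in lebesgue. x \<in> C \<longrightarrow> convergent (\<lambda>j. u (k j) x)"
proof -
  obtain N where N: "\<And>j. j \<ge> N \<Longrightarrow> (\<exists>A. S \<subseteq> A \<and> is_weak_grad A (u j) (v j)) \<and>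
       (\<integral>\<^sup>+x. ennreal \<bar>u j x\<bar> * indicator S x \<partial>lebesgue) \<le> ennreal B \<and>
       (\<integral>\<^sup>+x. ennreal (norm (v j x)) * indicator S x \<partial>lebesgue) \<le> ennreal B"
    using ev unfolding eventually_sequentially by metis
  have "\<exists>u' v'. mollified_grad S u' v' \<and>
     (AE x in lborel. u' x = indicator S x * u (j + N) x \<and> v' x = indicator S x *\<^sub>R v (j + N) x)" for j
    using N[of "j + N"] mollified_grad_of_weak_grad[OF _ S] by (meson le_add2)
  then have "\<forall>j. \<exists>q. mollified_grad S (fst q) (snd q) \<and>
     (AE x in lborel. fst q x = indicator S x * u (j + N) x \<and> snd q x = indicator S x *\<^sub>R v (j + N) x)"
    by (simp only: split_paired_Ex fst_conv snd_conv) blast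
  from choice[OF this] obtain q where q: "\<And>j. mollified_grad S (fst (q j)) (snd (q j))"
     "\<And>j. AE x in lborel. fst (q j) x = indicator S x * u (j + N) x \<and> snd (q j) x = indicator S x *\<^sub>R v (j + N) x"
    by blast
  define u' v' where "u' j = fst (q j)" and "v' j = snd (q j)" for j
  note uv = q[folded u'_def v'_def]
  have 1: "(\<integral>\<^sup>+x. ennreal \<bar>u' j x\<bar> \<partial>lborel) \<le> ennreal B" for j
  proof -
    have "(\<integral>\<^sup>+x. ennreal \<bar>u' j x\<bar> \<partial>lborel) = (\<integral>\<^sup>+x. ennreal \<bar>u (j + N) x\<bar> * indicator S x \<partial>lborel)"
      by (rule nn_integral_cong_AE, use uv(2)[of j] in eventually_elim) (auto simp: indicator_def)
    then show ?thesis using N[of "j + N"] by (simp add: nn_integral_completion)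
  qed
  have 2: "(\<integral>\<^sup>+x. ennreal (norm (v' j x)) \<partial>lborel) \<le> ennreal B" for j
  proof -
    have "(\<integral>\<^sup>+x. ennreal (norm (v' j x)) \<partial>lborel) = (\<integral>\<^sup>+x. ennreal (norm (v (j + N) x)) * indicator S x \<partial>lborel)"
      by (rule nn_integral_cong_AE, use uv(2)[of j] in eventually_elim) (auto simp: indicator_def)
    then show ?thesis using N[of "j + N"] by (simp add: nn_integral_completion)
  qed
  obtain k where k: "strict_mono (k :: nat \<Rightarrow> nat)" "AE x in lborel. x \<in> C \<longrightarrow> convergent (\<lambda>j. u' (k j) x)"
    by (rule rellich_local_mollified[OF C uv(1) B 1 2])
  have "AE x in lborel. \<forall>j. u' j x = indicator S x * u (j + N) x"
    unfolding AE_all_countable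
  proof
    fix j show "AE x in lborel. u' j x = indicator S x * u (j + N) x" using uv(2)[of j] by eventually_elim simp
  qed
  with k(2) have "AE x in lborel. x \<in> C \<longrightarrow> convergent (\<lambda>j. u (k j + N) x)"
  proof eventually_elim
    case (elim x)
    have "x \<in> S" if "x \<in> C" using C(3)[OF that] C(2) by auto
    then show ?case using elim by simp
  qed
  then show thesis using k(1) by (intro that[of "\<lambda>j. k j + N"] AE_completion) (auto simp: strict_mono_def)
qed

text \<open>
  A diagonal sequence over the compact exhaustion of \<open>U\<close>.
\<close>

lemma rellich_AE:
  fixes u :: "nat \<Rightarrow> 'a::euclidean_space \<Rightarrow> real"
  assumes U: "open U" and B: "0 \<le> B"
    and ev: "\<And>S. compact S \<Longrightarrow> S \<subseteq> U \<Longrightarrow> \<forall>\<^sub>F j in sequentially. (\<exists>A. S \<subseteq> A \<and> is_weak_grad A (u j) (v j)) \<and>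
       (\<integral>\<^sup>+x. ennreal \<bar>u j x\<bar> * indicator S x \<partial>lebesgue) \<le> ennreal B \<and>
       (\<integral>\<^sup>+x. ennreal (norm (v j x)) * indicator S x \<partial>lebesgue) \<le> ennreal B"
  obtains k where "strict_mono (k :: nat \<Rightarrow> nat)" "AE x in lebesgue. x \<in> U \<longrightarrow> convergent (\<lambda>j. u (k j) x)"
proof -
  define C where "C n = erode U (3 * (1 / real (Suc n))) (real n)" for n
  define P where "P n s \<longleftrightarrow> (AE x in lebesgue. x \<in> C n \<longrightarrow> convergent (\<lambda>j. u (s j) x))" for n and s :: "nat \<Rightarrow> nat"
  interpret subseqs P
  proof
    fix n and s :: "nat \<Rightarrow> nat" assume s: "strict_mono s"
    define S where "S = erode U (1 / real (Suc n)) (real n + 2)"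
    have S: "compact S" "S \<subseteq> U" unfolding S_def by (rule compact_erode, rule erode_subset) simp
    have cb: "cball x (2 * (1 / real (Suc n))) \<subseteq> S" if "x \<in> C n" for x
      using cball_subset_erode[of x U "1 / real (Suc n)" "real n"] that by (simp add: C_def S_def)
    have cC: "compact (C n)" unfolding C_def by (rule compact_erode)
    have pos: "0 < 1 / real (Suc n)" by simp
    have ev': "\<forall>\<^sub>F j in sequentially. (\<exists>A. S \<subseteq> A \<and> is_weak_grad A (u (s j)) (v (s j))) \<and>
       (\<integral>\<^sup>+x. ennreal \<bar>u (s j) x\<bar> * indicator S x \<partial>lebesgue) \<le> ennreal B \<and>
       (\<integral>\<^sup>+x. ennreal (norm (v (s j) x)) * indicator S x \<partial>lebesgue) \<le> ennreal B"
      by (rule eventually_subseq[OF s ev[OF S]])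
    obtain k where "strict_mono (k :: nat \<Rightarrow> nat)" "AE x in lebesgue. x \<in> C n \<longrightarrow> convergent (\<lambda>j. u (s (k j)) x)"
      by (rule rellich_compact[where u = "\<lambda>j. u (s j)" and v = "\<lambda>j. v (s j)", OF cC pos cb S(1) B ev'])
    then show "\<exists>r'. strict_mono r' \<and> P n (s \<circ> r')" unfolding P_def by auto
  qed
  define d where "d = diagseq"
  have d: "strict_mono d" unfolding d_def by (rule subseq_diagseq)
  have PD: "P n (d \<circ> (+) (Suc n))" for n
    unfolding d_def
  proof (rule diagseq_holds)
    fix r s n assume "strict_mono (r :: nat \<Rightarrow> nat)" "P n s"
    show "P n (s \<circ> r)"
      using \<open>P n s\<close> unfolding P_def
    proof eventually_elim
      case (elim x)
      then show ?case using convergent_subseq_convergent[OF _ \<open>strict_mono r\<close>, of "\<lambda>j. u (s j) x"] by (auto simp: o_def)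
    qed
  qed
  have "AE x in lebesgue. x \<in> C n \<longrightarrow> convergent (\<lambda>j. u (d j) x)" for n
    using PD[of n] unfolding P_def
  proof eventually_elim
    case (elim x)
    have "convergent (\<lambda>j. u (d (j + Suc n)) x) \<longleftrightarrow> convergent (\<lambda>j. u (d j) x)"
      by (rule convergent_ignore_initial_segment[of "\<lambda>j. u (d j) x" "Suc n"])
    then show ?case using elim by (simp add: add.commute)
  qed
  then show thesis unfolding C_def by (intro that[of d] d AE_exhaust[OF U])
qed

section \<open>Measurability and locality of the energies\<close>

lemma erode_mono: "\<rho>' \<le> \<rho> \<Longrightarrow> R \<le> R' \<Longrightarrow> erode U \<rho> R \<subseteq> erode U \<rho>' R'"
  using subset_ball[of \<rho>' \<rho>] by (fastforce simp: erode_def)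

text \<open>
  Local integrability gives measurability on compact sets, and these exhaust \<open>A\<close>.
\<close>

lemma L1_loc_measurable:
  fixes u :: "'a::euclidean_space \<Rightarrow> 'b::euclidean_space"
  assumes A: "open A" and u: "u \<in> L1_loc A"
  shows "(\<lambda>x. indicator A x *\<^sub>R u x) \<in> borel_measurable lebesgue"
proof -
  define E where "E n = erode A (1 / real (Suc n)) (real n)" for n
  have E: "compact (E n)" "E n \<subseteq> A" for n unfolding E_def by (rule compact_erode, rule erode_subset) simp
  show ?thesis
  proof (rule borel_measurable_LIMSEQ_metric)
    show "(\<lambda>x. indicator (E n) x *\<^sub>R u x) \<in> borel_measurable lebesgue" for n
      using u E[of n] by (auto simp: L1_loc_def set_integrable_def)
    show "(\<lambda>n. indicator (E n) x *\<^sub>R u x) \<longlonglongrightarrow> indicator A x *\<^sub>R u x" for x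
    proof (cases "x \<in> A")
      case True
      then obtain n where n: "x \<in> erode A (3 * (1 / real (Suc n))) (real n)" using erode_exhausts[OF A] by blast
      have "x \<in> E m" if "m \<ge> n" for m
      proof -
        have "1 / real (Suc m) \<le> 1 / real (Suc n)" using that by (intro divide_left_mono) auto
        then have "1 / real (Suc m) \<le> 3 * (1 / real (Suc n))" by (smt (verit) divide_nonneg_nonneg of_nat_0_le_iff)
        then show ?thesis using erode_mono[of "1 / real (Suc m)" "3 * (1 / real (Suc n))" "real n" "real m" A] n that
          by (auto simp: E_def)
      qed
      then have "\<forall>\<^sub>F m in sequentially. indicator (E m) x *\<^sub>R u x = indicator A x *\<^sub>R u x"
        using True unfolding eventually_sequentially by (intro exI[of _ n]) simp
      then show ?thesis by (rule tendsto_eventually)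
    next
      case False
      then have "\<And>n. x \<notin> E n" using E(2) by blast
      then show ?thesis using False by simp
    qed
  qed
qed

lemma measurable_lebesgue_on_iff:
  fixes u :: "'a::euclidean_space \<Rightarrow> 'b::euclidean_space"
  assumes "A \<in> sets lebesgue"
  shows "u \<in> borel_measurable (lebesgue_on A) \<longleftrightarrow> (\<lambda>x. indicator A x *\<^sub>R u x) \<in> borel_measurable lebesgue"
  using assms by (intro borel_measurable_restrict_space_iff) simp

lemma weak_grad_works: "is_weak_grad A u v \<Longrightarrow> is_weak_grad A u (weak_grad A u)"
  unfolding weak_grad_def using someI[of "is_weak_grad A u"] by blast

text \<open>
  \<^const>\<open>weak_grad\<close> chooses some weak gradient, which uniqueness identifies almost everywhere.
\<close>

lemma weak_grad_AE:
  assumes "open A" "is_weak_grad A u v"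
  shows "AE x in lebesgue. x \<in> A \<longrightarrow> weak_grad A u x = v x"
  using is_weak_grad_unique[OF assms(1) weak_grad_works[OF assms(2)] assms(2)] .

lemma is_weak_grad_cong:
  assumes "\<And>x. x \<in> A \<Longrightarrow> u x = w x"
  shows "is_weak_grad A u = is_weak_grad A w"
proof -
  have 1: "u \<in> L1_loc A \<longleftrightarrow> w \<in> L1_loc A"
  proof -
    have "(\<lambda>x. indicator C x *\<^sub>R u x) = (\<lambda>x. indicator C x *\<^sub>R w x)" if "C \<subseteq> A" for C
      using that assms by (auto simp: indicator_def fun_eq_iff)
    then show ?thesis by (simp add: L1_loc_def set_integrable_def cong: conj_cong imp_cong)
  qed
  have 2: "(\<lambda>x. indicator A x *\<^sub>R (u x * z x)) = (\<lambda>x. indicator A x *\<^sub>R (w x * z x))" for z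
    using assms by (auto simp: indicator_def fun_eq_iff)
  show ?thesis
    by (simp add: fun_eq_iff is_weak_grad_def 1 set_lebesgue_integral_def 2[simplified real_scaleR_def] )
qed

lemma weak_grad_cong:
  assumes "\<And>x. x \<in> A \<Longrightarrow> u x = w x"
  shows "weak_grad A u = weak_grad A w"
  by (simp only: weak_grad_def is_weak_grad_cong[OF assms])

lemma deny_lions_cong:
  assumes "\<And>x. x \<in> A \<Longrightarrow> u x = w x"
  shows "u \<in> deny_lions p A \<longleftrightarrow> w \<in> deny_lions p A"
  by (simp add: deny_lions_def is_weak_grad_cong[OF assms])

lemma F_crack_cong:
  assumes "\<And>x. x \<in> A \<Longrightarrow> u x = w x"
  shows "F_crack p f K u A = F_crack p f K w A"
proof -
  have eq: "\<And>x. x \<in> A - K \<Longrightarrow> u x = w x" using assms by auto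
  have 1: "u \<in> deny_lions p (A - K) \<longleftrightarrow> w \<in> deny_lions p (A - K)" by (rule deny_lions_cong) (rule eq)
  have 2: "weak_grad (A - K) u = weak_grad (A - K) w" by (rule weak_grad_cong) (rule eq)
  show ?thesis unfolding F_crack_def 1 2 ..
qed

lemma Lim_cong: "(\<forall>\<^sub>F x in F. f x = g x) \<Longrightarrow> Lim F f = Lim F g"
  unfolding Topological_Spaces.Lim_def by (simp cong: tendsto_cong)

text \<open>
  The one-sided limits only depend on arbitrarily small half-balls, which lie in \<open>A\<close>.
\<close>

lemma jump_cong:
  assumes A: "open A" "x \<in> A" and eq: "\<And>x. x \<in> A \<Longrightarrow> u x = w x"
  shows "jump M u x = jump M w x"
proof -
  obtain e where e: "e > 0" "ball x e \<subseteq> A" using A open_contains_ball by blast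
  have "Lim (at_right 0) (\<lambda>\<rho>. mean_value (half_ball \<nu> x \<rho>) u) = Lim (at_right 0) (\<lambda>\<rho>. mean_value (half_ball \<nu> x \<rho>) w)" for \<nu>
  proof (rule Lim_cong)
    have "\<forall>\<^sub>F \<rho> in at_right (0::real). \<rho> < e"
      using e(1) by (simp add: eventually_at_right_less eventually_at_right[of 0 e]) (auto intro: exI[of _ e])
    then show "\<forall>\<^sub>F \<rho> in at_right 0. mean_value (half_ball \<nu> x \<rho>) u = mean_value (half_ball \<nu> x \<rho>) w"
    proof eventually_elim
      case (elim \<rho>)
      then have "half_ball \<nu> x \<rho> \<subseteq> A" using e(2) by (auto simp: half_ball_def)
      then have "(\<lambda>y. indicator (half_ball \<nu> x \<rho>) y *\<^sub>R u y) = (\<lambda>y. indicator (half_ball \<nu> x \<rho>) y *\<^sub>R w y)"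
        using eq by (auto simp: indicator_def fun_eq_iff)
      then show ?case by (simp add: mean_value_def set_lebesgue_integral_def)
    qed
  qed
  then show ?thesis by (simp add: jump_def)
qed

lemma F_meas_cong:
  assumes A: "open A" and eq: "\<And>x. x \<in> A \<Longrightarrow> u x = w x"
  shows "F_meas p f M \<mu> u A = F_meas p f M \<mu> w A"
proof -
  have eq': "\<And>x. x \<in> A - M \<Longrightarrow> u x = w x" using eq by auto
  have "(\<integral>\<^sup>+x\<in>A \<inter> M. ennreal (jump M u x powr p) \<partial>\<mu>) = (\<integral>\<^sup>+x\<in>A \<inter> M. ennreal (jump M w x powr p) \<partial>\<mu>)"
    by (rule nn_integral_cong) (auto simp: indicator_def jump_cong[OF A _ eq])
  moreover have "u \<in> deny_lions p (A - M) \<longleftrightarrow> w \<in> deny_lions p (A - M)" by (rule deny_lions_cong) (rule eq')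
  moreover have "weak_grad (A - M) u = weak_grad (A - M) w" by (rule weak_grad_cong) (rule eq')
  ultimately show ?thesis unfolding F_meas_def by (simp only:)
qed

section \<open>Truncation\<close>

text \<open>
  The chain rule multiplies the gradient by \<open>T'\<close>, and homogeneity turns this into the factor
  \<open>T' powr p \<le> 1\<close>. Positivity of \<open>T'\<close> matters because homogeneity speaks about positive factors.
\<close>

lemma F_crack_chain_le:
  fixes u :: "'a::euclidean_space \<Rightarrow> real"
  assumes U: "open (A - K)" and u: "u \<in> deny_lions p (A - K)" and p: "0 < p"
    and f: "\<And>\<xi>. 0 \<le> f \<xi>" "\<And>t \<xi>. 0 < t \<Longrightarrow> f (t *\<^sub>R \<xi>) = t powr p * f \<xi>"
    and T: "\<And>s. (T has_real_derivative T' s) (at s)" "continuous_on UNIV T'" "\<And>s. 0 < T' s" "\<And>s. T' s \<le> 1" "\<And>s. \<bar>T s\<bar> \<le> B"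
  shows "(\<lambda>x. T (u x)) \<in> deny_lions p (A - K)"
    and "F_crack p f K (\<lambda>x. T (u x)) A \<le> F_crack p f K u A"
proof -
  have [measurable]: "A - K \<in> sets lebesgue" using U by simp
  obtain v where v: "is_weak_grad (A - K) u v" "v \<in> Lp p (A - K)" using u by (auto simp: deny_lions_def)
  have T1: "\<bar>T' s\<bar> \<le> 1" for s using T(3,4)[of s] by simp
  have [measurable]: "T' \<in> borel_measurable borel" using T(2) by (rule borel_measurable_continuous_onI)
  have chain: "is_weak_grad (A - K) (\<lambda>x. T (u x)) (\<lambda>x. T' (u x) *\<^sub>R v x)" if "is_weak_grad (A - K) u v" for v
    by (rule is_weak_grad_chain[OF U that T(1,2) T1 T(5)])
  have [measurable]: "u \<in> borel_measurable (lebesgue_on (A - K))" "v \<in> borel_measurable (lebesgue_on (A - K))"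
    using L1_loc_measurable[OF U, of u] v by (auto simp: is_weak_grad_def Lp_def measurable_lebesgue_on_iff)
  have "(\<lambda>x. T' (u x) *\<^sub>R v x) \<in> Lp p (A - K)"
    unfolding Lp_def
  proof (intro CollectI conjI)
    show "integrable (lebesgue_on (A - K)) (\<lambda>x. norm (T' (u x) *\<^sub>R v x) powr p)"
    proof (rule Bochner_Integration.integrable_bound)
      show "integrable (lebesgue_on (A - K)) (\<lambda>x. norm (v x) powr p)" using v(2) by (simp add: Lp_def)
      show "AE x in lebesgue_on (A - K). norm (norm (T' (u x) *\<^sub>R v x) powr p) \<le> norm (norm (v x) powr p)"
        using T1 p by (intro AE_I2) (auto intro!: powr_mono2 mult_left_le_one_le)
    qed measurable
  qed measurable
  then show "(\<lambda>x. T (u x)) \<in> deny_lions p (A - K)" using chain[OF v(1)] by (auto simp: deny_lions_def)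
  moreover have "AE x in lebesgue. x \<in> A - K \<longrightarrow> weak_grad (A - K) (\<lambda>x. T (u x)) x = T' (u x) *\<^sub>R weak_grad (A - K) u x"
    by (rule weak_grad_AE[OF U chain[OF weak_grad_works[OF v(1)]]])
  then have "(\<integral>\<^sup>+x\<in>A - K. ennreal (f (weak_grad (A - K) (\<lambda>x. T (u x)) x)) \<partial>lebesgue)
     \<le> (\<integral>\<^sup>+x\<in>A - K. ennreal (f (weak_grad (A - K) u x)) \<partial>lebesgue)"
  proof (intro nn_integral_mono_AE, eventually_elim)
    case (elim x)
    have "T' (u x) powr p * f (weak_grad (A - K) u x) \<le> 1 * f (weak_grad (A - K) u x)"
      using T(3,4)[of "u x"] p f(1) by (intro mult_right_mono powr_le1) auto
    then show ?case using elim by (auto simp: indicator_def f(2)[OF T(3)] intro!: ennreal_leI)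
  qed
  ultimately show "F_crack p f K (\<lambda>x. T (u x)) A \<le> F_crack p f K u A" using u by (simp add: F_crack_def)
qed

text \<open>
  A smooth truncation: a strictly increasing contraction with values in \<open>[- k * pi / 2, k * pi / 2]\<close>
  which tends to the identity as \<open>k\<close> grows.
\<close>

definition soft_cut :: "real \<Rightarrow> real \<Rightarrow> real" where
  "soft_cut k s = k * arctan (s / k)"

lemma DERIV_soft_cut: "0 < k \<Longrightarrow> (soft_cut k has_real_derivative 1 / (1 + (s / k)\<^sup>2)) (at s)"
  unfolding soft_cut_def[abs_def]
  by (auto intro!: derivative_eq_intros simp: divide_inverse)

lemma soft_cut_deriv_bounds: "0 < 1 / (1 + (s / k)\<^sup>2)" "1 / (1 + (s / k)\<^sup>2) \<le> (1::real)"
proof -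
  have "0 \<le> (s / k)\<^sup>2" by simp
  then show "0 < 1 / (1 + (s / k)\<^sup>2)" "1 / (1 + (s / k)\<^sup>2) \<le> 1"
    by (simp_all only: zero_less_divide_1_iff divide_le_eq_1) linarith+
qed

lemma soft_cut_bounded: "0 < k \<Longrightarrow> \<bar>soft_cut k s\<bar> \<le> k * (pi / 2)"
  using arctan_bounded[of "s / k"] by (auto simp: soft_cut_def abs_mult intro!: mult_left_mono)

lemma soft_cut_le: 
  assumes k: "0 < k" shows "\<bar>soft_cut k s\<bar> \<le> \<bar>s\<bar>"
proof -
  have "\<bar>soft_cut k s - soft_cut k 0\<bar> \<le> 1 * \<bar>s - 0\<bar>"
    unfolding real_norm_def[symmetric]
  proof (rule field_differentiable_bound[of UNIV "soft_cut k" "\<lambda>s. 1 / (1 + (s / k)\<^sup>2)"])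
    show "norm (1 / (1 + (z / k)\<^sup>2)) \<le> 1" for z
      using soft_cut_deriv_bounds[of z k] by (simp only: real_norm_def abs_of_pos)
  qed (use DERIV_soft_cut[OF k] in auto)
  then show ?thesis by (simp add: soft_cut_def)
qed

lemma soft_cut_tendsto: "(\<lambda>n. soft_cut (real (Suc n)) s) \<longlonglongrightarrow> s"
proof (cases "s = 0")
  case False
  have "(\<lambda>h. (arctan (0 + h) - arctan 0) / h) \<midarrow>0\<rightarrow> inverse (1 + 0\<^sup>2)"
    using DERIV_arctan[of 0] unfolding DERIV_def .
  then have "(\<lambda>h. arctan h / h) \<midarrow>0\<rightarrow> 1" by simp
  note seq = this[folded LIMSEQ_SEQ_conv, rule_format]
  have "(\<lambda>n. arctan (s / real (Suc n)) / (s / real (Suc n))) \<longlonglongrightarrow> 1"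
  proof (rule seq, intro conjI allI)
    show "(\<lambda>n. s / real (Suc n)) \<longlonglongrightarrow> 0"
      using tendsto_mult[OF tendsto_const[of s] LIMSEQ_Suc[OF lim_1_over_n]] by simp
  qed (use False in auto)
  moreover have "soft_cut (real (Suc n)) s = s * (arctan (s / real (Suc n)) / (s / real (Suc n)))" for n
    using False by (simp add: soft_cut_def del: of_nat_Suc)
  ultimately show ?thesis using tendsto_mult[OF tendsto_const[of s]] by (simp only: mult_1_right) force
qed (simp add: soft_cut_def)

lemma isCont_soft_cut: "0 < k \<Longrightarrow> isCont (soft_cut k) s"
  using DERIV_soft_cut DERIV_isCont by blast

section \<open>Null sets, integrands and convergence in measure\<close>

text \<open>
  A chart maps \<open>M\<close> locally into a hyperplane, and its differentiable inverse preserves null sets.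
\<close>

lemma negligible_C1_hypersurface:
  fixes M :: "'a::euclidean_space set"
  assumes "C1_hypersurface_with_boundary M"
  shows "negligible M"
proof (rule locally_negligible_alt[THEN iffD2], rule ballI)
  fix x assume "x \<in> M"
  from bspec[OF assms[unfolded C1_hypersurface_with_boundary_def] this] obtain U \<Phi> \<Phi>' e where x: "x \<in> U" "hypersurface_chart M U \<Phi> \<Phi>' e"
    by (elim exE conjE) (rule that)
  from x(2) obtain V \<Psi> \<Psi>' e' where U: "open U" "homeomorphism U V \<Phi> \<Psi>" "C1_with_derivative V \<Psi> \<Psi>'" "e \<in> Basis"
    "\<Phi> ` (M \<inter> U) = V \<inter> {y. y \<bullet> e = 0 \<and> y \<bullet> e' \<ge> 0}"
    unfolding hypersurface_chart_def by (elim exE conjE) (rule that)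
  have "M \<inter> U \<subseteq> \<Psi> ` (V \<inter> {y. y \<bullet> e = 0})"
  proof
    fix y assume y: "y \<in> M \<inter> U"
    then have "\<Phi> y \<in> V \<inter> {y. y \<bullet> e = 0}" using U(5) by blast
    moreover have "\<Psi> (\<Phi> y) = y" using U(2) y by (simp add: homeomorphism_def)
    ultimately show "y \<in> \<Psi> ` (V \<inter> {y. y \<bullet> e = 0})" by (metis image_eqI)
  qed
  moreover have "negligible (\<Psi> ` (V \<inter> {y. y \<bullet> e = 0}))"
  proof (rule negligible_differentiable_image_negligible[OF order_refl])
    show "negligible (V \<inter> {y. y \<bullet> e = 0})"
      by (rule negligible_subset[OF negligible_standard_hyperplane[OF U(4), of 0]]) auto
    show "\<Psi> differentiable_on V \<inter> {y. y \<bullet> e = 0}"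
      unfolding differentiable_on_def
    proof
      fix y assume "y \<in> V \<inter> {y. y \<bullet> e = 0}"
      then have "(\<Psi> has_derivative blinfun_apply (\<Psi>' y)) (at y)"
        using U(3) by (simp add: C1_with_derivative_def)
      then show "\<Psi> differentiable at y within V \<inter> {y. y \<bullet> e = 0}"
        by (rule differentiable_at_withinI[OF differentiableI])
    qed
  qed
  ultimately have "negligible (M \<inter> U)" using negligible_subset by blast
  then show "\<exists>V. openin (top_of_set M) V \<and> x \<in> V \<and> negligible V"
    using \<open>x \<in> M\<close> x(1) U(1) by (intro exI[of _ "M \<inter> U"]) (auto simp: openin_open)
qed

text \<open>
  Composing with a simple function gives a finite sum of measurable pieces; continuity in the
  second variable handles the limit outside a null set.
\<close>

lemma caratheodory_measurable:
  fixes u :: "'a::euclidean_space \<Rightarrow> real" and g :: "'a \<Rightarrow> real \<Rightarrow> real"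
  assumes A: "A \<in> sets lebesgue"
    and g: "\<And>s. (\<lambda>x. indicator A x * g x s) \<in> borel_measurable lebesgue"
    and gc: "AE x in lebesgue. x \<in> A \<longrightarrow> continuous_on UNIV (g x)"
    and u: "(\<lambda>x. indicator A x * u x) \<in> borel_measurable lebesgue"
  shows "(\<lambda>x. indicator A x * g x (u x)) \<in> borel_measurable lebesgue"
proof -
  obtain s where s: "\<And>i. simple_function lebesgue (s i)" "\<And>x. (\<lambda>i. s i x) \<longlonglongrightarrow> indicator A x * u x"
    using borel_measurable_implies_sequence_metric[OF u, of 0] by auto
  have sm: "(\<lambda>x. indicator A x * g x (s i x)) \<in> borel_measurable lebesgue" for i
  proof -
    have fin: "finite (range (s i))" and sets: "\<And>y. s i -` {y} \<in> sets lebesgue"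
      using simple_functionD[OF s(1)[of i]] by auto
    have "(\<lambda>x. indicator A x * g x (s i x)) = (\<lambda>x. \<Sum>y\<in>range (s i). indicator (s i -` {y}) x * (indicator A x * g x y))"
    proof
      fix x
      have "(\<Sum>y\<in>range (s i). indicator (s i -` {y}) x * (indicator A x * g x y))
          = (\<Sum>y\<in>range (s i). if y = s i x then indicator A x * g x y else 0)"
        by (intro sum.cong) (auto simp: indicator_def)
      then show "indicator A x * g x (s i x) = (\<Sum>y\<in>range (s i). indicator (s i -` {y}) x * (indicator A x * g x y))"
        using fin by simp
    qed
    also have "\<dots> \<in> borel_measurable lebesgue"
      by (intro borel_measurable_sum borel_measurable_times borel_measurable_indicator sets g)
    finally show ?thesis .
  qed
  obtain N where N: "N \<in> null_sets lebesgue" "{x. \<not> (x \<in> A \<longrightarrow> continuous_on UNIV (g x))} \<subseteq> N"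
    using gc unfolding eventually_ae_filter by auto
  have "(\<lambda>x. indicator (- N) x * (indicator A x * g x (u x))) \<in> borel_measurable lebesgue"
  proof (rule borel_measurable_LIMSEQ_real)
    show "(\<lambda>x. indicator (- N) x * (indicator A x * g x (s i x))) \<in> borel_measurable lebesgue" for i
      using N(1) by (intro borel_measurable_times borel_measurable_indicator sm) (auto simp: Compl_in_sets_lebesgue)
    show "(\<lambda>i. indicator (- N) x * (indicator A x * g x (s i x))) \<longlonglongrightarrow> indicator (- N) x * (indicator A x * g x (u x))" for x
    proof (cases "x \<in> A \<and> x \<notin> N")
      case True
      then have "isCont (g x) (u x)" using N(2) by (auto simp: continuous_on_eq_continuous_at)
      moreover have "(\<lambda>i. s i x) \<longlonglongrightarrow> u x" using s(2)[of x] True by simp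
      ultimately have "(\<lambda>i. g x (s i x)) \<longlonglongrightarrow> g x (u x)" by (rule isCont_tendsto_compose)
      then show ?thesis by (intro tendsto_mult tendsto_const)
    qed (auto simp: indicator_def)
  qed
  then show ?thesis
  proof (rule borel_measurable_AE)
    show "AE x in lebesgue. indicator (- N) x * (indicator A x * g x (u x)) = indicator A x * g x (u x)"
      using AE_not_in[OF N(1)] by eventually_elim simp
  qed
qed

lemma AE_imp_converges_in_measure:
  fixes u :: "nat \<Rightarrow> 'a::euclidean_space \<Rightarrow> real"
  assumes \<Omega>: "\<Omega> \<in> lmeasurable" and u: "\<And>j. u j \<in> L0 \<Omega>" "v \<in> L0 \<Omega>"
    and lim: "AE x in lebesgue. x \<in> \<Omega> \<longrightarrow> (\<lambda>j. u j x) \<longlonglongrightarrow> v x"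
  shows "converges_in_measure \<Omega> u v"
  unfolding converges_in_measure_def
proof (intro allI impI)
  fix e :: real assume e: "0 < e"
  have \<Omega>s[measurable]: "\<Omega> \<in> sets lebesgue" using \<Omega> by (rule fmeasurableD)
  have [measurable]: "(\<lambda>x. indicator \<Omega> x * u j x) \<in> borel_measurable lebesgue" "(\<lambda>x. indicator \<Omega> x * v x) \<in> borel_measurable lebesgue" for j
    using u by (auto simp: L0_def measurable_lebesgue_on_iff)
  define E where "E j = {x \<in> \<Omega>. \<bar>u j x - v x\<bar> > e}" for j
  have Eeq: "E j = {x \<in> space lebesgue. \<bar>indicator \<Omega> x * u j x - indicator \<Omega> x * v x\<bar> > e}" for j
    using e by (auto simp: E_def indicator_def split: if_splits)
  have Em[measurable]: "E j \<in> sets lebesgue" for j unfolding Eeq by measurable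
  have "(\<lambda>j. \<integral>\<^sup>+x. indicator (E j) x \<partial>lebesgue) \<longlonglongrightarrow> (\<integral>\<^sup>+x. 0 \<partial>(lebesgue :: 'a measure))"
  proof (rule nn_integral_dominated_convergence)
    show "(\<integral>\<^sup>+x. indicator \<Omega> x \<partial>lebesgue) < \<infinity>" using \<Omega> by (simp add: fmeasurable_def)
    show "AE x in lebesgue. indicator (E j) x \<le> (indicator \<Omega> x :: ennreal)" for j
      by (auto simp: E_def indicator_def)
    show "AE x in lebesgue. (\<lambda>j. indicator (E j) x :: ennreal) \<longlonglongrightarrow> 0"
      using lim
    proof eventually_elim
      case (elim x)
      have "\<forall>\<^sub>F j in sequentially. x \<notin> E j"
      proof (cases "x \<in> \<Omega>")
        case True
        then have "(\<lambda>j. u j x) \<longlonglongrightarrow> v x" using elim by simp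
        from tendstoD[OF this e] show ?thesis
          by (rule eventually_mono) (auto simp: E_def dist_real_def)
      qed (simp add: E_def)
      then have "\<forall>\<^sub>F j in sequentially. (indicator (E j) x :: ennreal) = 0"
        by (rule eventually_mono) simp
      then show ?case by (rule tendsto_eventually)
    qed
  qed auto
  then show "(\<lambda>j. emeasure lebesgue {x \<in> \<Omega>. e < \<bar>u j x - v x\<bar>}) \<longlonglongrightarrow> 0"
    by (simp add: E_def[symmetric])
qed

text \<open>
  On a set of finite measure, convergence in measure means that the distances truncated at 1
  tend to zero in \<open>L\<^sup>1\<close>.
\<close>

lemma converges_in_measure_AE_subseq:
  fixes u :: "nat \<Rightarrow> 'a::euclidean_space \<Rightarrow> real"
  assumes \<Omega>: "\<Omega> \<in> lmeasurable" and u: "\<And>j. u j \<in> L0 \<Omega>" "v \<in> L0 \<Omega>"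
    and conv: "converges_in_measure \<Omega> u v"
  obtains r where "strict_mono (r :: nat \<Rightarrow> nat)" "AE x in lebesgue. x \<in> \<Omega> \<longrightarrow> (\<lambda>j. u (r j) x) \<longlonglongrightarrow> v x"
proof -
  have \<Omega>s[measurable]: "\<Omega> \<in> sets lebesgue" using \<Omega> by (rule fmeasurableD)
  have m[measurable]: "(\<lambda>x. indicator \<Omega> x * u j x) \<in> borel_measurable lebesgue" "(\<lambda>x. indicator \<Omega> x * v x) \<in> borel_measurable lebesgue" for j
    using u by (auto simp: L0_def measurable_lebesgue_on_iff)
  define w where "w j x = min \<bar>indicator \<Omega> x * u j x - indicator \<Omega> x * v x\<bar> 1" for j x
  have wm[measurable]: "w j \<in> borel_measurable lebesgue" for j unfolding w_def[abs_def] by measurable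
  have w01: "0 \<le> w j x" "w j x \<le> indicator \<Omega> x" for j x by (auto simp: w_def indicator_def)
  have ind: "integrable lebesgue (indicator \<Omega> :: 'a \<Rightarrow> real)" using \<Omega> by (simp add: fmeasurable_def)
  have wi: "integrable lebesgue (w j)" for j
    by (rule Bochner_Integration.integrable_bound[OF ind wm]) (use w01 in auto)
  have "(\<lambda>j. LINT x|lebesgue. norm (w j x)) \<longlonglongrightarrow> 0"
  proof (rule LIMSEQ_I)
    fix e :: real assume e: "0 < e"
    define m where "m = measure lebesgue \<Omega>"
    have m0: "m \<ge> 0" by (simp add: m_def)
    define d where "d = e / (2 * (m + 1))"
    have d: "0 < d" using e m0 by (simp add: d_def)
    have dm: "d * m < e / 2"
    proof -
      have "d * m < d * (m + 1)" using d by simp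
      also have "d * (m + 1) = e / 2"
      proof -
        have "c * (e / (2 * c)) = e / 2" if "c \<noteq> 0" for c :: real using that by simp
        moreover have "m + 1 \<noteq> 0" using m0 by linarith
        ultimately show ?thesis unfolding d_def by (metis mult.commute)
      qed
      finally show ?thesis .
    qed
    define E where "E j = {x \<in> \<Omega>. \<bar>u j x - v x\<bar> > d}" for j
    have Eeq: "E j = {x \<in> space lebesgue. \<bar>indicator \<Omega> x * u j x - indicator \<Omega> x * v x\<bar> > d}" for j
      using d by (auto simp: E_def indicator_def split: if_splits)
    have Em[measurable]: "E j \<in> sets lebesgue" for j unfolding Eeq by measurable
    have Ef: "E j \<in> lmeasurable" for j
      by (rule fmeasurableI2[OF \<Omega> _ Em]) (auto simp: E_def)
    have "(\<lambda>j. emeasure lebesgue (E j)) \<longlonglongrightarrow> 0" using conv d by (simp add: converges_in_measure_def E_def)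
    from order_tendstoD(2)[OF this, of "ennreal (e / 2)"] e obtain N
      where N: "\<And>j. j \<ge> N \<Longrightarrow> emeasure lebesgue (E j) < ennreal (e / 2)" by (auto simp: eventually_sequentially)
    have "(LINT x|lebesgue. norm (w j x)) < e" if "j \<ge> N" for j
    proof -
      have "(LINT x|lebesgue. norm (w j x)) \<le> (LINT x|lebesgue. d * indicator \<Omega> x + indicator (E j) x)"
      proof (rule integral_mono)
        show "integrable lebesgue (\<lambda>x. d * indicator \<Omega> x + indicator (E j) x :: real)"
          using ind Ef[of j] by (intro Bochner_Integration.integrable_add integrable_mult_right) (auto simp: fmeasurable_def)
        show "norm (w j x) \<le> d * indicator \<Omega> x + indicator (E j) x" for x
          using d w01[of j x] by (auto simp: w_def E_def indicator_def)
      qed (use wi in simp)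
      also have "\<dots> = d * m + measure lebesgue (E j)"
        using ind Ef[of j] by (subst Bochner_Integration.integral_add) (auto simp: m_def fmeasurable_def)
      also have "measure lebesgue (E j) < e / 2"
        using N[OF that] Ef[of j] e by (simp add: emeasure_eq_measure2 ennreal_less_iff)
      finally show ?thesis using dm by linarith
    qed
    moreover have "0 \<le> (LINT x|lebesgue. norm (w j x))" for j by (rule Bochner_Integration.integral_nonneg) simp
    ultimately show "\<exists>N. \<forall>j\<ge>N. norm ((LINT x|lebesgue. norm (w j x)) - 0) < e" by (intro exI[of _ N]) simp
  qed
  from tendsto_L1_AE_subseq[OF wi this] obtain r where r: "strict_mono r" "AE x in lebesgue. (\<lambda>n. w (r n) x) \<longlonglongrightarrow> 0" by blast
  show thesis
  proof (rule that[OF r(1)])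
    show "AE x in lebesgue. x \<in> \<Omega> \<longrightarrow> (\<lambda>j. u (r j) x) \<longlonglongrightarrow> v x"
      using r(2)
    proof (eventually_elim, intro impI)
      fix x assume w0: "(\<lambda>n. w (r n) x) \<longlonglongrightarrow> 0" and x: "x \<in> \<Omega>"
      have "\<forall>\<^sub>F n in sequentially. w (r n) x < 1" using order_tendstoD(2)[OF w0, of 1] by simp
      then have "\<forall>\<^sub>F n in sequentially. w (r n) x = \<bar>u (r n) x - v x\<bar>"
        by (rule eventually_mono) (use x in \<open>auto simp: w_def\<close>)
      from Lim_transform_eventually[OF w0 this] have "(\<lambda>n. \<bar>u (r n) x - v x\<bar>) \<longlonglongrightarrow> 0" .
      then show "(\<lambda>j. u (r j) x) \<longlonglongrightarrow> v x" by (simp add: tendsto_rabs_zero_iff LIM_zero_iff)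
    qed
  qed
qed

section \<open>Limits of the minimum problems\<close>

lemma liminf_add_ennreal:
  fixes a b :: "nat \<Rightarrow> ennreal"
  shows "liminf a + liminf b \<le> liminf (\<lambda>n. a n + b n)"
proof -
  have inc: "incseq (\<lambda>n. INF m\<in>{n..}. a m)" for a :: "nat \<Rightarrow> ennreal"
    by (auto simp: incseq_def intro!: INF_superset_mono)
  have "liminf a + liminf b = (SUP n. (INF m\<in>{n..}. a m) + (INF m\<in>{n..}. b m))"
    unfolding liminf_SUP_INF by (rule ennreal_SUP_add[OF inc inc, symmetric])
  also have "\<dots> \<le> (SUP n. INF m\<in>{n..}. a m + b m)"
    by (intro SUP_mono' INF_greatest add_mono INF_lower)
  also have "\<dots> = liminf (\<lambda>n. a n + b n)" unfolding liminf_SUP_INF ..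
  finally show ?thesis .
qed

text \<open>
  In the limit the first summand uses up at least \<open>\<alpha>\<close> of the total \<open>\<alpha> + \<beta>\<close>, which leaves at most \<open>\<beta>\<close>
  for the second one, as \<open>\<alpha>\<close> is finite.
\<close>

lemma limsup_le_of_sum_converges:
  fixes a b :: "nat \<Rightarrow> ennreal"
  assumes lim: "(\<lambda>n. a n + b n) \<longlonglongrightarrow> \<alpha> + \<beta>" and a: "\<alpha> \<le> liminf a" and fin: "\<alpha> < \<infinity>"
  shows "limsup b \<le> \<beta>"
proof -
  obtain s where s: "strict_mono s" "(b \<circ> s) \<longlonglongrightarrow> limsup b" using limsup_subseq_lim by blast
  have "\<alpha> + limsup b \<le> liminf (a \<circ> s) + liminf (b \<circ> s)"
  proof (rule add_mono)
    show "\<alpha> \<le> liminf (a \<circ> s)" using a liminf_subseq_mono[OF s(1), of a] by (rule order_trans)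
    show "limsup b \<le> liminf (b \<circ> s)" using lim_imp_Liminf[OF _ s(2)] by simp
  qed
  also have "\<dots> \<le> liminf (\<lambda>n. (a \<circ> s) n + (b \<circ> s) n)" by (rule liminf_add_ennreal)
  also have "\<dots> = \<alpha> + \<beta>"
    using LIMSEQ_subseq_LIMSEQ[OF lim s(1)] by (intro lim_imp_Liminf) (simp_all add: o_def)
  finally show ?thesis using fin by (auto simp: ennreal_add_left_cancel_le)
qed

lemma limsup_add_le_of_converges:
  fixes a b :: "nat \<Rightarrow> ennreal"
  assumes a: "limsup a \<le> \<alpha>" and b: "b \<longlonglongrightarrow> \<beta>" and fin: "\<beta> < \<infinity>"
  shows "limsup (\<lambda>n. a n + b n) \<le> \<alpha> + \<beta>"
proof (rule ennreal_le_epsilon)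
  fix e :: real assume e: "0 < e"
  have "\<beta> < \<beta> + ennreal e" using fin e ennreal_add_left_cancel_less[of \<beta> 0 "ennreal e"] by (simp add: less_top)
  from order_tendstoD(2)[OF b this] have "\<forall>\<^sub>F n in sequentially. a n + b n \<le> (\<beta> + ennreal e) + a n"
    by (rule eventually_mono) (simp add: add.commute add_left_mono less_imp_le)
  then have "limsup (\<lambda>n. a n + b n) \<le> limsup (\<lambda>n. (\<beta> + ennreal e) + a n)" by (rule Limsup_mono)
  also have "\<dots> = (\<beta> + ennreal e) + limsup a"
    by (rule Limsup_const_add) (use fin in \<open>auto simp: less_top\<close>)
  also have "\<dots> \<le> (\<beta> + ennreal e) + \<alpha>" using a by (rule add_left_mono)
  finally show "limsup (\<lambda>n. a n + b n) \<le> \<alpha> + \<beta> + ennreal e" by (simp add: ac_simps)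
qed

lemma powr_diff_le:
  fixes a b q :: real
  assumes q: "1 \<le> q"
  shows "\<bar>a - b\<bar> powr q \<le> 2 powr q * (\<bar>a\<bar> powr q + \<bar>b\<bar> powr q)"
proof -
  have "\<bar>a - b\<bar> powr q \<le> (2 * max \<bar>a\<bar> \<bar>b\<bar>) powr q" using q by (intro powr_mono2) auto
  also have "\<dots> = 2 powr q * max \<bar>a\<bar> \<bar>b\<bar> powr q" by (rule powr_mult)
  also have "max \<bar>a\<bar> \<bar>b\<bar> powr q \<le> \<bar>a\<bar> powr q + \<bar>b\<bar> powr q" by (simp add: max_def)
  finally show ?thesis by simp
qed

lemma le_one_plus_powr:
  fixes s r :: real
  assumes "0 \<le> s" "1 \<le> r"
  shows "s \<le> 1 + s powr r"
proof (cases "s \<le> 1")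
  case False
  then show ?thesis using powr_mono[OF assms(2), of s] by simp
qed (simp add: add_increasing2)

lemma is_arg_min_INF:
  fixes E :: "'b \<Rightarrow> 'c::complete_linorder"
  assumes "is_arg_min E (\<lambda>v. v \<in> S) u"
  shows "E u = (INF v\<in>S. E v)"
  using assms unfolding is_arg_min_def
  by (intro antisym INF_greatest INF_lower) (auto simp: not_less)

text \<open>
  The data of the theorem. The hypersurface enters as a compact null set to which the sets \<open>K j\<close>
  are eventually close.
\<close>

locale crack_setting =
  fixes \<Omega> M A :: "'a::euclidean_space set"
    and p q lam Lam c1 c2 :: real
    and f :: "'a \<Rightarrow> real"
    and g :: "'a \<Rightarrow> real \<Rightarrow> real"
    and a1 a2 :: "'a \<Rightarrow> real"
    and K :: "nat \<Rightarrow> 'a set"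
    and \<mu> :: "'a measure"
  assumes Omega: "open \<Omega>" "bounded \<Omega>"
    and p: "1 < p"
    and f_nonneg: "\<And>\<xi>. 0 \<le> f \<xi>"
    and f_homogeneous: "\<And>t \<xi>. 0 < t \<Longrightarrow> f (t *\<^sub>R \<xi>) = t powr p * f \<xi>"
    and lam: "0 < lam"
    and f_growth: "\<And>\<xi>. lam * norm \<xi> powr p \<le> f \<xi>" "\<And>\<xi>. f \<xi> \<le> Lam * norm \<xi> powr p"
    and M: "compact M" "negligible M"
    and q: "1 \<le> q"
    and g_nonneg: "\<And>x s. x \<in> \<Omega> \<Longrightarrow> 0 \<le> g x s"
    and g_measurable: "\<And>s. (\<lambda>x. g x s) \<in> borel_measurable (lebesgue_on \<Omega>)"
    and g_continuous: "AE x in lebesgue_on \<Omega>. continuous_on UNIV (g x)"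
    and c1: "0 < c1" and c2: "0 < c2"
    and a1_a2: "integrable (lebesgue_on \<Omega>) a1" "integrable (lebesgue_on \<Omega>) a2"
    and g_growth: "AE x in lebesgue_on \<Omega>. \<forall>s. c1 * \<bar>s\<bar> powr q - a1 x \<le> g x s \<and>
                     g x s \<le> c2 * (1 + \<bar>s\<bar> powr q + a2 x)"
    and K_compact: "\<And>j. compact (K j)"
    and K_to_M: "(\<lambda>j. SUP x\<in>K j. INF y\<in>M. ennreal (dist x y)) \<longlonglongrightarrow> 0"
    and A: "open A" "A \<subseteq> \<Omega>"
    and Gamma: "gamma_converges (L0 \<Omega>) (converges_in_measure \<Omega>)
                  (\<lambda>j u. F_crack p f (K j) u A) (\<lambda>u. F_meas p f M \<mu> u A)"
begin

abbreviation "E j u \<equiv> energy_crack p f g (K j) A u"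
abbreviation "E\<^sub>0 u \<equiv> energy_meas p f g M \<mu> A u"
abbreviation "adm j \<equiv> admissible_crack p (K j) A"
abbreviation "m j \<equiv> INF u\<in>adm j. E j u"

lemma Omega_lmeasurable: "\<Omega> \<in> lmeasurable"
  using Omega by (simp add: lmeasurable_open)

lemma A_lmeasurable: "A \<in> lmeasurable"
  using Omega A by (intro lmeasurable_open) (auto intro: bounded_subset)

lemma sets_A[measurable]: "A \<in> sets lebesgue" and sets_Omega[measurable]: "\<Omega> \<in> sets lebesgue"
  using A_lmeasurable Omega_lmeasurable by (auto dest: fmeasurableD)

lemma AE_Omega: "(AE x in lebesgue_on \<Omega>. P x) \<Longrightarrow> AE x in lebesgue. x \<in> A \<longrightarrow> P x"
  using A(2) by (subst (asm) AE_restrict_space_iff) (auto elim: eventually_mono)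

lemma open_A_diff: "open (A - K j)" "open (A - M)"
  using A(1) K_compact[of j] M(1) by (auto intro: open_Diff compact_imp_closed)

lemma integrable_Omega_A: "integrable (lebesgue_on \<Omega>) a \<Longrightarrow> integrable lebesgue (\<lambda>x. indicator A x * a x)"
  for a :: "'a \<Rightarrow> real"
proof -
  assume "integrable (lebesgue_on \<Omega>) a"
  then have "integrable lebesgue (\<lambda>x. indicator \<Omega> x *\<^sub>R a x)"
    by (subst (asm) integrable_restrict_space) auto
  from integrable_mult_indicator[OF sets_A this]
  show ?thesis
    by (rule back_subst[of "integrable lebesgue"]) (use A(2) in \<open>auto simp: indicator_def fun_eq_iff\<close>)
qed

lemma integrable_indicator_A: "integrable lebesgue (indicator A :: 'a \<Rightarrow> real)"
  using A_lmeasurable by (simp add: fmeasurable_def)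

lemma L0_A_iff: "w \<in> L0 A \<longleftrightarrow> (\<lambda>x. indicator A x * w x) \<in> borel_measurable lebesgue"
  by (simp add: L0_def measurable_lebesgue_on_iff)

lemma L0_extend: "w \<in> L0 A \<Longrightarrow> (\<lambda>x. indicator A x * w x) \<in> L0 \<Omega>"
  unfolding L0_A_iff by (simp add: L0_def measurable_restrict_space1)

lemma L0_restrict: "w \<in> L0 \<Omega> \<Longrightarrow> w \<in> L0 A"
proof -
  assume "w \<in> L0 \<Omega>"
  then have "(\<lambda>x. indicator \<Omega> x * w x) \<in> borel_measurable lebesgue"
    by (simp add: L0_def measurable_lebesgue_on_iff)
  from borel_measurable_times[OF borel_measurable_indicator[OF sets_A] this]
  have "(\<lambda>x. indicator A x * (indicator \<Omega> x * w x)) \<in> borel_measurable lebesgue" .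
  moreover have "(\<lambda>x. indicator A x * (indicator \<Omega> x * w x)) = (\<lambda>x. indicator A x * w x)"
    using A(2) by (auto simp: indicator_def fun_eq_iff)
  ultimately show ?thesis by (simp add: L0_A_iff)
qed

lemma g_comp_measurable:
  assumes "w \<in> L0 A"
  shows "(\<lambda>x. indicator A x * g x (w x)) \<in> borel_measurable lebesgue"
proof (rule caratheodory_measurable[where g = g and u = w, OF sets_A])
  show "(\<lambda>x. indicator A x * g x s) \<in> borel_measurable lebesgue" for s
    using L0_restrict[of "\<lambda>x. g x s"] g_measurable by (simp add: L0_def[of \<Omega>] L0_A_iff)
  show "AE x in lebesgue. x \<in> A \<longrightarrow> continuous_on UNIV (g x)" by (rule AE_Omega[OF g_continuous])
qed (use assms in \<open>simp add: L0_A_iff\<close>)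

lemma lower_order_eq: "lower_order g w A = (\<integral>\<^sup>+x. ennreal (indicator A x * g x (w x)) \<partial>lebesgue)"
  unfolding lower_order_def by (rule nn_integral_cong) (auto simp: indicator_def)

lemma g_A_nonneg: "0 \<le> indicator A x * g x s"
  using g_nonneg A(2) by (auto simp: indicator_def)

lemma g_growth_A: "AE x in lebesgue. x \<in> A \<longrightarrow> (\<forall>s. c1 * \<bar>s\<bar> powr q - a1 x \<le> g x s \<and>
                     g x s \<le> c2 * (1 + \<bar>s\<bar> powr q + a2 x))"
  by (rule AE_Omega[OF g_growth])

lemma g_limit: "AE x in lebesgue. x \<in> A \<longrightarrow> (\<lambda>j. w j x) \<longlonglongrightarrow> v x \<Longrightarrow>
  AE x in lebesgue. (\<lambda>j. indicator A x * g x (w j x)) \<longlonglongrightarrow> indicator A x * g x (v x)"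
proof -
  assume lim: "AE x in lebesgue. x \<in> A \<longrightarrow> (\<lambda>j. w j x) \<longlonglongrightarrow> v x"
  show ?thesis
    using lim AE_Omega[OF g_continuous]
  proof eventually_elim
    case (elim x)
    show ?case
    proof (cases "x \<in> A")
      case True
      then have "isCont (g x) (v x)" using elim by (auto simp: continuous_on_eq_continuous_at)
      moreover have "(\<lambda>j. w j x) \<longlonglongrightarrow> v x" using elim True by simp
      ultimately have "(\<lambda>j. g x (w j x)) \<longlonglongrightarrow> g x (v x)" by (rule isCont_tendsto_compose)
      then show ?thesis by (intro tendsto_mult tendsto_const)
    qed simp
  qed
qed

lemma lower_order_liminf:
  assumes w: "\<And>j. w j \<in> L0 A" and lim: "AE x in lebesgue. x \<in> A \<longrightarrow> (\<lambda>j. w j x) \<longlonglongrightarrow> v x"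
  shows "lower_order g v A \<le> liminf (\<lambda>j. lower_order g (w j) A)"
proof -
  have "lower_order g v A = (\<integral>\<^sup>+x. liminf (\<lambda>j. ennreal (indicator A x * g x (w j x))) \<partial>lebesgue)"
    unfolding lower_order_eq
  proof (rule nn_integral_cong_AE, use g_limit[OF lim] in eventually_elim)
    case (elim x)
    then have "(\<lambda>j. ennreal (indicator A x * g x (w j x))) \<longlonglongrightarrow> ennreal (indicator A x * g x (v x))"
      by (rule tendsto_ennrealI)
    then show ?case by (intro lim_imp_Liminf[symmetric]) simp_all
  qed
  also have "\<dots> \<le> liminf (\<lambda>j. \<integral>\<^sup>+x. ennreal (indicator A x * g x (w j x)) \<partial>lebesgue)"
    using g_comp_measurable[OF w] by (intro nn_integral_liminf measurable_compose[OF _ measurable_ennreal])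
  finally show ?thesis by (simp add: lower_order_eq)
qed

lemma lower_order_dominated:
  assumes w: "\<And>j. w j \<in> L0 A" and v: "v \<in> L0 A"
    and lim: "AE x in lebesgue. x \<in> A \<longrightarrow> (\<lambda>j. w j x) \<longlonglongrightarrow> v x"
    and h: "integrable lebesgue (\<lambda>x. indicator A x * h x)"
    and le: "\<And>j. AE x in lebesgue. x \<in> A \<longrightarrow> g x (w j x) \<le> h x"
  shows "(\<lambda>j. lower_order g (w j) A) \<longlonglongrightarrow> lower_order g v A"
  unfolding lower_order_eq
proof (rule nn_integral_dominated_convergence)
  show "(\<lambda>x. ennreal (indicator A x * g x (w j x))) \<in> borel_measurable lebesgue" for j
    using g_comp_measurable[OF w] by (rule measurable_compose[OF _ measurable_ennreal])
  show "(\<lambda>x. ennreal (indicator A x * g x (v x))) \<in> borel_measurable lebesgue"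
    using g_comp_measurable[OF v] by (rule measurable_compose[OF _ measurable_ennreal])
  show "(\<lambda>x. ennreal (indicator A x * h x)) \<in> borel_measurable lebesgue"
    using borel_measurable_integrable[OF h] by (rule measurable_compose[OF _ measurable_ennreal])
  show "(\<integral>\<^sup>+x. ennreal (indicator A x * h x) \<partial>lebesgue) < \<infinity>"
  proof -
    have "(\<integral>\<^sup>+x. ennreal (indicator A x * h x) \<partial>lebesgue) \<le> (\<integral>\<^sup>+x. ennreal (norm (indicator A x * h x)) \<partial>lebesgue)"
      by (intro nn_integral_mono ennreal_leI) simp
    also have "\<dots> < \<infinity>" using h unfolding integrable_iff_bounded by blast
    finally show ?thesis .
  qed
  show "AE x in lebesgue. ennreal (indicator A x * g x (w j x)) \<le> ennreal (indicator A x * h x)" for j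
    using le[of j] by eventually_elim (auto simp: indicator_def intro!: ennreal_leI)
  show "AE x in lebesgue. (\<lambda>j. ennreal (indicator A x * g x (w j x))) \<longlonglongrightarrow> ennreal (indicator A x * g x (v x))"
    using g_limit[OF lim] by eventually_elim (rule tendsto_ennrealI)
qed

definition "norm_a1 = (\<integral>\<^sup>+x. ennreal \<bar>indicator A x * a1 x\<bar> \<partial>lebesgue)"

lemma norm_a1_finite: "norm_a1 < \<infinity>"
  using integrable_Omega_A[OF a1_a2(1)] by (simp add: norm_a1_def integrable_iff_bounded)

lemma Lq_le_lower_order:
  assumes w: "w \<in> L0 A"
  shows "(\<integral>\<^sup>+x. ennreal (indicator A x * \<bar>w x\<bar> powr q) \<partial>lebesgue) \<le> ennreal (1 / c1) * (lower_order g w A + norm_a1)"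
proof -
  have m1: "(\<lambda>x. ennreal (indicator A x * g x (w x))) \<in> borel_measurable lebesgue"
    using g_comp_measurable[OF w] by (rule measurable_compose[OF _ measurable_ennreal])
  have m2: "(\<lambda>x. ennreal \<bar>indicator A x * a1 x\<bar>) \<in> borel_measurable lebesgue"
    using borel_measurable_integrable[OF integrable_Omega_A[OF a1_a2(1)]] by measurable
  have "(\<integral>\<^sup>+x. ennreal (indicator A x * \<bar>w x\<bar> powr q) \<partial>lebesgue)
      \<le> (\<integral>\<^sup>+x. ennreal (1 / c1) * (ennreal (indicator A x * g x (w x)) + ennreal \<bar>indicator A x * a1 x\<bar>) \<partial>lebesgue)"
  proof (rule nn_integral_mono_AE, use g_growth_A in eventually_elim)
    case (elim x)
    show ?case
    proof (cases "x \<in> A")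
      case True
      then have "c1 * \<bar>w x\<bar> powr q \<le> g x (w x) + \<bar>a1 x\<bar>" using elim by (smt (verit))
      then have "\<bar>w x\<bar> powr q \<le> 1 / c1 * (g x (w x) + \<bar>a1 x\<bar>)" using c1 by (simp add: field_simps)
      moreover have "0 \<le> g x (w x)" using g_A_nonneg[of x "w x"] True by simp
      ultimately show ?thesis using True c1
        by (simp flip: ennreal_plus ennreal_mult)
    qed simp
  qed
  also have "\<dots> = ennreal (1 / c1) * (lower_order g w A + norm_a1)"
    using m1 m2 by (simp add: nn_integral_cmult nn_integral_add lower_order_eq norm_a1_def)
  finally show ?thesis .
qed

lemma powr_measurable:
  assumes "w \<in> L0 A"
  shows "(\<lambda>x. indicator A x * \<bar>w x\<bar> powr q) \<in> borel_measurable lebesgue"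
proof -
  have [measurable]: "(\<lambda>x. indicator A x * w x) \<in> borel_measurable lebesgue" using assms by (simp add: L0_A_iff)
  have "(\<lambda>x. indicator A x * \<bar>indicator A x * w x\<bar> powr q) \<in> borel_measurable lebesgue" by measurable
  moreover have "(\<lambda>x. indicator A x * \<bar>indicator A x * w x\<bar> powr q) = (\<lambda>x. indicator A x * \<bar>w x\<bar> powr q)"
    by (auto simp: indicator_def fun_eq_iff)
  ultimately show ?thesis by simp
qed

lemma powr_integrable:
  assumes w: "w \<in> L0 A" and fin: "lower_order g w A < \<infinity>"
  shows "integrable lebesgue (\<lambda>x. indicator A x * \<bar>w x\<bar> powr q)"
proof -
  have "(\<integral>\<^sup>+x. ennreal (indicator A x * \<bar>w x\<bar> powr q) \<partial>lebesgue) < \<infinity>"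
    using Lq_le_lower_order[OF w] norm_a1_finite fin
    by (auto intro!: le_less_trans[OF Lq_le_lower_order[OF w]] ennreal_mult_less_top[THEN iffD2])
  then show ?thesis using powr_measurable[OF w] by (simp add: integrable_iff_bounded)
qed

lemma Lp_q_A: "w \<in> L0 A \<Longrightarrow> lower_order g w A < \<infinity> \<Longrightarrow> w \<in> Lp q A"
  using powr_integrable[of w] unfolding Lp_def L0_def
  by (simp add: integrable_restrict_space)

lemma F_crack_zero: "F_crack p f (K j) (\<lambda>_. 0) A = 0" and zero_admissible: "(\<lambda>_. 0) \<in> adm j"
proof -
  have w: "is_weak_grad (A - K j) (\<lambda>_. 0) (\<lambda>_. 0)"
    by (auto simp: is_weak_grad_def L1_loc_def set_integrable_def set_lebesgue_integral_def)
  have "(\<lambda>_. 0) \<in> Lp p (A - K j)" by (simp add: Lp_def)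
  then have d: "(\<lambda>_. 0) \<in> deny_lions p (A - K j)" using w unfolding deny_lions_def by blast
  then show "(\<lambda>_. 0) \<in> adm j" by (simp add: admissible_crack_def L0_def)
  have f0: "f 0 = 0" using f_growth(2)[of 0] f_nonneg[of 0] by simp
  have "(\<integral>\<^sup>+x\<in>A - K j. ennreal (f (weak_grad (A - K j) (\<lambda>_. 0) x)) \<partial>lebesgue) = (\<integral>\<^sup>+x. 0 \<partial>(lebesgue :: 'a measure))"
    using weak_grad_AE[OF open_A_diff(1) w]
    by (intro nn_integral_cong_AE, eventually_elim) (auto simp: f0 indicator_def)
  then show "F_crack p f (K j) (\<lambda>_. 0) A = 0" using d by (simp add: F_crack_def)
qed

lemma lower_order_finite:
  assumes w: "w \<in> L0 A" and i: "integrable lebesgue (\<lambda>x. indicator A x * \<bar>w x\<bar> powr q)"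
  shows "lower_order g w A < \<infinity>"
proof -
  have h: "integrable lebesgue (\<lambda>x. c2 * (indicator A x + indicator A x * \<bar>w x\<bar> powr q + indicator A x * a2 x))"
    by (intro integrable_mult_right Bochner_Integration.integrable_add integrable_indicator_A i integrable_Omega_A a1_a2)
  have "lower_order g w A \<le> (\<integral>\<^sup>+x. ennreal (norm (c2 * (indicator A x + indicator A x * \<bar>w x\<bar> powr q + indicator A x * a2 x))) \<partial>lebesgue)"
    unfolding lower_order_eq
  proof (rule nn_integral_mono_AE, use g_growth_A in eventually_elim)
    case (elim x)
    show ?case
    proof (cases "x \<in> A")
      case True
      then have "g x (w x) \<le> c2 * (1 + \<bar>w x\<bar> powr q + a2 x)" using elim by blast
      then show ?thesis using True by (intro ennreal_leI) (simp add: order_trans[OF _ abs_ge_self])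
    qed simp
  qed
  also have "\<dots> < \<infinity>" using h unfolding integrable_iff_bounded by blast
  finally show ?thesis .
qed

definition "zero_energy = lower_order g (\<lambda>_. 0) A"

lemma zero_energy_finite: "zero_energy < \<infinity>"
  unfolding zero_energy_def by (rule lower_order_finite) (simp_all add: L0_def)

lemma minimum_le_zero_energy: "m j \<le> zero_energy"
proof -
  have "m j \<le> E j (\<lambda>_. 0)" by (rule INF_lower[OF zero_admissible])
  then show ?thesis by (simp add: energy_crack_def F_crack_zero zero_energy_def)
qed

lemma K_eventually_disjoint:
  assumes S: "compact S" "S \<inter> M = {}"
  shows "\<forall>\<^sub>F j in sequentially. K j \<inter> S = {}"
proof -
  obtain d where d: "0 < d" "\<And>x y. x \<in> S \<Longrightarrow> y \<in> M \<Longrightarrow> d \<le> dist x y"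
    using separate_compact_closed[OF S(1) compact_imp_closed[OF M(1)] S(2)] by blast
  have "\<forall>\<^sub>F j in sequentially. (SUP x\<in>K j. INF y\<in>M. ennreal (dist x y)) < ennreal d"
    using order_tendstoD(2)[OF K_to_M, of "ennreal d"] d(1) by simp
  then show ?thesis
  proof (rule eventually_mono)
    fix j assume lt: "(SUP x\<in>K j. INF y\<in>M. ennreal (dist x y)) < ennreal d"
    show "K j \<inter> S = {}"
    proof (rule ccontr)
      assume "K j \<inter> S \<noteq> {}"
      then obtain x where x: "x \<in> K j" "x \<in> S" by blast
      have "ennreal d \<le> (INF y\<in>M. ennreal (dist x y))" using d(2)[OF x(2)] by (intro INF_greatest ennreal_leI)
      also have "\<dots> \<le> (SUP x\<in>K j. INF y\<in>M. ennreal (dist x y))" using x(1) by (rule SUP_upper)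
      finally show False using lt by simp
    qed
  qed
qed

lemma deny_lions_L0:
  assumes "w \<in> deny_lions p (A - M)"
  shows "w \<in> L0 A"
proof -
  have "w \<in> L1_loc (A - M)" using assms by (auto simp: deny_lions_def is_weak_grad_def)
  from L1_loc_measurable[OF open_A_diff(2) this]
  have "(\<lambda>x. indicator (A - M) x *\<^sub>R w x) \<in> borel_measurable lebesgue" .
  then have "(\<lambda>x. indicator A x * w x) \<in> borel_measurable lebesgue"
  proof (rule borel_measurable_AE)
    have "M \<in> null_sets lebesgue" using M(2) by (simp add: negligible_iff_null_sets)
    from AE_not_in[OF this] show "AE x in lebesgue. indicator (A - M) x *\<^sub>R w x = indicator A x * w x"
      by eventually_elim (simp add: indicator_def)
  qed
  then show ?thesis by (simp add: L0_A_iff)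
qed

text \<open>
  The liminf inequality of Gamma-convergence concerns sequences indexed by all \<open>j\<close>. A sequence
  given along the indices \<open>r j\<close> is filled up with its limit; this preserves convergence in measure,
  and the lower limit over all indices is at most the one along \<open>r\<close>.
\<close>

lemma gamma_liminf:
  assumes r: "strict_mono r" and w: "\<And>j. w j \<in> L0 A" and v: "v \<in> L0 A"
    and lim: "AE x in lebesgue. x \<in> A \<longrightarrow> (\<lambda>j. w j x) \<longlonglongrightarrow> v x"
  shows "F_meas p f M \<mu> v A \<le> liminf (\<lambda>j. F_crack p f (K (r j)) (w j) A)"
proof -
  define ext where "ext w x = indicator A x * w x" for w :: "'a \<Rightarrow> real" and x
  have ext: "x \<in> A \<Longrightarrow> ext w x = w x" for w x by (simp add: ext_def)
  have extL: "w \<in> L0 A \<Longrightarrow> ext w \<in> L0 \<Omega>" for w unfolding ext_def[abs_def] by (rule L0_extend)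
  have inv: "inv r (r j) = j" for j using strict_mono_imp_inj_on[OF r] by simp
  \<comment> \<open>The given sequence on the range of \<open>r\<close>, its limit elsewhere.\<close>
  define W where "W i = (if i \<in> range r then ext (w (inv r i)) else ext v)" for i
  have W: "W i \<in> L0 \<Omega>" for i using w v by (simp add: W_def extL)
  have "converges_in_measure \<Omega> (\<lambda>j. ext (w j)) (ext v)"
  proof (rule AE_imp_converges_in_measure[OF Omega_lmeasurable extL[OF w] extL[OF v]])
    show "AE x in lebesgue. x \<in> \<Omega> \<longrightarrow> (\<lambda>j. ext (w j) x) \<longlonglongrightarrow> ext v x"
      using lim by eventually_elim (auto simp: ext_def indicator_def)
  qed
  then have conv: "\<And>e. 0 < e \<Longrightarrow> (\<lambda>j. emeasure lebesgue {x \<in> \<Omega>. \<bar>ext (w j) x - ext v x\<bar> > e}) \<longlonglongrightarrow> 0"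
    by (simp add: converges_in_measure_def)
  have "converges_in_measure \<Omega> W (ext v)"
    unfolding converges_in_measure_def
  proof (intro allI impI)
    fix e :: real assume e: "0 < e"
    show "(\<lambda>i. emeasure lebesgue {x \<in> \<Omega>. e < \<bar>W i x - ext v x\<bar>}) \<longlonglongrightarrow> 0"
    proof (rule order_tendstoI)
      fix a :: ennreal assume a: "0 < a"
      from order_tendstoD(2)[OF conv[OF e] a] obtain N
        where N: "\<And>j. j \<ge> N \<Longrightarrow> emeasure lebesgue {x \<in> \<Omega>. \<bar>ext (w j) x - ext v x\<bar> > e} < a"
        unfolding eventually_sequentially by blast
      show "\<forall>\<^sub>F i in sequentially. emeasure lebesgue {x \<in> \<Omega>. e < \<bar>W i x - ext v x\<bar>} < a"
        unfolding eventually_sequentially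
      proof (intro exI allI impI)
        fix i assume i: "r N \<le> i"
        show "emeasure lebesgue {x \<in> \<Omega>. e < \<bar>W i x - ext v x\<bar>} < a"
        proof (cases "i \<in> range r")
          case True
          then obtain j where j: "i = r j" by blast
          then have "N \<le> j" using i r by (simp add: strict_mono_less_eq)
          then show ?thesis using N[of j] by (simp add: W_def j inv)
        next
          case False
          then show ?thesis using e a by (simp add: W_def)
        qed
      qed
    qed simp
  qed
  then have "F_meas p f M \<mu> (ext v) A \<le> liminf (\<lambda>i. F_crack p f (K i) (W i) A)"
    using Gamma extL[OF v] W unfolding gamma_converges_def by blast
  also have "\<dots> \<le> liminf ((\<lambda>i. F_crack p f (K i) (W i) A) \<circ> r)"
    by (rule liminf_subseq_mono[OF r])
  also have "((\<lambda>i. F_crack p f (K i) (W i) A) \<circ> r) = (\<lambda>j. F_crack p f (K (r j)) (w j) A)"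
  proof
    fix j
    have "F_crack p f (K (r j)) (ext (w j)) A = F_crack p f (K (r j)) (w j) A"
      by (rule F_crack_cong) (rule ext)
    then show "((\<lambda>i. F_crack p f (K i) (W i) A) \<circ> r) j = F_crack p f (K (r j)) (w j) A"
      by (simp add: W_def inv)
  qed
  also have "F_meas p f M \<mu> (ext v) A = F_meas p f M \<mu> v A"
    by (rule F_meas_cong[OF A(1)]) (rule ext)
  finally show ?thesis .
qed

lemma energy_liminf:
  assumes r: "strict_mono r" and w: "\<And>j. w j \<in> L0 A" and v: "v \<in> L0 A"
    and lim: "AE x in lebesgue. x \<in> A \<longrightarrow> (\<lambda>j. w j x) \<longlonglongrightarrow> v x"
  shows "E\<^sub>0 v \<le> liminf (\<lambda>j. E (r j) (w j))"
proof -
  have "E\<^sub>0 v \<le> liminf (\<lambda>j. F_crack p f (K (r j)) (w j) A) + liminf (\<lambda>j. lower_order g (w j) A)"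
    unfolding energy_meas_def by (intro add_mono gamma_liminf[OF assms] lower_order_liminf[OF w lim])
  also have "\<dots> \<le> liminf (\<lambda>j. E (r j) (w j))"
    unfolding energy_crack_def by (rule liminf_add_ennreal)
  finally show ?thesis .
qed

lemma grad_Lp_le:
  assumes w: "w \<in> deny_lions p (A - K j)"
  shows "(\<integral>\<^sup>+x\<in>A - K j. ennreal (norm (weak_grad (A - K j) w x) powr p) \<partial>lebesgue) \<le> ennreal (1 / lam) * F_crack p f (K j) w A"
    and "(\<lambda>x. indicator (A - K j) x *\<^sub>R weak_grad (A - K j) w x) \<in> borel_measurable lebesgue"
proof -
  define U where "U = A - K j"
  define v where "v = weak_grad U w"
  have v: "is_weak_grad U w v" using w unfolding v_def U_def deny_lions_def by (blast intro: weak_grad_works)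
  then have vm: "(\<lambda>x. indicator U x *\<^sub>R v x) \<in> borel_measurable lebesgue"
    using open_A_diff(1)[of j] by (intro L1_loc_measurable) (auto simp: is_weak_grad_def U_def)
  then show "(\<lambda>x. indicator (A - K j) x *\<^sub>R weak_grad (A - K j) w x) \<in> borel_measurable lebesgue"
    by (simp add: U_def v_def)
  have U[measurable]: "U \<in> sets lebesgue" unfolding U_def using open_A_diff(1)[of j] by simp
  have m0: "(\<lambda>x. ennreal (indicator U x * norm (indicator U x *\<^sub>R v x) powr p)) \<in> borel_measurable lebesgue"
    using vm by measurable
  have eq: "ennreal (norm (v x) powr p) * indicator U x = ennreal (indicator U x * norm (indicator U x *\<^sub>R v x) powr p)" for x
    by (simp add: indicator_def)
  have "(\<integral>\<^sup>+x\<in>U. ennreal (norm (v x) powr p) \<partial>lebesgue)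
      = ennreal (1 / lam) * (ennreal lam * (\<integral>\<^sup>+x\<in>U. ennreal (norm (v x) powr p) \<partial>lebesgue))"
    using lam by (simp flip: mult.assoc ennreal_mult)
  also have "ennreal lam * (\<integral>\<^sup>+x\<in>U. ennreal (norm (v x) powr p) \<partial>lebesgue)
      = (\<integral>\<^sup>+x. ennreal lam * (ennreal (norm (v x) powr p) * indicator U x) \<partial>lebesgue)"
    unfolding eq by (rule nn_integral_cmult[OF m0, symmetric])
  also have "\<dots> \<le> (\<integral>\<^sup>+x\<in>U. ennreal (f (v x)) \<partial>lebesgue)"
  proof (rule nn_integral_mono)
    fix x
    have "ennreal lam * ennreal (norm (v x) powr p) \<le> ennreal (f (v x))"
      using lam f_growth(1)[of "v x"] by (simp add: ennreal_mult[symmetric] ennreal_leI)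
    then show "ennreal lam * (ennreal (norm (v x) powr p) * indicator U x) \<le> ennreal (f (v x)) * indicator U x"
      by (simp add: indicator_def)
  qed
  also have "\<dots> = F_crack p f (K j) w A" using w by (simp add: F_crack_def U_def v_def)
  finally show "(\<integral>\<^sup>+x\<in>A - K j. ennreal (norm (weak_grad (A - K j) w x) powr p) \<partial>lebesgue) \<le> ennreal (1 / lam) * F_crack p f (K j) w A"
    by (simp add: U_def v_def mult_left_mono)
qed

text \<open>
  On a set of finite measure the bounds in \<open>L\<^sup>q\<close> and \<open>L\<^sup>p\<close> give bounds in \<open>L\<^sup>1\<close>. A compact subset of
  \<open>A - M\<close> has positive distance from \<open>M\<close> and is therefore disjoint from \<open>K j\<close> for large \<open>j\<close>, so
  the weak gradient on \<open>A - K j\<close> can be tested there.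
\<close>

lemma compactness:
  assumes w: "\<And>j. w j \<in> adm (r j)" and r: "strict_mono r" and B: "\<And>j. E (r j) (w j) \<le> B" "B < \<infinity>"
  obtains k v where "strict_mono (k :: nat \<Rightarrow> nat)" "v \<in> L0 A" "AE x in lebesgue. x \<in> A \<longrightarrow> (\<lambda>j. w (k j) x) \<longlonglongrightarrow> v x"
proof -
  have wL: "w j \<in> L0 A" and wd: "w j \<in> deny_lions p (A - K (r j))" for j using w by (auto simp: admissible_crack_def)
  have F: "F_crack p f (K (r j)) (w j) A \<le> B" and G: "lower_order g (w j) A \<le> B" for j
    using B(1)[of j] unfolding energy_crack_def
    by (meson add_increasing2 order_trans order_refl zero_le, meson add_increasing order_trans order_refl zero_le)
  define V where "V j = weak_grad (A - K (r j)) (w j)" for j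
  define mA where "mA = emeasure lebesgue A"
  have mA: "mA < \<infinity>" using A_lmeasurable by (simp add: mA_def fmeasurable_def)
  define C1 where "C1 = mA + ennreal (1 / c1) * (B + norm_a1)"
  define C2 where "C2 = mA + ennreal (1 / lam) * B"
  have "C1 + C2 < \<infinity>" using mA B(2) norm_a1_finite by (auto simp: C1_def C2_def ennreal_mult_less_top)
  then obtain C where C: "0 \<le> C" "C1 + C2 = ennreal C" by (cases "C1 + C2" rule: ennreal_cases) auto
  have b1: "(\<integral>\<^sup>+x. ennreal \<bar>w j x\<bar> * indicator S x \<partial>lebesgue) \<le> ennreal C" if S: "S \<subseteq> A" for j S
  proof -
    have m0: "(\<lambda>x. ennreal (indicator A x * \<bar>w j x\<bar> powr q)) \<in> borel_measurable lebesgue"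
      using powr_measurable[OF wL[of j]] by (rule measurable_compose[OF _ measurable_ennreal])
    have "(\<integral>\<^sup>+x. ennreal \<bar>w j x\<bar> * indicator S x \<partial>lebesgue) \<le> (\<integral>\<^sup>+x. indicator A x + ennreal (indicator A x * \<bar>w j x\<bar> powr q) \<partial>lebesgue)"
    proof (rule nn_integral_mono)
      fix x
      show "ennreal \<bar>w j x\<bar> * indicator S x \<le> indicator A x + ennreal (indicator A x * \<bar>w j x\<bar> powr q)"
      proof (cases "x \<in> S")
        case True
        have "ennreal \<bar>w j x\<bar> \<le> ennreal (1 + \<bar>w j x\<bar> powr q)"
          using le_one_plus_powr[of "\<bar>w j x\<bar>" q] q by (intro ennreal_leI) simp
        then show ?thesis using True S by (auto simp: ennreal_plus)
      qed simp
    qed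
    also have "\<dots> = mA + (\<integral>\<^sup>+x. ennreal (indicator A x * \<bar>w j x\<bar> powr q) \<partial>lebesgue)"
      unfolding mA_def by (subst nn_integral_add[OF _ m0]) simp_all
    also have "\<dots> \<le> C1" unfolding C1_def
      by (intro add_left_mono order_trans[OF Lq_le_lower_order[OF wL]] mult_left_mono add_right_mono G) simp
    also have "\<dots> \<le> C1 + C2" by simp
    finally show ?thesis using C(2) by simp
  qed
  have b2: "(\<integral>\<^sup>+x. ennreal (norm (V j x)) * indicator S x \<partial>lebesgue) \<le> ennreal C" if S: "S \<subseteq> A - K (r j)" for j S
  proof -
    define U where "U = A - K (r j)"
    have U[measurable]: "U \<in> sets lebesgue" unfolding U_def using open_A_diff(1)[of "r j"] by simp
    have [measurable]: "(\<lambda>x. indicator U x *\<^sub>R V j x) \<in> borel_measurable lebesgue"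
      using grad_Lp_le(2)[OF wd[of j]] by (simp add: U_def V_def)
    have "(\<lambda>x. ennreal (norm (indicator U x *\<^sub>R V j x) powr p)) \<in> borel_measurable lebesgue" by measurable
    moreover have "ennreal (norm (indicator U x *\<^sub>R V j x) powr p) = ennreal (norm (V j x) powr p) * indicator U x" for x
      by (simp add: indicator_def)
    ultimately have m0: "(\<lambda>x. ennreal (norm (V j x) powr p) * indicator U x) \<in> borel_measurable lebesgue" by (simp only:)
    have "(\<integral>\<^sup>+x. ennreal (norm (V j x)) * indicator S x \<partial>lebesgue) \<le> (\<integral>\<^sup>+x. indicator A x + ennreal (norm (V j x) powr p) * indicator U x \<partial>lebesgue)"
    proof (rule nn_integral_mono)
      fix x
      show "ennreal (norm (V j x)) * indicator S x \<le> indicator A x + ennreal (norm (V j x) powr p) * indicator U x"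
      proof (cases "x \<in> S")
        case True
        have "ennreal (norm (V j x)) \<le> ennreal (1 + norm (V j x) powr p)"
          using le_one_plus_powr[of "norm (V j x)" p] p by (intro ennreal_leI) simp
        then show ?thesis using True S by (auto simp: ennreal_plus U_def)
      qed simp
    qed
    also have "\<dots> = mA + (\<integral>\<^sup>+x. ennreal (norm (V j x) powr p) * indicator U x \<partial>lebesgue)"
      unfolding mA_def by (subst nn_integral_add[OF _ m0]) simp_all
    also have "\<dots> \<le> C2" unfolding C2_def U_def V_def
      by (intro add_left_mono order_trans[OF grad_Lp_le(1)[OF wd]] mult_left_mono F) simp
    also have "\<dots> \<le> C1 + C2" by simp
    finally show ?thesis using C(2) by simp
  qed
  have ev: "\<forall>\<^sub>F j in sequentially. (\<exists>A. S \<subseteq> A \<and> is_weak_grad A (w j) (V j)) \<and>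
       (\<integral>\<^sup>+x. ennreal \<bar>w j x\<bar> * indicator S x \<partial>lebesgue) \<le> ennreal C \<and>
       (\<integral>\<^sup>+x. ennreal (norm (V j x)) * indicator S x \<partial>lebesgue) \<le> ennreal C"
    if S: "compact S" "S \<subseteq> A - M" for S
  proof -
    have "S \<inter> M = {}" using S(2) by blast
    from eventually_subseq[OF r K_eventually_disjoint[OF S(1) this]]
    show ?thesis
    proof (rule eventually_mono)
      fix j assume "K (r j) \<inter> S = {}"
      then have SK: "S \<subseteq> A - K (r j)" using S(2) by blast
      have "is_weak_grad (A - K (r j)) (w j) (V j)"
        using wd[of j] unfolding V_def deny_lions_def by (blast intro: weak_grad_works)
      then show "(\<exists>A. S \<subseteq> A \<and> is_weak_grad A (w j) (V j)) \<and>
       (\<integral>\<^sup>+x. ennreal \<bar>w j x\<bar> * indicator S x \<partial>lebesgue) \<le> ennreal C \<and>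
       (\<integral>\<^sup>+x. ennreal (norm (V j x)) * indicator S x \<partial>lebesgue) \<le> ennreal C"
        using SK b2[OF SK] S(2) by (intro conjI exI[of _ "A - K (r j)"] b1) auto
    qed
  qed
  obtain k where k: "strict_mono (k :: nat \<Rightarrow> nat)" "AE x in lebesgue. x \<in> A - M \<longrightarrow> convergent (\<lambda>j. w (k j) x)"
    by (rule rellich_AE[OF open_A_diff(2) C(1) ev])
  define v where "v x = lim (\<lambda>j. indicator A x * w (k j) x)" for x
  have "v \<in> borel_measurable lebesgue"
    unfolding v_def[abs_def] using wL by (intro borel_measurable_lim_metric) (simp add: L0_A_iff)
  then have "v \<in> L0 A" by (simp add: L0_def measurable_restrict_space1)
  moreover have "AE x in lebesgue. x \<in> A \<longrightarrow> (\<lambda>j. w (k j) x) \<longlonglongrightarrow> v x"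
  proof -
    have "M \<in> null_sets lebesgue" using M(2) by (simp add: negligible_iff_null_sets)
    from k(2) AE_not_in[OF this] show ?thesis
      by eventually_elim (auto simp: v_def convergent_LIMSEQ_iff)
  qed
  ultimately show thesis using that k(1) by blast
qed

text \<open>
  The truncated members of a recovery sequence are competitors for the minimum values, with no
  more gradient energy. The lower order terms are dominated by the growth of \<open>g\<close> at the height of
  truncation; almost everywhere convergence is available along a subsequence, which is first
  chosen to realise the upper limit of the minimum values.
\<close>

lemma limsup_truncated:
  assumes w: "w \<in> deny_lions p (A - M)" and k: "0 < k"
  shows "limsup m \<le> F_meas p f M \<mu> w A + lower_order g (\<lambda>x. soft_cut k (w x)) A"
proof -
  have wL: "w \<in> L0 A" by (rule deny_lions_L0[OF w])
  define u where "u x = indicator A x * w x" for x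
  have u: "u \<in> L0 \<Omega>" unfolding u_def[abs_def] by (rule L0_extend[OF wL])
  have uw: "x \<in> A \<Longrightarrow> u x = w x" for x by (simp add: u_def)
  obtain v where v: "\<And>j. v j \<in> L0 \<Omega>" "converges_in_measure \<Omega> v u"
    "limsup (\<lambda>j. F_crack p f (K j) (v j) A) \<le> F_meas p f M \<mu> u A"
    using Gamma u unfolding gamma_converges_def by blast
  have Fu: "F_meas p f M \<mu> u A = F_meas p f M \<mu> w A" by (rule F_meas_cong[OF A(1) uw])
  obtain r where r: "strict_mono r" "(m \<circ> r) \<longlonglongrightarrow> limsup m" using limsup_subseq_lim by blast
  have "converges_in_measure \<Omega> (\<lambda>j. v (r j)) u"
    unfolding converges_in_measure_def
  proof (intro allI impI)
    fix e :: real assume "0 < e"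
    then have "(\<lambda>j. emeasure lebesgue {x \<in> \<Omega>. e < \<bar>v j x - u x\<bar>}) \<longlonglongrightarrow> 0"
      using v(2) by (simp add: converges_in_measure_def)
    from LIMSEQ_subseq_LIMSEQ[OF this r(1)]
    show "(\<lambda>j. emeasure lebesgue {x \<in> \<Omega>. e < \<bar>v (r j) x - u x\<bar>}) \<longlonglongrightarrow> 0" by (simp add: o_def)
  qed
  from converges_in_measure_AE_subseq[OF Omega_lmeasurable v(1) u this]
  obtain s where s: "strict_mono s" "AE x in lebesgue. x \<in> \<Omega> \<longrightarrow> (\<lambda>j. v (r (s j)) x) \<longlonglongrightarrow> u x" by blast
  define t where "t = r \<circ> s"
  have t: "strict_mono t" unfolding t_def by (rule strict_mono_o[OF r(1) s(1)])
  have mt: "(\<lambda>j. m (t j)) \<longlonglongrightarrow> limsup m"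
    using LIMSEQ_subseq_LIMSEQ[OF r(2) s(1)] by (simp add: t_def o_def)
  have cont: "continuous_on UNIV (soft_cut k)"
    by (intro continuous_at_imp_continuous_on ballI isCont_soft_cut k)
  then have [measurable]: "soft_cut k \<in> borel_measurable borel" by (rule borel_measurable_continuous_onI)
  have cutL: "z \<in> L0 A \<Longrightarrow> (\<lambda>x. soft_cut k (z x)) \<in> L0 A" for z unfolding L0_def by measurable
  have vL: "v j \<in> L0 A" for j by (rule L0_restrict[OF v(1)])
  have le: "m j \<le> F_crack p f (K j) (v j) A + lower_order g (\<lambda>x. soft_cut k (v j x)) A" for j
  proof (cases "v j \<in> deny_lions p (A - K j)")
    case True
    have dc: "continuous_on UNIV (\<lambda>s. 1 / (1 + (s / k)\<^sup>2))"
      using k by (intro continuous_intros) (auto simp: add_nonneg_eq_0_iff)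
    have p0: "0 < p" using p by simp
    have c: "(\<lambda>x. soft_cut k (v j x)) \<in> deny_lions p (A - K j)"
      by (rule F_crack_chain_le(1)[OF open_A_diff(1) True p0 f_nonneg f_homogeneous DERIV_soft_cut[OF k] dc
          soft_cut_deriv_bounds soft_cut_bounded[OF k]])
    have c': "F_crack p f (K j) (\<lambda>x. soft_cut k (v j x)) A \<le> F_crack p f (K j) (v j) A"
      by (rule F_crack_chain_le(2)[OF open_A_diff(1) True p0 f_nonneg f_homogeneous DERIV_soft_cut[OF k] dc
          soft_cut_deriv_bounds soft_cut_bounded[OF k]])
    have "(\<lambda>x. soft_cut k (v j x)) \<in> adm j"
      using c cutL[OF vL] by (simp add: admissible_crack_def)
    then have "m j \<le> E j (\<lambda>x. soft_cut k (v j x))" by (rule INF_lower)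
    also have "\<dots> \<le> F_crack p f (K j) (v j) A + lower_order g (\<lambda>x. soft_cut k (v j x)) A"
      unfolding energy_crack_def by (rule add_right_mono[OF c'])
    finally show ?thesis .
  qed (simp add: F_crack_def)
  define h where "h x = c2 * (1 + (k * (pi / 2)) powr q + a2 x)" for x
  have hi: "integrable lebesgue (\<lambda>x. indicator A x * h x)"
  proof -
    have "integrable lebesgue (\<lambda>x. c2 * ((1 + (k * (pi / 2)) powr q) * indicator A x + indicator A x * a2 x))"
      by (intro integrable_mult_right Bochner_Integration.integrable_add integrable_indicator_A integrable_Omega_A a1_a2)
    moreover have "(\<lambda>x. c2 * ((1 + (k * (pi / 2)) powr q) * indicator A x + indicator A x * a2 x)) = (\<lambda>x. indicator A x * h x)"
      by (simp add: h_def fun_eq_iff algebra_simps)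
    ultimately show ?thesis by (simp only:)
  qed
  have gh: "AE x in lebesgue. x \<in> A \<longrightarrow> g x (soft_cut k (z x)) \<le> h x" for z
    using g_growth_A
  proof (eventually_elim, intro impI)
    fix x assume "x \<in> A \<longrightarrow> (\<forall>s. c1 * \<bar>s\<bar> powr q - a1 x \<le> g x s \<and> g x s \<le> c2 * (1 + \<bar>s\<bar> powr q + a2 x))" "x \<in> A"
    then have "g x (soft_cut k (z x)) \<le> c2 * (1 + \<bar>soft_cut k (z x)\<bar> powr q + a2 x)" by blast
    also have "\<bar>soft_cut k (z x)\<bar> powr q \<le> (k * (pi / 2)) powr q"
      using soft_cut_bounded[OF k] q by (intro powr_mono2) auto
    then have "c2 * (1 + \<bar>soft_cut k (z x)\<bar> powr q + a2 x) \<le> h x"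
      unfolding h_def using c2 by (intro mult_left_mono) auto
    finally show "g x (soft_cut k (z x)) \<le> h x" .
  qed
  have low: "(\<lambda>j. lower_order g (\<lambda>x. soft_cut k (v (t j) x)) A) \<longlonglongrightarrow> lower_order g (\<lambda>x. soft_cut k (w x)) A"
  proof (rule lower_order_dominated[OF cutL[OF vL] cutL[OF wL] _ hi gh])
    show "AE x in lebesgue. x \<in> A \<longrightarrow> (\<lambda>j. soft_cut k (v (t j) x)) \<longlonglongrightarrow> soft_cut k (w x)"
      using s(2)
    proof (eventually_elim, intro impI)
      fix x assume "x \<in> \<Omega> \<longrightarrow> (\<lambda>j. v (r (s j)) x) \<longlonglongrightarrow> u x" "x \<in> A"
      then have "(\<lambda>j. v (t j) x) \<longlonglongrightarrow> w x" using A(2) uw by (auto simp: t_def)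
      then show "(\<lambda>j. soft_cut k (v (t j) x)) \<longlonglongrightarrow> soft_cut k (w x)"
        by (rule isCont_tendsto_compose[OF isCont_soft_cut[OF k]])
    qed
  qed
  have fin: "lower_order g (\<lambda>x. soft_cut k (w x)) A < \<infinity>"
  proof (rule lower_order_finite[OF cutL[OF wL]])
    show "integrable lebesgue (\<lambda>x. indicator A x * \<bar>soft_cut k (w x)\<bar> powr q)"
    proof (rule Bochner_Integration.integrable_bound)
      show "integrable lebesgue (\<lambda>x. (k * (pi / 2)) powr q * indicator A x)"
        by (intro integrable_mult_right integrable_indicator_A)
      show "AE x in lebesgue. norm (indicator A x * \<bar>soft_cut k (w x)\<bar> powr q) \<le> norm ((k * (pi / 2)) powr q * indicator A x)"
        using powr_mono2[OF _ abs_ge_zero soft_cut_bounded[OF k], of q] q by (intro AE_I2) (simp add: indicator_def)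
    qed (rule powr_measurable[OF cutL[OF wL]])
  qed
  have "limsup m = limsup (\<lambda>j. m (t j))" using lim_imp_Limsup[OF _ mt] by simp
  also have "\<dots> \<le> limsup (\<lambda>j. F_crack p f (K (t j)) (v (t j)) A + lower_order g (\<lambda>x. soft_cut k (v (t j) x)) A)"
    by (intro Limsup_mono always_eventually allI le)
  also have "\<dots> \<le> F_meas p f M \<mu> w A + lower_order g (\<lambda>x. soft_cut k (w x)) A"
  proof (rule limsup_add_le_of_converges[OF _ low fin])
    have "limsup (\<lambda>j. F_crack p f (K (t j)) (v (t j)) A) \<le> limsup (\<lambda>j. F_crack p f (K j) (v j) A)"
      using limsup_subseq_mono[OF t, of "\<lambda>j. F_crack p f (K j) (v j) A"] by (simp add: o_def)
    then show "limsup (\<lambda>j. F_crack p f (K (t j)) (v (t j)) A) \<le> F_meas p f M \<mu> w A"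
      using v(3) unfolding Fu by (rule order_trans)
  qed
  finally show ?thesis .
qed

text \<open>
  If the lower order term of \<open>w\<close> is finite then \<open>w\<close> lies in \<open>L\<^sup>q(A)\<close>, which dominates the lower order
  terms of all truncations of \<open>w\<close>.
\<close>

lemma limsup_minima_le:
  assumes w: "w \<in> deny_lions p (A - M)"
  shows "limsup m \<le> E\<^sub>0 w"
proof (cases "lower_order g w A < \<infinity>")
  case True
  have wL: "w \<in> L0 A" by (rule deny_lions_L0[OF w])
  note wq = powr_integrable[OF wL True]
  define T where "T n = soft_cut (real (Suc n))" for n
  have "continuous_on UNIV (T n)" for n
    unfolding T_def by (intro continuous_at_imp_continuous_on ballI isCont_soft_cut) simp
  then have [measurable]: "T n \<in> borel_measurable borel" for n by (rule borel_measurable_continuous_onI)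
  have TL: "(\<lambda>x. T n (w x)) \<in> L0 A" for n using wL unfolding L0_def by measurable
  define h where "h x = c2 * (1 + \<bar>w x\<bar> powr q + a2 x)" for x
  have hi: "integrable lebesgue (\<lambda>x. indicator A x * h x)"
  proof -
    have "integrable lebesgue (\<lambda>x. c2 * (indicator A x + indicator A x * \<bar>w x\<bar> powr q + indicator A x * a2 x))"
      by (intro integrable_mult_right Bochner_Integration.integrable_add integrable_indicator_A wq integrable_Omega_A a1_a2)
    moreover have "(\<lambda>x. c2 * (indicator A x + indicator A x * \<bar>w x\<bar> powr q + indicator A x * a2 x)) = (\<lambda>x. indicator A x * h x)"
      by (simp add: h_def fun_eq_iff algebra_simps)
    ultimately show ?thesis by (simp only:)
  qed
  have "(\<lambda>n. lower_order g (\<lambda>x. T n (w x)) A) \<longlonglongrightarrow> lower_order g w A"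
  proof (rule lower_order_dominated[OF TL wL _ hi])
    show "AE x in lebesgue. x \<in> A \<longrightarrow> (\<lambda>n. T n (w x)) \<longlonglongrightarrow> w x"
      unfolding T_def by (intro AE_I2 impI soft_cut_tendsto)
    show "AE x in lebesgue. x \<in> A \<longrightarrow> g x (T n (w x)) \<le> h x" for n
      using g_growth_A
    proof (eventually_elim, intro impI)
      fix x assume "x \<in> A \<longrightarrow> (\<forall>s. c1 * \<bar>s\<bar> powr q - a1 x \<le> g x s \<and> g x s \<le> c2 * (1 + \<bar>s\<bar> powr q + a2 x))" "x \<in> A"
      then have "g x (T n (w x)) \<le> c2 * (1 + \<bar>T n (w x)\<bar> powr q + a2 x)" by blast
      also have "\<bar>T n (w x)\<bar> powr q \<le> \<bar>w x\<bar> powr q"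
        unfolding T_def using q by (intro powr_mono2 soft_cut_le) auto
      then have "c2 * (1 + \<bar>T n (w x)\<bar> powr q + a2 x) \<le> h x"
        unfolding h_def using c2 by (intro mult_left_mono) auto
      finally show "g x (T n (w x)) \<le> h x" .
    qed
  qed
  then have "(\<lambda>n. F_meas p f M \<mu> w A + lower_order g (\<lambda>x. T n (w x)) A) \<longlonglongrightarrow> F_meas p f M \<mu> w A + lower_order g w A"
    by (intro tendsto_add tendsto_const)
  then have "limsup m \<le> F_meas p f M \<mu> w A + lower_order g w A"
    by (rule LIMSEQ_le_const) (intro exI allI impI, unfold T_def, rule limsup_truncated[OF w], simp)
  then show ?thesis by (simp add: energy_meas_def)
next
  case False
  then have "lower_order g w A = \<infinity>" by (simp add: less_top[symmetric])
  then show ?thesis by (simp add: energy_meas_def)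
qed

lemma bounded_energy_subseq:
  assumes w: "\<And>j. w j \<in> adm (r j)" and r: "strict_mono r" and B: "\<And>j. E (r j) (w j) \<le> B" "B < \<infinity>"
  obtains k v where "strict_mono (k :: nat \<Rightarrow> nat)" "v \<in> L0 A" "v \<in> deny_lions p (A - M)"
    "AE x in lebesgue. x \<in> A \<longrightarrow> (\<lambda>j. w (k j) x) \<longlonglongrightarrow> v x"
    "E\<^sub>0 v \<le> liminf (\<lambda>j. E (r (k j)) (w (k j)))"
proof -
  obtain k v where k: "strict_mono (k :: nat \<Rightarrow> nat)" and v: "v \<in> L0 A" "AE x in lebesgue. x \<in> A \<longrightarrow> (\<lambda>j. w (k j) x) \<longlonglongrightarrow> v x"
    by (rule compactness[OF w r B])
  have rk: "strict_mono (\<lambda>j. r (k j))" using strict_mono_o[OF r k] by (simp add: o_def)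
  have le: "E\<^sub>0 v \<le> liminf (\<lambda>j. E (r (k j)) (w (k j)))"
    by (rule energy_liminf[OF rk _ v]) (use w in \<open>simp add: admissible_crack_def\<close>)
  also have "\<dots> \<le> liminf (\<lambda>j. B)" by (intro Liminf_mono always_eventually allI B)
  also have "\<dots> = B" by (rule Liminf_const) simp
  finally have "E\<^sub>0 v < \<infinity>" using B(2) by (rule le_less_trans)
  then have "v \<in> deny_lions p (A - M)"
    unfolding energy_meas_def F_meas_def by (auto split: if_splits)
  then show thesis by (rule that[OF k v(1) _ v(2) le])
qed

abbreviation "m\<^sub>0 \<equiv> INF u\<in>deny_lions p (A - M). E\<^sub>0 u"

text \<open>
  Near-minimisers, up to errors tending to zero, along indices that realise the lower limit.
\<close>

lemma minima_le_liminf: "m\<^sub>0 \<le> liminf m"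
proof -
  obtain r where r: "strict_mono r" "(m \<circ> r) \<longlonglongrightarrow> liminf m" using liminf_subseq_lim by blast
  define \<delta> where "\<delta> j = ennreal (1 / real (Suc j))" for j
  have \<delta>: "\<delta> \<longlonglongrightarrow> 0"
    unfolding \<delta>_def[abs_def] using tendsto_ennrealI[OF LIMSEQ_Suc[OF lim_1_over_n]] by simp
  have \<delta>1: "0 < \<delta> j" "\<delta> j \<le> 1" for j
    unfolding \<delta>_def by (simp, subst ennreal_1[symmetric], rule ennreal_leI) simp
  have "\<exists>w\<in>adm (r j). E (r j) w < m (r j) + \<delta> j" for j
  proof -
    have *: "z < z + \<delta> j" if "z < \<infinity>" for z :: ennreal
      using that \<delta>1(1)[of j] ennreal_add_left_cancel_less[of z 0 "\<delta> j"] by (simp add: less_top)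
    have "m (r j) < \<infinity>" by (rule le_less_trans[OF minimum_le_zero_energy zero_energy_finite])
    from *[OF this] show ?thesis by (rule INF_less_iff[THEN iffD1])
  qed
  then obtain w where w: "\<And>j. w j \<in> adm (r j)" "\<And>j. E (r j) (w j) < m (r j) + \<delta> j" by metis
  have EB: "E (r j) (w j) \<le> zero_energy + 1" for j
    using less_imp_le[OF w(2)[of j]] add_mono[OF minimum_le_zero_energy[of "r j"] \<delta>1(2)[of j]] by (rule order_trans)
  have fin: "zero_energy + 1 < \<infinity>" using zero_energy_finite by (simp add: less_top)
  obtain k v where k: "strict_mono (k :: nat \<Rightarrow> nat)" and v: "v \<in> deny_lions p (A - M)"
    "E\<^sub>0 v \<le> liminf (\<lambda>j. E (r (k j)) (w (k j)))"
    by (rule bounded_energy_subseq[OF w(1) r(1) EB fin])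
  have "m\<^sub>0 \<le> E\<^sub>0 v" by (rule INF_lower[OF v(1)])
  also have "\<dots> \<le> liminf (\<lambda>j. E (r (k j)) (w (k j)))" by (rule v(2))
  also have "\<dots> \<le> liminf (\<lambda>j. m (r (k j)) + \<delta> (k j))"
    by (intro Liminf_mono always_eventually allI less_imp_le w)
  also have "\<dots> = liminf m + 0"
  proof (rule lim_imp_Liminf)
    show "(\<lambda>j. m (r (k j)) + \<delta> (k j)) \<longlonglongrightarrow> liminf m + 0"
      using LIMSEQ_subseq_LIMSEQ[OF r(2) k] LIMSEQ_subseq_LIMSEQ[OF \<delta> k]
      by (intro tendsto_add) (simp_all add: o_def)
  qed simp
  finally show ?thesis by simp
qed

lemma minima_converge: "m \<longlonglongrightarrow> m\<^sub>0"
proof -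
  have "limsup m \<le> m\<^sub>0" by (intro INF_greatest limsup_minima_le)
  then have "limsup m = m\<^sub>0" "liminf m = m\<^sub>0"
    using minima_le_liminf Liminf_le_Limsup[of sequentially m] by auto
  then show ?thesis by (simp add: tendsto_iff_Liminf_eq_Limsup)
qed

text \<open>
  By Fatou's lemma the assumption on the upper limit means that the integrals of the nonnegative
  functions \<open>g x (w j x)\<close> converge, so Scheffe's lemma gives their convergence in \<open>L\<^sup>1\<close>. As they
  control \<open>\<bar>w j x\<bar> powr q\<close> up to an integrable function, dominated convergence applies after
  splitting off the part that tends to zero in \<open>L\<^sup>1\<close>.
\<close>

lemma converges_in_Lq:
  assumes w: "\<And>j. w j \<in> L0 A" "\<And>j. lower_order g (w j) A < \<infinity>"
    and v: "v \<in> L0 A" "lower_order g v A < \<infinity>"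
    and lim: "AE x in lebesgue. x \<in> A \<longrightarrow> (\<lambda>j. w j x) \<longlonglongrightarrow> v x"
    and ls: "limsup (\<lambda>j. lower_order g (w j) A) \<le> lower_order g v A"
  shows "converges_in_Lp q A w v"
proof -
  define G where "G z x = indicator A x * g x (z x)" for z x
  have G0: "0 \<le> G z x" for z x unfolding G_def by (rule g_A_nonneg)
  have Gi: "integrable lebesgue (G z)" if "z \<in> L0 A" "lower_order g z A < \<infinity>" for z
    using that g_comp_measurable[OF that(1)] g_A_nonneg
    by (simp add: integrable_iff_bounded G_def[abs_def] lower_order_eq)
  have "(\<lambda>j. \<integral>\<^sup>+x. ennreal (norm (G (w j) x - G v x)) \<partial>lebesgue) \<longlonglongrightarrow> 0"
  proof (rule Scheffe_lemma1)
    show "AE x in lebesgue. (\<lambda>j. G (w j) x) \<longlonglongrightarrow> G v x" unfolding G_def by (rule g_limit[OF lim])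
    show "limsup (\<lambda>j. \<integral>\<^sup>+x. ennreal (norm (G (w j) x)) \<partial>lebesgue) \<le> (\<integral>\<^sup>+x. ennreal (norm (G v x)) \<partial>lebesgue)"
      using ls G0 unfolding lower_order_eq by (simp add: G_def[symmetric])
  qed (intro Gi w v)+
  note L1 = this
  define c where "c = 2 powr q / c1"
  have c: "0 < c" using c1 by (simp add: c_def)
  \<comment> \<open>\<open>H\<close> is the integrable part of the bound \<open>DH\<close> below; the rest of that bound tends to zero in \<open>L\<^sup>1\<close>.\<close>
  define H where "H x = c * (2 * G v x + 2 * \<bar>indicator A x * a1 x\<bar>)" for x
  have Hi: "integrable lebesgue H"
    unfolding H_def[abs_def]
    by (intro integrable_mult_right Bochner_Integration.integrable_add Gi v integrable_abs integrable_Omega_A a1_a2)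
  have H0: "0 \<le> H x" for x unfolding H_def using c G0 by simp
  define D where "D j x = indicator A x * \<bar>w j x - v x\<bar> powr q" for j x
  have D0: "0 \<le> D j x" for j x by (simp add: D_def)
  have Dm: "D j \<in> borel_measurable lebesgue" for j
  proof -
    have "(\<lambda>x. w j x - v x) \<in> L0 A" using w(1) v(1) unfolding L0_def by (intro borel_measurable_diff)
    from powr_measurable[OF this] show ?thesis by (simp add: D_def[abs_def])
  qed
  have DH: "AE x in lebesgue. D j x \<le> H x + c * \<bar>G (w j) x - G v x\<bar>" for j
    using g_growth_A
  proof eventually_elim
    case (elim x)
    show ?case
    proof (cases "x \<in> A")
      case True
      then have "c1 * \<bar>s\<bar> powr q \<le> g x s + \<bar>a1 x\<bar>" for s using elim by (smt (verit))
      then have bd: "\<bar>s\<bar> powr q \<le> (g x s + \<bar>a1 x\<bar>) / c1" for s using c1 by (simp add: pos_le_divide_eq mult.commute)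
      have "D j x \<le> 2 powr q * (\<bar>w j x\<bar> powr q + \<bar>v x\<bar> powr q)"
        using powr_diff_le[OF q] True by (simp add: D_def)
      also have "\<dots> \<le> 2 powr q * ((g x (w j x) + \<bar>a1 x\<bar>) / c1 + (g x (v x) + \<bar>a1 x\<bar>) / c1)"
        by (intro mult_left_mono add_mono bd) simp
      also have "\<dots> = c * (g x (w j x) + g x (v x) + 2 * \<bar>a1 x\<bar>)"
        by (simp add: c_def add_divide_distrib algebra_simps)
      also have "\<dots> \<le> c * (\<bar>g x (w j x) - g x (v x)\<bar> + 2 * g x (v x) + 2 * \<bar>a1 x\<bar>)"
        using c by (intro mult_left_mono) auto
      also have "\<dots> = H x + c * \<bar>G (w j) x - G v x\<bar>"
        using True by (simp add: H_def G_def algebra_simps)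
      finally show ?thesis .
    next
      case False
      then show ?thesis using H0[of x] c by (simp add: D_def G_def)
    qed
  qed
  \<comment> \<open>From \<open>D \<le> H + d\<close> with \<open>d \<ge> 0\<close> follows \<open>D \<le> min D H + d\<close>, and \<open>min D H\<close> is dominated by \<open>H\<close>.\<close>
  have min0: "(\<lambda>j. \<integral>\<^sup>+x. ennreal (min (D j x) (H x)) \<partial>lebesgue) \<longlonglongrightarrow> (\<integral>\<^sup>+x. 0 \<partial>(lebesgue :: 'a measure))"
  proof (rule nn_integral_dominated_convergence)
    show "(\<lambda>x. ennreal (min (D j x) (H x))) \<in> borel_measurable lebesgue" for j
      using Dm borel_measurable_integrable[OF Hi] by measurable
    show "(\<lambda>x. ennreal (H x)) \<in> borel_measurable lebesgue"
      using borel_measurable_integrable[OF Hi] by measurable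
    show "(\<integral>\<^sup>+x. ennreal (H x) \<partial>lebesgue) < \<infinity>"
      using Hi H0 by (simp add: integrable_iff_bounded)
    show "AE x in lebesgue. ennreal (min (D j x) (H x)) \<le> ennreal (H x)" for j
      by (intro AE_I2 ennreal_leI) simp
    show "AE x in lebesgue. (\<lambda>j. ennreal (min (D j x) (H x))) \<longlonglongrightarrow> 0"
      using lim
    proof eventually_elim
      case (elim x)
      have "(\<lambda>j. D j x) \<longlonglongrightarrow> 0"
      proof (cases "x \<in> A")
        case True
        then have "(\<lambda>j. \<bar>w j x - v x\<bar>) \<longlonglongrightarrow> 0" using elim by (simp add: LIM_zero tendsto_rabs_zero)
        from tendsto_powr'[OF this tendsto_const, of q] q True show ?thesis by (simp add: D_def)
      qed (simp add: D_def)
      then have "(\<lambda>j. min (D j x) (H x)) \<longlonglongrightarrow> min 0 (H x)" by (intro tendsto_min tendsto_const)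
      from tendsto_ennrealI[OF this] show ?case using H0[of x] by (simp add: min_def)
    qed
  qed simp
  have Gm: "(\<lambda>x. ennreal (norm (G (w j) x - G v x))) \<in> borel_measurable lebesgue" for j
    using borel_measurable_integrable[OF Gi[OF w(1,2)]] borel_measurable_integrable[OF Gi[OF v]] by measurable
  have mm: "(\<lambda>x. ennreal (min (D j x) (H x))) \<in> borel_measurable lebesgue" for j
    using Dm borel_measurable_integrable[OF Hi] by measurable
  have upper: "(\<integral>\<^sup>+x. ennreal (D j x) \<partial>lebesgue) \<le> (\<integral>\<^sup>+x. ennreal (min (D j x) (H x)) \<partial>lebesgue)
      + ennreal c * (\<integral>\<^sup>+x. ennreal (norm (G (w j) x - G v x)) \<partial>lebesgue)" for j
  proof -
    have "(\<integral>\<^sup>+x. ennreal (D j x) \<partial>lebesgue) \<le> (\<integral>\<^sup>+x. ennreal (min (D j x) (H x)) + ennreal c * ennreal (norm (G (w j) x - G v x)) \<partial>lebesgue)"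
    proof (rule nn_integral_mono_AE, use DH[of j] in eventually_elim)
      case (elim x)
      have "D j x \<le> min (D j x) (H x) + c * norm (G (w j) x - G v x)"
        using elim c by (auto simp: min_def)
      from ennreal_leI[OF this] show ?case using c D0[of j x] H0[of x]
        by (simp add: ennreal_plus ennreal_mult)
    qed
    also have "\<dots> = (\<integral>\<^sup>+x. ennreal (min (D j x) (H x)) \<partial>lebesgue) + ennreal c * (\<integral>\<^sup>+x. ennreal (norm (G (w j) x - G v x)) \<partial>lebesgue)"
      using mm Gm by (simp add: nn_integral_add nn_integral_cmult)
    finally show ?thesis .
  qed
  have "(\<lambda>j. \<integral>\<^sup>+x. ennreal (D j x) \<partial>lebesgue) \<longlonglongrightarrow> 0"
  proof (rule tendsto_sandwich[OF _ _ tendsto_const])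
    show "\<forall>\<^sub>F j in sequentially. (\<integral>\<^sup>+x. ennreal (D j x) \<partial>lebesgue) \<le> (\<integral>\<^sup>+x. ennreal (min (D j x) (H x)) \<partial>lebesgue)
      + ennreal c * (\<integral>\<^sup>+x. ennreal (norm (G (w j) x - G v x)) \<partial>lebesgue)"
      by (intro always_eventually allI upper)
    have "(\<lambda>j. ennreal c * (\<integral>\<^sup>+x. ennreal (norm (G (w j) x - G v x)) \<partial>lebesgue)) \<longlonglongrightarrow> ennreal c * 0"
      by (rule ennreal_tendsto_cmult[OF _ L1]) simp
    from tendsto_add[OF min0 this]
    show "(\<lambda>j. (\<integral>\<^sup>+x. ennreal (min (D j x) (H x)) \<partial>lebesgue)
      + ennreal c * (\<integral>\<^sup>+x. ennreal (norm (G (w j) x - G v x)) \<partial>lebesgue)) \<longlonglongrightarrow> 0" by simp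
  qed simp
  moreover have "(\<integral>\<^sup>+x\<in>A. ennreal (norm (w j x - v x) powr q) \<partial>lebesgue) = (\<integral>\<^sup>+x. ennreal (D j x) \<partial>lebesgue)" for j
    by (rule nn_integral_cong) (simp add: D_def indicator_def)
  ultimately show ?thesis
    using Lp_q_A w v by (simp add: converges_in_Lp_def)
qed

lemma minimisers_converge:
  assumes u: "\<And>j. is_arg_min (energy_crack p f g (K j) A) (\<lambda>v. v \<in> adm j) (u j)"
  shows "\<exists>r v. strict_mono r \<and> converges_in_Lp q A (\<lambda>j. u (r j)) v \<and>
                 is_arg_min (energy_meas p f g M \<mu> A) (\<lambda>w. w \<in> deny_lions p (A - M)) v"
proof -
  have ua: "u j \<in> adm j" for j using u[of j] by (simp add: is_arg_min_def)
  have um: "E j (u j) = m j" for j by (rule is_arg_min_INF[OF u])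
  have EB: "E j (u j) \<le> zero_energy" for j unfolding um by (rule minimum_le_zero_energy)
  obtain k v where k: "strict_mono (k :: nat \<Rightarrow> nat)" and v: "v \<in> L0 A" "v \<in> deny_lions p (A - M)"
    "AE x in lebesgue. x \<in> A \<longrightarrow> (\<lambda>j. u (k j) x) \<longlonglongrightarrow> v x"
    "E\<^sub>0 v \<le> liminf (\<lambda>j. E (k j) (u (k j)))"
    by (rule bounded_energy_subseq[where r = "\<lambda>j. j", OF ua _ EB zero_energy_finite]) (auto simp: strict_mono_def)
  have mk: "(\<lambda>j. E (k j) (u (k j))) \<longlonglongrightarrow> m\<^sub>0"
    using LIMSEQ_subseq_LIMSEQ[OF minima_converge k] by (simp add: um o_def)
  have "E\<^sub>0 v \<le> m\<^sub>0" using v(4) lim_imp_Liminf[OF _ mk] by simp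
  moreover have "m\<^sub>0 \<le> E\<^sub>0 v" by (rule INF_lower[OF v(2)])
  ultimately have Ev: "E\<^sub>0 v = m\<^sub>0" by (rule antisym)
  have mk': "(\<lambda>j. E (k j) (u (k j))) \<longlonglongrightarrow> E\<^sub>0 v" unfolding Ev by (rule mk)
  have "is_arg_min (energy_meas p f g M \<mu> A) (\<lambda>w. w \<in> deny_lions p (A - M)) v"
    unfolding is_arg_min_def using v(2) INF_lower[of _ "deny_lions p (A - M)" "energy_meas p f g M \<mu> A"]
    by (auto simp: Ev not_less)
  moreover have "converges_in_Lp q A (\<lambda>j. u (k j)) v"
  proof (rule converges_in_Lq[OF _ _ v(1) _ v(3)])
    show uL: "u (k j) \<in> L0 A" for j using ua by (simp add: admissible_crack_def)
    have "lower_order g (u (k j)) A \<le> E (k j) (u (k j))" for j by (simp add: energy_crack_def)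
    then show "lower_order g (u (k j)) A < \<infinity>" for j using EB zero_energy_finite by (meson le_less_trans order_trans)
    have "m\<^sub>0 \<le> zero_energy" by (rule LIMSEQ_le_const2[OF mk]) (use EB in blast)
    then have fin: "F_meas p f M \<mu> v A + lower_order g v A < \<infinity>"
      using Ev zero_energy_finite unfolding energy_meas_def by (metis le_less_trans)
    then show "lower_order g v A < \<infinity>" by (simp add: less_top)
    show "limsup (\<lambda>j. lower_order g (u (k j)) A) \<le> lower_order g v A"
    proof (rule limsup_le_of_sum_converges)
      show "(\<lambda>j. F_crack p f (K (k j)) (u (k j)) A + lower_order g (u (k j)) A) \<longlonglongrightarrow> F_meas p f M \<mu> v A + lower_order g v A"
        using mk' unfolding energy_crack_def energy_meas_def .
      show "F_meas p f M \<mu> v A \<le> liminf (\<lambda>j. F_crack p f (K (k j)) (u (k j)) A)"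
        by (rule gamma_liminf[OF k uL v(1,3)])
      show "F_meas p f M \<mu> v A < \<infinity>" using fin by (simp add: less_top)
    qed
  qed
  ultimately show ?thesis using k by blast
qed

end

section \<open>Convergence of minima and minimisers\<close>

theorem theorem3p5:
  fixes \<Omega> M A :: "'a::euclidean_space set"
    and p q lam Lam c1 c2 :: real
    and f :: "'a \<Rightarrow> real"
    and g :: "'a \<Rightarrow> real \<Rightarrow> real"
    and a1 a2 :: "'a \<Rightarrow> real"
    and K :: "nat \<Rightarrow> 'a set"
    and \<mu> :: "'a measure"
  assumes dim: "2 \<le> DIM('a)"
    and Omega: "open \<Omega>" "bounded \<Omega>"
    and p: "1 < p" "p \<le> real DIM('a)"
    and f_nonneg: "\<And>\<xi>. 0 \<le> f \<xi>"
    and f_convex: "convex_on UNIV f"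
    and f_even: "\<And>\<xi>. f (- \<xi>) = f \<xi>"
    and f_homogeneous: "\<And>t \<xi>. 0 < t \<Longrightarrow> f (t *\<^sub>R \<xi>) = t powr p * f \<xi>"
    and lam_Lam: "0 < lam" "lam < Lam"
    and f_growth: "\<And>\<xi>. lam * norm \<xi> powr p \<le> f \<xi>" "\<And>\<xi>. f \<xi> \<le> Lam * norm \<xi> powr p"
    and M: "M \<subseteq> \<Omega>" "compact M" "C1_hypersurface_with_boundary M"
    and q: "1 \<le> q"
    and g_nonneg: "\<And>x s. x \<in> \<Omega> \<Longrightarrow> 0 \<le> g x s"
    and g_measurable: "\<And>s. (\<lambda>x. g x s) \<in> borel_measurable (lebesgue_on \<Omega>)"
    and g_continuous: "AE x in lebesgue_on \<Omega>. continuous_on UNIV (g x)"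
    and c1_c2: "0 < c1" "c1 < c2"
    and a1_a2: "integrable (lebesgue_on \<Omega>) a1" "integrable (lebesgue_on \<Omega>) a2"
    and g_growth: "AE x in lebesgue_on \<Omega>. \<forall>s. c1 * \<bar>s\<bar> powr q - a1 x \<le> g x s \<and>
                     g x s \<le> c2 * (1 + \<bar>s\<bar> powr q + a2 x)"
    and K_compact: "\<And>j. compact (K j)"
    and K_to_M: "(\<lambda>j. SUP x\<in>K j. INF y\<in>M. ennreal (dist x y)) \<longlonglongrightarrow> 0"
    and mu: "\<mu> \<in> M_p p \<Omega> M"
    and A: "open A" "A \<subseteq> \<Omega>"
    and Gamma: "gamma_converges (L0 \<Omega>) (converges_in_measure \<Omega>)
                  (\<lambda>j u. F_crack p f (K j) u A) (\<lambda>u. F_meas p f M \<mu> u A)"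
  shows "(\<forall>u. (\<forall>j. is_arg_min (energy_crack p f g (K j) A)
                      (\<lambda>v. v \<in> admissible_crack p (K j) A) (u j)) \<longrightarrow>
              (\<exists>r v. strict_mono r \<and> converges_in_Lp q A (\<lambda>j. u (r j)) v \<and>
                 is_arg_min (energy_meas p f g M \<mu> A) (\<lambda>w. w \<in> deny_lions p (A - M)) v)) \<and>
         (\<lambda>j. INF u \<in> admissible_crack p (K j) A. energy_crack p f g (K j) A u)
           \<longlonglongrightarrow> (INF u \<in> deny_lions p (A - M). energy_meas p f g M \<mu> A u)"
proof -
  interpret crack_setting \<Omega> M A p q lam Lam c1 c2 f g a1 a2 K \<mu>
  proof
    show "negligible M" by (rule negligible_C1_hypersurface[OF M(3)])
    show "0 < c2" using c1_c2 by simp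
  qed (use assms in blast)+
  show ?thesis
    by (intro conjI allI impI minimisers_converge minima_converge) (erule spec)
qed

end
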